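(* Let $d\ge2$ and let $F\subset\mathbb{R}^d$ be a self-similar set, not contained in any $(d-1)$-dimensional hyperplane, that is the attractor of an IFS $\mathcal S=\{S_1,\dots,S_m\}$ that does not satisfy the weak separation property. Overlapping directions below are overlapping directions for $\mathcal S$. \begin{enumerate} \item If $\{O_\gamma:\gamma\in\mathcal I^\ast\}$ is dense in $O(d)$ or in $SO(d)$, then $\dim_A F=d$. Moreover, for any $\pi\in G_{d,k}$ we have $\dim_A\pi F=k$. \item If there is an overlapping direction $v$ not contained in any invariant subspace of dimension $1$ of some $O\in G$, then $\dim_A F\ge2$. \item If $d=2$ and the orthogonal part of one of the similitudes of the IFS is a rotation by an angle different from $0$ and $\pi$, then $\dim_A F=2$. \item Assume $d=3$ and that the orthogonal part $O$ of one of the similitudes of the IFS contains a rotation by an angle different from $0$ and $\pi$. \begin{enumerate} \item If there is an overlapping direction not contained in a nontrivial invariant subspace of $O$, then $\dim_A F=3$. \item If an overlapping direction is contained in the $2$-dimensional invariant subspace of $O$, then $\dim_A F>2$. \end{enumerate} \end{enumerate}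
   Context: IFS and attractor: an IFS is a finite family $\mathcal S=\{S_1,\dots,S_m\}$ of contractive similitudes of $\mathbb{R}^d$, $S_i(x)=c_iO_ix+b_i$ with $c_i\in(0,1)$, $O_i$ a $d\times d$ orthogonal matrix (the orthogonal part of $S_i$), $b_i\in\mathbb{R}^d$. Its attractor is the unique nonempty compact $F$ with $F=\bigcup_{i=1}^m S_i(F)$; such an $F$ is called a self-similar set. $\mathcal I=\{1,\dots,m\}$, $\mathcal I^\ast=\bigcup_{k\ge1}\mathcal I^k$, and for $\alpha=(i_1,\dots,i_k)\in\mathcal I^\ast$, $S_\alpha=S_{i_1}\circ\cdots\circ S_{i_k}$ and $O_\alpha=O_{i_1}\cdots O_{i_k}$. $G=\overline{\{O_\gamma:\gamma\in\mathcal I^\ast\}}$, a compact subgroup of the orthogonal group $O(d)$. Assouad dimension: $N_r(E)$ is the minimum number of closed balls of radius $r$ needed to cover $E$, $B(x,R)$ is the closed ball, and $\dim_A E$ is the infimum of the $\alpha$ for which there is a constant $c$ such that $\sup_{x\in E}N_r(B(x,R)\cap E)\le c(R/r)^\alpha$ for all $0<r<R$. Weak separation property (WSP): let $\mathcal E=\{S_\alpha^{-1}\circ S_\beta:\alpha,\beta\in\mathcal I^\ast,\alpha\ne\beta\}$, inside the group of similitudes with the topology of pointwise convergence. For $F$ not contained in any $(d-1)$-dimensional hyperplane, $\mathcal S$ satisfies the WSP if $I\notin\overline{\mathcal E\setminus\{I\}}$, where $I$ is the identity. Overlapping directions: $\|\cdot\|_\infty$ is the sup norm on $[0,1]^d$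 and $\|\cdot\|_{\mathrm{op}}$ the Euclidean operator norm. Suppose $\mathcal S$ does not satisfy the WSP. Take any sequences $\alpha_k,\beta_k\in\mathcal I^\ast$ such that $\Phi_k:=S_{\alpha_k}^{-1}\circ S_{\beta_k}-I$ satisfies $0<\|\Phi_k\|_\infty\to0$ and such that, for some $a\in F$ and $\rho>0$, $\rho\|D\Phi_k\|_{\mathrm{op}}\le\|\Phi_k(a_k)\|$ for all $k$, where $a_k$ is any point of $B(a,\rho)$ minimizing $\|\Phi_k(x)\|$ over $x\in B(a,\rho)$. Any limit point $\omega\in S^{d-1}$ of $\{\Phi_k(a)/\|\Phi_k(a)\|\}_k$, for any such choice of data, is called an overlapping direction for $\mathcal S$. $G_{d,k}$ is the family of all orthogonal projections of $\mathbb{R}^d$ onto $k$-dimensional subspaces. A $3\times3$ orthogonal matrix $O$ "contains a rotation by an angle $\theta$" if in some orthonormal basis it is block diagonal with a $2\times2$ rotation block by the angle $\theta$ and a $1\times1$ block $\pm1$; for $\theta\neq0,\pi$ it has exactly one $2$-dimensional invariant subspace. Nontrivial invariant subspaces are those different from $\{0\}$ and $\mathbb{R}^3$. *)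

theory Defs
  imports "HOL-Analysis.Analysis"
begin

text \<open>The IFS consists of the maps \<open>S 1, \<dots>, S m\<close>, and \<open>Q i\<close> is the (uniquely determined) orthogonal
  part of \<open>S i\<close>. The values of \<open>S\<close> and \<open>Q\<close> outside \<open>{1..m}\<close> are irrelevant.\<close>

definition similitude_ifs ::
  "nat \<Rightarrow> (nat \<Rightarrow> real^'n \<Rightarrow> real^'n) \<Rightarrow> (nat \<Rightarrow> real^'n^'n) \<Rightarrow> bool" where
  "similitude_ifs m S Q \<longleftrightarrow> 1 \<le> m \<and>
     (\<forall>i\<in>{1..m}. orthogonal_matrix (Q i) \<and>
        (\<exists>c b. 0 < c \<and> c < 1 \<and> S i = (\<lambda>x. c *\<^sub>R (Q i *v x) + b)))"

text \<open>By Hutchinson's theorem, an IFS has exactly one attractor.\<close>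

definition attractor :: "nat \<Rightarrow> (nat \<Rightarrow> real^'n \<Rightarrow> real^'n) \<Rightarrow> (real^'n) set \<Rightarrow> bool" where
  "attractor m S F \<longleftrightarrow> compact F \<and> F \<noteq> {} \<and> F = (\<Union>i\<in>{1..m}. S i ` F)"

definition index_words :: "nat \<Rightarrow> nat list set" where
  "index_words m = {w. w \<noteq> [] \<and> set w \<subseteq> {1..m}}"

definition word_map :: "(nat \<Rightarrow> 'a \<Rightarrow> 'a) \<Rightarrow> nat list \<Rightarrow> 'a \<Rightarrow> 'a" where
  "word_map S w = foldr (\<lambda>i f. S i \<circ> f) w id"

definition word_orth :: "(nat \<Rightarrow> real^'n^'n) \<Rightarrow> nat list \<Rightarrow> real^'n^'n" where
  "word_orth Q w = foldr (\<lambda>i A. Q i ** A) w (mat 1)"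

definition orth_parts :: "nat \<Rightarrow> (nat \<Rightarrow> real^'n^'n) \<Rightarrow> (real^'n^'n) set" where
  "orth_parts m Q = word_orth Q ` index_words m"

definition orth_group :: "nat \<Rightarrow> (nat \<Rightarrow> real^'n^'n) \<Rightarrow> (real^'n^'n) set" where
  "orth_group m Q = closure (orth_parts m Q)"

definition dense_in_set :: "'a::topological_space set \<Rightarrow> 'a set \<Rightarrow> bool" where
  "dense_in_set A X \<longleftrightarrow> A \<subseteq> X \<and> X \<subseteq> closure A"

definition in_some_hyperplane :: "(real^'n) set \<Rightarrow> bool" where
  "in_some_hyperplane F \<longleftrightarrow> (\<exists>H. affine H \<and> aff_dim H = int CARD('n) - 1 \<and> F \<subseteq> H)"

definition quotient_maps ::
  "nat \<Rightarrow> (nat \<Rightarrow> real^'n \<Rightarrow> real^'n) \<Rightarrow> (real^'n \<Rightarrow> real^'n) set" where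
  "quotient_maps m S = {inv (word_map S \<alpha>) \<circ> word_map S \<beta> | \<alpha> \<beta>.
     \<alpha> \<in> index_words m \<and> \<beta> \<in> index_words m \<and> \<alpha> \<noteq> \<beta>}"

text \<open>The topology on the function type is the product topology, that is, the topology of pointwise
  convergence. As the identity is a similitude, it does not matter whether the closure is taken
  among all functions or among the similitudes.\<close>

definition weak_separation :: "nat \<Rightarrow> (nat \<Rightarrow> real^'n \<Rightarrow> real^'n) \<Rightarrow> bool" where
  "weak_separation m S \<longleftrightarrow> id \<notin> closure (quotient_maps m S - {id})"

definition displacement ::
  "(nat \<Rightarrow> real^'n \<Rightarrow> real^'n) \<Rightarrow> nat list \<Rightarrow> nat list \<Rightarrow> real^'n \<Rightarrow> real^'n" where
  "displacement S \<alpha> \<beta> x = inv (word_map S \<alpha>) (word_map S \<beta> x) - x"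

text \<open>In \<^term>\<open>cbox 0 1 :: (real^'n) set\<close>, the bound \<open>1\<close> is the all-ones vector, so this is the unit cube.\<close>

definition cube_norm :: "(real^'n \<Rightarrow> real^'n) \<Rightarrow> real" where
  "cube_norm f = (SUP x\<in>cbox 0 1. norm (f x))"

text \<open>The maps \<open>displacement S (\<alpha> k) (\<beta> k)\<close> are affine, so their derivative does not depend on the
  point at which it is taken; below it is taken at \<open>0\<close>. Limit points are those of the sequence, that is,
  limits of subsequences.\<close>

definition overlapping_direction ::
  "nat \<Rightarrow> (nat \<Rightarrow> real^'n \<Rightarrow> real^'n) \<Rightarrow> (real^'n) set \<Rightarrow> real^'n \<Rightarrow> bool" where
  "overlapping_direction m S F \<omega> \<longleftrightarrow> \<omega> \<in> sphere 0 1 \<and>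
     (\<exists>\<alpha> \<beta> \<Phi> a \<rho> a' r.
        (\<forall>k::nat. \<alpha> k \<in> index_words m \<and> \<beta> k \<in> index_words m \<and>
           \<Phi> k = displacement S (\<alpha> k) (\<beta> k)) \<and>
        (\<forall>k. 0 < cube_norm (\<Phi> k)) \<and> (\<lambda>k. cube_norm (\<Phi> k)) \<longlonglongrightarrow> 0 \<and>
        a \<in> F \<and> 0 < \<rho> \<and>
        (\<forall>k. is_arg_min (\<lambda>x. norm (\<Phi> k x)) (\<lambda>x. x \<in> cball a \<rho>) (a' k) \<and>
           \<rho> * onorm (frechet_derivative (\<Phi> k) (at 0)) \<le> norm (\<Phi> k (a' k))) \<and>
        strict_mono (r :: nat \<Rightarrow> nat) \<and>
        (\<lambda>j. (1 / norm (\<Phi> (r j) a)) *\<^sub>R \<Phi> (r j) a) \<longlonglongrightarrow> \<omega>)"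

text \<open>The centres of the balls need not lie in \<open>E\<close>. The definition is only used for bounded \<open>E\<close>, which
  has a finite cover because the space is Euclidean.\<close>

definition covering_number :: "real \<Rightarrow> 'a::euclidean_space set \<Rightarrow> nat" where
  "covering_number r E = (LEAST n. \<exists>C. finite C \<and> card C = n \<and> E \<subseteq> (\<Union>x\<in>C. cball x r))"

text \<open>For nonempty \<open>E\<close> the set of exponents contains \<open>DIM('a)\<close> and is bounded below by \<open>0\<close>, so
  the real-valued infimum is the genuine one.\<close>

definition assouad_dim :: "'a::euclidean_space set \<Rightarrow> real" where
  "assouad_dim E = Inf {\<alpha>. \<exists>c. \<forall>r R. 0 < r \<and> r < R \<longrightarrow>
     (\<forall>x\<in>E. real (covering_number r (cball x R \<inter> E)) \<le> c * (R / r) powr \<alpha>)}"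

definition orth_projections :: "nat \<Rightarrow> (real^'n \<Rightarrow> real^'n) set" where
  "orth_projections k = {p. \<exists>V. subspace V \<and> dim V = k \<and>
     (\<forall>x. p x \<in> V \<and> (\<forall>v\<in>V. orthogonal (x - p x) v))}"

definition invariant_subspace :: "real^'n^'n \<Rightarrow> (real^'n) set \<Rightarrow> bool" where
  "invariant_subspace A V \<longleftrightarrow> subspace V \<and> (\<forall>x\<in>V. A *v x \<in> V)"

definition rotates_pair :: "real^'n^'n \<Rightarrow> real \<Rightarrow> real^'n \<Rightarrow> real^'n \<Rightarrow> bool" where
  "rotates_pair A \<theta> u v \<longleftrightarrow>
     norm u = 1 \<and> norm v = 1 \<and> orthogonal u v \<and>
     A *v u = cos \<theta> *\<^sub>R u + sin \<theta> *\<^sub>R v \<and> A *v v = - sin \<theta> *\<^sub>R u + cos \<theta> *\<^sub>R v"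

text \<open>For \<open>d = 2\<close>: in some orthonormal basis, \<open>A\<close> is the rotation matrix of angle \<open>\<theta>\<close>. As either
  orientation of the basis is allowed, \<open>\<theta>\<close> is determined up to sign, which does not affect
  whether it is \<open>0\<close> or \<open>\<pi>\<close> modulo \<open>2\<pi>\<close>.\<close>

definition plane_rotation :: "real^'n^'n \<Rightarrow> real \<Rightarrow> bool" where
  "plane_rotation A \<theta> \<longleftrightarrow> (\<exists>u v. rotates_pair A \<theta> u v \<and> span {u, v} = UNIV)"

text \<open>For \<open>d = 3\<close>: in the orthonormal basis \<open>u, v, w\<close>, \<open>A\<close> is block diagonal with a rotation block
  and a block \<open>1\<close> or \<open>-1\<close>.\<close>

definition contains_rotation :: "real^'n^'n \<Rightarrow> real \<Rightarrow> bool" where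
  "contains_rotation A \<theta> \<longleftrightarrow> (\<exists>u v w. rotates_pair A \<theta> u v \<and>
     norm w = 1 \<and> orthogonal u w \<and> orthogonal v w \<and> span {u, v, w} = UNIV \<and>
     (A *v w = w \<or> A *v w = - w))"

end

theory Submission
  imports Defs
begin

text \<open>If the weak separation property fails, then some maps \<open>S\<^sub>\<alpha>\<^sup>-\<^sup>1 \<circ> S\<^sub>\<beta> = I + \<Phi>\<close> are arbitrarily small
  perturbations of the identity. Near a suitable point \<open>a\<close> of \<open>F\<close>, the displacement \<open>\<Phi>\<close> is almost the constant
  vector \<open>\<Phi> a\<close>, whose direction is close to an overlapping direction \<open>\<omega>\<close>. Conjugating with \<open>S\<^sub>\<gamma>\<close> magnifies \<open>\<Phi>\<close>
  and rotates it by \<open>O\<^sub>\<gamma>\<^sup>-\<^sup>1\<close>, so magnified copies of \<open>F\<close> approximately contain \<open>F \<union> (F + v)\<close> for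
  short vectors \<open>v\<close> pointing in almost any prescribed direction \<open>g \<omega>\<close>, \<open>g \<in> G\<close>. Iterating, they approximately contain
  \<open>F + [0,1] g\<^sub>1 \<omega> + \<dots> + [0,1] g\<^sub>l \<omega>\<close>, and counting separated points gives \<open>dim\<^sub>A F \<ge> l\<close> if the vectors
  \<open>g\<^sub>i \<omega>\<close> are linearly independent. If moreover they do not span the whole space, then
  the projection of \<open>F\<close> to an orthogonal line still has positive dimension, which makes the inequality strict.\<close>


section \<open>Matrices and linear maps\<close>

text \<open>Lower bounds only require that magnified copies of \<open>F\<close> come close to every
  point of \<open>E\<close>, so the approximation is one-sided. The pair of translates arises
  because one point \<open>q\<close> of \<open>F\<close> is seen through two words:
  \<open>SW \<alpha> q\<close> and \<open>SW \<beta> q = SW \<alpha> (q + \<Phi> q)\<close> both lie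
  in \<open>F\<close>. The obstacle is the control of the translation \<open>v\<close>.
  Magnifications take discrete values, and the word that steers the direction of \<open>v\<close>
  can be chosen only after the magnification, so the length of \<open>v\<close> is known only up to
  a constant factor. What matters is that this factor depends neither on \<open>E\<close> nor on the
  accuracy: then finitely many short steps cross a segment of length 1. The uniformity comes from
  the compactness of \<open>G\<close>, all of whose elements are approximated by finitely many
  words. Steering needs inverses in \<open>G\<close>, hence that the closed semigroup is a
  group.\<close>

lemma norm_matrix_vector_le: "norm (A *v x) \<le> norm A * norm x" for A :: "real^'n^'m"
proof -
  have "norm (A *v x) \<le> L2_set (\<lambda>i. norm (A $ i) * norm x) UNIV"
    unfolding norm_vec_def[of "A *v x"]
  proof (rule L2_set_mono)
    show "norm ((A *v x) $ i) \<le> norm (A $ i) * norm x" for i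
      unfolding matrix_vector_mul_component real_norm_def by (rule Cauchy_Schwarz_ineq2)
  qed simp
  also have "\<dots> = norm A * norm x"
    unfolding norm_vec_def[of A] by (subst L2_set_left_distrib) (auto simp: mult.commute)
  finally show ?thesis .
qed

lemma tendsto_matrix_mult:
  fixes X :: "'a \<Rightarrow> real^'n^'m" and Y :: "'a \<Rightarrow> real^'k^'n"
  assumes "(X \<longlongrightarrow> A) net" "(Y \<longlongrightarrow> B) net"
  shows "((\<lambda>n. X n ** Y n) \<longlongrightarrow> A ** B) net"
  unfolding matrix_matrix_mult_def
  by (intro vec_tendstoI) (auto intro!: tendsto_sum tendsto_mult tendsto_vec_nth assms)

lemma tendsto_transpose:
  fixes X :: "'a \<Rightarrow> real^'n^'m"
  assumes "(X \<longlongrightarrow> A) net"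
  shows "((\<lambda>n. transpose (X n)) \<longlongrightarrow> transpose A) net"
  unfolding transpose_def
  by (intro vec_tendstoI) (auto intro!: tendsto_vec_nth assms)

lemma norm_orthogonal_matrix_mult:
  fixes A :: "real^'n^'n"
  assumes "orthogonal_matrix A"
  shows "norm (A *v x) = norm x"
proof -
  have "orthogonal_transformation ((*v) A)"
    using assms by (simp add: orthogonal_transformation_matrix matrix_of_matrix_vector_mul)
  then show ?thesis
    by (rule orthogonal_transformation_norm)
qed

lemma transpose_cancel:
  fixes A :: "real^'n^'n"
  assumes "orthogonal_matrix A"
  shows "transpose A *v (A *v x) = x" "A *v (transpose A *v x) = x"
  using assms by (auto simp: orthogonal_matrix_def matrix_vector_mul_assoc simp del: vector_transpose_matrix transpose_matrix_vector)

lemma compact_orthogonal_matrices: "compact {A :: real^'n^'n. orthogonal_matrix A}"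
proof -
  have "closed {A :: real^'n^'n. orthogonal_matrix A}"
    unfolding closed_sequential_limits
  proof (intro allI impI, elim conjE)
    fix X and A :: "real^'n^'n"
    assume X: "\<forall>n. X n \<in> {A. orthogonal_matrix A}" "X \<longlonglongrightarrow> A"
    have "(\<lambda>n. transpose (X n) ** X n) \<longlonglongrightarrow> transpose A ** A"
      by (intro tendsto_matrix_mult tendsto_transpose X)
    then have "(\<lambda>n. mat 1) \<longlonglongrightarrow> transpose A ** A"
      using X(1) by (simp add: orthogonal_matrix)
    then show "A \<in> {A. orthogonal_matrix A}"
      by (simp add: orthogonal_matrix LIMSEQ_const_iff)
  qed
  moreover have "bounded {A :: real^'n^'n. orthogonal_matrix A}"
    unfolding bounded_iff
  proof (intro exI ballI)
    fix A :: "real^'n^'n" assume "A \<in> {A. orthogonal_matrix A}"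
    then have "norm (A $ i) = 1" for i
      by (auto simp: orthogonal_matrix_orthonormal_rows row_def)
    then show "norm A \<le> L2_set (\<lambda>i::'n. 1) UNIV"
      by (simp add: norm_vec_def[of A])
  qed
  ultimately show ?thesis
    by (simp add: compact_eq_bounded_closed)
qed

lemma tendsto_matrix_vector_mult:
  fixes X :: "'a \<Rightarrow> real^'n^'m"
  assumes "(X \<longlongrightarrow> A) net"
  shows "((\<lambda>n. X n *v a) \<longlongrightarrow> A *v a) net"
  unfolding matrix_vector_mult_def
  by (intro vec_tendstoI) (auto intro!: tendsto_sum tendsto_mult tendsto_vec_nth assms)

text \<open>Each \<open>M *v axis i 1\<close> is a difference of two of the controlled values, which
  gives the factor 2. The test points 0 and \<open>axis i 1\<close> lie in the unit cube and are
  finitely many, so the bound serves both for a small cube norm and for pointwise closeness to the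
  identity.\<close>

lemma norm_affine_le:
  fixes M :: "real^'n^'n"
  assumes 0: "norm v \<le> N" and axis: "\<And>i. norm (M *v axis i 1 + v) \<le> N"
  shows "norm (M *v a + v) \<le> N * (1 + 2 * (\<Sum>i\<in>UNIV. \<bar>a $ i\<bar>))"
proof -
  have "M *v a = (\<Sum>i\<in>UNIV. (a $ i) *\<^sub>R (M *v axis i 1))"
    by (subst basis_expansion[of a, symmetric])
      (simp add: linear_sum[OF matrix_vector_mul_linear] scalar_mult_eq_scaleR matrix_vector_mult_scaleR)
  also have "norm \<dots> \<le> (\<Sum>i\<in>UNIV. \<bar>a $ i\<bar> * (2 * N))"
  proof (rule sum_norm_le)
    fix i :: 'n
    have "norm (M *v axis i 1) \<le> 2 * N"
      using 0 axis[of i] norm_triangle_ineq4[of "M *v axis i 1 + v" v] by simp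
    then show "norm ((a $ i) *\<^sub>R (M *v axis i 1)) \<le> \<bar>a $ i\<bar> * (2 * N)"
      by (simp add: mult_left_mono)
  qed
  also have "\<dots> = 2 * N * (\<Sum>i\<in>UNIV. \<bar>a $ i\<bar>)"
    by (simp add: sum_distrib_right[symmetric])
  finally have "norm (M *v a) \<le> 2 * N * (\<Sum>i\<in>UNIV. \<bar>a $ i\<bar>)" .
  then show ?thesis
    using 0 norm_triangle_ineq[of "M *v a" v] by (simp add: algebra_simps)
qed

lemma norm_le_cube_norm:
  fixes f :: "real^'n \<Rightarrow> real^'n"
  assumes "continuous_on UNIV f" "x \<in> cbox 0 1"
  shows "norm (f x) \<le> cube_norm f"
proof -
  have "compact ((\<lambda>x. norm (f x)) ` cbox 0 1)"
    using assms(1) by (intro compact_continuous_image continuous_intros) (auto intro: continuous_on_subset)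
  then have "bdd_above ((\<lambda>x. norm (f x)) ` cbox 0 1)"
    by (intro bounded_imp_bdd_above compact_imp_bounded)
  then show ?thesis
    unfolding cube_norm_def using assms(2) by (intro cSUP_upper)
qed

lemma axis_in_cube: "(axis i 1 :: real^'n) \<in> cbox 0 1"
  by (simp add: mem_box_cart axis_def)

lemma zero_in_cube: "(0 :: real^'n) \<in> cbox 0 1"
  by (simp add: mem_box_cart)

text \<open>If the map vanished on \<open>F\<close>, any nonzero row of \<open>M\<close> would
  define a hyperplane containing \<open>F\<close>. This supplies the base point at which a limit of
  normalised displacements does not vanish.\<close>

lemma affine_nonzero_on_nondegenerate:
  fixes M :: "real^'n^'n"
  assumes "\<not> in_some_hyperplane F" "F \<noteq> {}" "(M, v) \<noteq> 0"
  shows "\<exists>a\<in>F. M *v a + v \<noteq> 0"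
proof (rule ccontr)
  assume "\<not> ?thesis"
  then have zero: "M *v a + v = 0" if "a \<in> F" for a using that by blast
  have row: "M $ i \<bullet> a = - (v $ i)" if "a \<in> F" for a i
    using zero[OF that] by (metis add_eq_0_iff2 matrix_vector_mul_component vector_uminus_component)
  show False
  proof (cases "M = 0")
    case True
    then have "v = 0" using assms(2) zero by auto
    with True assms(3) show False by (simp add: zero_prod_def)
  next
    case False
    then obtain i where "M $ i \<noteq> 0" by (auto simp: vec_eq_iff[of M])
    then have "aff_dim {x. M $ i \<bullet> x = - (v $ i)} = int CARD('n) - 1"
      by (simp add: aff_dim_hyperplane)
    moreover have "affine {x. M $ i \<bullet> x = - (v $ i)}" by (rule affine_hyperplane)
    moreover have "F \<subseteq> {x. M $ i \<bullet> x = - (v $ i)}" using row by auto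
    ultimately show False using assms(1) unfolding in_some_hyperplane_def by blast
  qed
qed

text \<open>Coordinate functionals extend to bounded linear functionals on the whole space. The
  bound keeps grid points with coordinates in multiples of \<open>1 / N\<close> at mutual distance
  at least \<open>\<kappa> / N\<close>.\<close>

lemma independent_lower_bound:
  fixes B :: "'a::euclidean_space set"
  assumes "independent B"
  shows "\<exists>\<kappa>. 0 < \<kappa> \<and> \<kappa> \<le> 1 \<and> (\<forall>t. \<forall>b\<in>B. \<kappa> * \<bar>t b\<bar> \<le> norm (\<Sum>b\<in>B. t b *\<^sub>R b))"
proof -
  have fin: "finite B" using assms by (rule independent_imp_finite)
  have "\<exists>f::'a \<Rightarrow> real. \<exists>K>0. linear f \<and> (\<forall>b'\<in>B. f b' = (if b' = b then 1 else 0)) \<and> (\<forall>x. \<bar>f x\<bar> \<le> K * norm x)"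
    for b
  proof -
    obtain f :: "'a \<Rightarrow> real" where f: "linear f" "\<forall>b'\<in>B. f b' = (if b' = b then 1 else 0)"
      using linear_independent_extend[OF assms, of "\<lambda>b'. if b' = b then 1 else 0"] by blast
    obtain K where "0 < K" "\<And>x. norm (f x) \<le> K * norm x"
      using linear_bounded_pos[OF f(1)] by blast
    with f show ?thesis by (intro exI[of _ f] exI[of _ K]) auto
  qed
  then obtain f :: "'a \<Rightarrow> 'a \<Rightarrow> real" and K where
    K: "\<And>b. 0 < K b" and lin: "\<And>b. linear (f b)" and
    f: "\<And>b b'. b' \<in> B \<Longrightarrow> f b b' = (if b' = b then 1 else 0)" and
    bd: "\<And>b x. \<bar>f b x\<bar> \<le> K b * norm x"
    by metis
  \<comment> \<open>The summand 1 makes \<open>1 / T \<le> 1\<close> and keeps \<open>T\<close>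
    positive when \<open>B\<close> is empty.\<close>
  define T where "T = 1 + (\<Sum>b\<in>B. K b)"
  have sum0: "0 \<le> (\<Sum>b\<in>B. K b)" using K by (intro sum_nonneg) (auto intro: less_imp_le)
  have "1 / T * \<bar>t b\<bar> \<le> norm (\<Sum>b\<in>B. t b *\<^sub>R b)" if b: "b \<in> B" for t b
  proof -
    let ?x = "\<Sum>b\<in>B. t b *\<^sub>R b"
    have "f b ?x = (\<Sum>b'\<in>B. t b' * f b b')"
      using lin[of b] by (simp add: linear_sum linear_cmul)
    also have "\<dots> = (\<Sum>b'\<in>B. if b' = b then t b' else 0)"
      using f by (intro sum.cong) auto
    also have "\<dots> = t b" using fin b by simp
    finally have "\<bar>t b\<bar> \<le> K b * norm ?x" using bd[of b ?x] by simp
    also have "K b \<le> T"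
      using member_le_sum[of b B K] K fin b by (simp add: T_def less_imp_le add_increasing)
    then have "K b * norm ?x \<le> T * norm ?x" by (intro mult_right_mono) auto
    finally show ?thesis using sum0 by (simp add: T_def field_simps)
  qed
  moreover have "0 < 1 / T" "1 / T \<le> 1" using sum0 by (auto simp: T_def)
  ultimately show ?thesis by blast
qed

text \<open>The last power not below the threshold. It selects how often a fixed letter is repeated
  so that a magnified displacement has a prescribed size up to one factor \<open>q\<close>.\<close>

lemma power_between:
  fixes q t \<theta> :: real
  assumes "0 < q" "q < 1" "0 < \<theta>" "\<theta> \<le> t"
  shows "\<exists>n. t * q ^ Suc n < \<theta> \<and> \<theta> \<le> t * q ^ n"
proof -
  have "\<exists>n. q ^ n < \<theta> / t"
    using assms by (intro real_arch_pow_inv) auto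
  then have ex: "\<exists>n. t * q ^ n < \<theta>"
    using assms by (auto simp: field_simps)
  define N where "N = (LEAST n. t * q ^ n < \<theta>)"
  have N: "t * q ^ N < \<theta>"
    unfolding N_def using ex by (rule LeastI_ex)
  then obtain n where n: "N = Suc n"
    using assms(4) by (cases N) auto
  have "\<not> t * q ^ n < \<theta>"
    using not_less_Least[of n "\<lambda>n. t * q ^ n < \<theta>"] n by (simp add: N_def)
  with N n show ?thesis by (auto intro!: exI[of _ n])
qed

text \<open>Linearity is not part of \<open>orth_projections\<close>; it follows from uniqueness of
  the orthogonal decomposition: the difference of two candidates for \<open>p x\<close> lies in
  \<open>V\<close> and is orthogonal to itself.\<close>

lemma orth_projections_linear:
  assumes "subspace V" "\<And>x. p x \<in> V" "\<And>x v. v \<in> V \<Longrightarrow> orthogonal (x - p x) v"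
  shows "linear p" "\<And>v. v \<in> V \<Longrightarrow> p v = v"
proof -
  have eq: "p x = y" if "y \<in> V" "\<And>v. v \<in> V \<Longrightarrow> orthogonal (x - y) v" for x y
  proof -
    have "p x - y \<in> V" using assms(1,2) that(1) by (intro subspace_diff)
    then have "(x - y) \<bullet> (p x - y) = 0" "(x - p x) \<bullet> (p x - y) = 0"
      using assms(3) that(2) by (auto simp: orthogonal_def)
    then have "((x - y) - (x - p x)) \<bullet> (p x - y) = 0"
      by (simp only: inner_diff_left[of "x - y"])
    then show ?thesis by simp
  qed
  show "linear p"
  proof (rule linearI)
    fix x y
    show "p (x + y) = p x + p y"
    proof (rule eq)
      show "p x + p y \<in> V" using assms(1,2) by (intro subspace_add)
      show "orthogonal (x + y - (p x + p y)) v" if "v \<in> V" for v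
        using assms(3)[OF that, of x] assms(3)[OF that, of y]
        by (simp add: orthogonal_def inner_diff_left inner_add_left)
    qed
  next
    fix r x
    show "p (r *\<^sub>R x) = r *\<^sub>R p x"
    proof (rule eq)
      show "r *\<^sub>R p x \<in> V" using assms(1,2) by (intro subspace_scale)
      show "orthogonal (r *\<^sub>R x - r *\<^sub>R p x) v" if "v \<in> V" for v
        using assms(3)[OF that, of x] by (simp add: orthogonal_def inner_diff_left)
    qed
  qed
  show "p v = v" if "v \<in> V" for v
    using that by (intro eq) (auto simp: orthogonal_def)
qed

section \<open>Rotation blocks and their eigenvectors\<close>

lemma sin_nonzero: "\<theta> \<in> {0..<2*pi} - {0, pi} \<Longrightarrow> sin \<theta> \<noteq> 0"
  using sin_gt_zero[of \<theta>] sin_lt_zero[of \<theta>] by (cases "\<theta> < pi") auto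

lemma rotation_coeffs:
  assumes "rotates_pair A \<theta> u v"
  shows "A *v (x *\<^sub>R u + y *\<^sub>R v) = (x * cos \<theta> - y * sin \<theta>) *\<^sub>R u + (x * sin \<theta> + y * cos \<theta>) *\<^sub>R v"
proof -
  have "A *v u = cos \<theta> *\<^sub>R u + sin \<theta> *\<^sub>R v" "A *v v = - sin \<theta> *\<^sub>R u + cos \<theta> *\<^sub>R v"
    using assms by (simp_all only: rotates_pair_def)
  then have "A *v (x *\<^sub>R u + y *\<^sub>R v) =
      x *\<^sub>R (cos \<theta> *\<^sub>R u + sin \<theta> *\<^sub>R v) + y *\<^sub>R (- sin \<theta> *\<^sub>R u + cos \<theta> *\<^sub>R v)"
    by (simp only: matrix_vector_right_distrib matrix_vector_mult_scaleR)
  then show ?thesis by (simp add: algebra_simps)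
qed

text \<open>The cross product of (x, y) with its rotated image is
  \<open>sin \<theta> * (x\<^sup>2 + y\<^sup>2)\<close>, and it vanishes for an eigenvector.\<close>

lemma rotation_no_eigenvector:
  fixes x y k :: real
  assumes "x * cos \<theta> - y * sin \<theta> = k * x" "x * sin \<theta> + y * cos \<theta> = k * y" "sin \<theta> \<noteq> 0"
  shows "x = 0 \<and> y = 0"
proof -
  have "sin \<theta> * (x\<^sup>2 + y\<^sup>2) = x * (x * sin \<theta> + y * cos \<theta>) - y * (x * cos \<theta> - y * sin \<theta>)"
    by (simp add: power2_eq_square algebra_simps)
  also have "\<dots> = 0" unfolding assms(1,2) by simp
  finally show ?thesis using assms(3) by (simp add: sum_power2_eq_zero_iff)
qed

lemma span2_iff: "z \<in> span {u, v} \<longleftrightarrow> (\<exists>x y. z = x *\<^sub>R u + y *\<^sub>R v)"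
  for z :: "'a::real_vector"
  by (auto simp: span_insert algebra_simps)

lemma span3_iff: "z \<in> span {u, v, w} \<longleftrightarrow> (\<exists>x y t. z = x *\<^sub>R u + y *\<^sub>R v + t *\<^sub>R w)"
  for z :: "'a::real_vector"
proof -
  have "z \<in> span {u, v, w} \<longleftrightarrow> (\<exists>x. z - x *\<^sub>R u \<in> span {v, w})"
    by (simp add: span_insert[of u])
  also have "\<dots> \<longleftrightarrow> (\<exists>x y t. z - x *\<^sub>R u = y *\<^sub>R v + t *\<^sub>R w)"
    by (simp add: span2_iff)
  finally show ?thesis by (simp add: algebra_simps)
qed

lemma inner_rotates_pair:
  assumes "rotates_pair A \<theta> u v"
  shows "u \<bullet> u = 1" "v \<bullet> v = 1" "u \<bullet> v = 0" "v \<bullet> u = 0"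
  using assms by (auto simp: rotates_pair_def norm_eq_1 orthogonal_def inner_commute)

lemma rotates_pair_eigen:
  assumes rot: "rotates_pair A \<theta> u v" and "sin \<theta> \<noteq> 0"
    and eq: "A *v (x *\<^sub>R u + y *\<^sub>R v) = k *\<^sub>R (x *\<^sub>R u + y *\<^sub>R v)"
  shows "x = 0 \<and> y = 0"
proof (rule rotation_no_eigenvector[OF _ _ assms(2)])
  note i = inner_rotates_pair[OF rot]
  have eq': "(x * cos \<theta> - y * sin \<theta>) *\<^sub>R u + (x * sin \<theta> + y * cos \<theta>) *\<^sub>R v = k *\<^sub>R (x *\<^sub>R u + y *\<^sub>R v)"
    using eq by (simp only: rotation_coeffs[OF rot])
  show "x * cos \<theta> - y * sin \<theta> = k * x"
    using arg_cong[OF eq', of "\<lambda>z. z \<bullet> u"] i by (simp add: inner_add_left)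
  show "x * sin \<theta> + y * cos \<theta> = k * y"
    using arg_cong[OF eq', of "\<lambda>z. z \<bullet> v"] i by (simp add: inner_add_left)
qed

lemma plane_rotation_no_eigenvector:
  assumes "plane_rotation A \<theta>" "sin \<theta> \<noteq> 0" "z \<noteq> 0"
  shows "A *v z \<notin> span {z}"
proof
  assume "A *v z \<in> span {z}"
  then obtain k where k: "A *v z = k *\<^sub>R z" by (auto simp: span_singleton)
  obtain u v where uv: "rotates_pair A \<theta> u v" "span {u, v} = UNIV"
    using assms(1) by (auto simp: plane_rotation_def)
  then obtain x y where "z = x *\<^sub>R u + y *\<^sub>R v"
    using span2_iff[of z u v] by auto
  then show False
    using rotates_pair_eigen[OF uv(1) assms(2), of x y k] k assms(3) by auto
qed

text \<open>An eigenvector of \<open>A\<close> lies on the axis of the rotation, and an invariant plane containing the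
  axis would also contain the plane of the rotation.\<close>

lemma contains_rotation_no_eigenvector:
  assumes "contains_rotation A \<theta>" "sin \<theta> \<noteq> 0" "z \<noteq> 0"
    and V: "invariant_subspace A V" "dim V = 2" "z \<in> V"
  shows "A *v z \<notin> span {z}"
proof
  assume "A *v z \<in> span {z}"
  then obtain k where k: "A *v z = k *\<^sub>R z" by (auto simp: span_singleton)
  obtain u v w where uv: "rotates_pair A \<theta> u v" and w: "norm w = 1" "orthogonal u w" "orthogonal v w"
    "A *v w = w \<or> A *v w = - w" and span: "span {u, v, w} = UNIV"
    using assms(1) by (auto simp: contains_rotation_def)
  note i = inner_rotates_pair[OF uv]
  have iw: "u \<bullet> w = 0" "v \<bullet> w = 0" "w \<bullet> u = 0" "w \<bullet> v = 0" "w \<bullet> w = 1"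
    using w by (auto simp: orthogonal_def inner_commute norm_eq_1)
  obtain \<sigma> :: real where \<sigma>: "A *v w = \<sigma> *\<^sub>R w"
    using w(4) by (metis scaleR_one scaleR_minus1_left)
  have sub: "subspace V" and inv: "\<And>x. x \<in> V \<Longrightarrow> A *v x \<in> V"
    using V(1) by (auto simp: invariant_subspace_def)
  obtain x y t where z: "z = x *\<^sub>R u + y *\<^sub>R v + t *\<^sub>R w"
    using span3_iff[of z u v w] span by auto
  have Az: "A *v z = (x * cos \<theta> - y * sin \<theta>) *\<^sub>R u + (x * sin \<theta> + y * cos \<theta>) *\<^sub>R v + (t * \<sigma>) *\<^sub>R w"
    unfolding z matrix_vector_right_distrib[of A "x *\<^sub>R u + y *\<^sub>R v"] rotation_coeffs[OF uv]
    by (simp add: matrix_vector_mult_scaleR \<sigma>)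
  have eq: "(x * cos \<theta> - y * sin \<theta>) *\<^sub>R u + (x * sin \<theta> + y * cos \<theta>) *\<^sub>R v + (t * \<sigma>) *\<^sub>R w =
      k *\<^sub>R (x *\<^sub>R u + y *\<^sub>R v + t *\<^sub>R w)"
    using k Az z by simp
  have "x = 0 \<and> y = 0"
  proof (rule rotation_no_eigenvector[OF _ _ assms(2)])
    show "x * cos \<theta> - y * sin \<theta> = k * x"
      using arg_cong[OF eq, of "\<lambda>z. z \<bullet> u"] i iw by (simp add: inner_add_left)
    show "x * sin \<theta> + y * cos \<theta> = k * y"
      using arg_cong[OF eq, of "\<lambda>z. z \<bullet> v"] i iw by (simp add: inner_add_left)
  qed
  then have zt: "z = t *\<^sub>R w" "t \<noteq> 0" using z assms(3) by auto
  then have "w = (1 / t) *\<^sub>R z" by simp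
  then have wV: "w \<in> V" using sub V(3) by (simp add: subspace_scale)
  have "\<not> V \<subseteq> span {w}"
  proof
    assume "V \<subseteq> span {w}"
    then have "dim V \<le> card {w}" using wV by (intro span_card_ge_dim) auto
    with V(2) show False by simp
  qed
  \<comment> \<open>Removing the axial part of a vector off the axis leaves a nonzero
    \<open>s\<close> in \<open>V\<close> within the plane of rotation. Then \<open>s\<close>, its
    image and \<open>w\<close> are three independent vectors of the plane \<open>V\<close>.\<close>
  then obtain s0 where s0: "s0 \<in> V" "s0 \<notin> span {w}" by blast
  obtain x' y' t' where s0eq: "s0 = x' *\<^sub>R u + y' *\<^sub>R v + t' *\<^sub>R w"
    using span3_iff[of s0 u v w] span by auto
  define s where "s = x' *\<^sub>R u + y' *\<^sub>R v"
  have "s = s0 - t' *\<^sub>R w" by (simp add: s_def s0eq)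
  then have sV: "s \<in> V" using sub s0(1) wV by (simp add: subspace_diff subspace_scale)
  have snz: "s \<noteq> 0"
  proof
    assume "s = 0"
    then have "s0 = t' *\<^sub>R w" by (simp add: s_def s0eq)
    with s0(2) show False by (simp add: span_base span_scale)
  qed
  have "A *v s \<notin> span {s}"
  proof
    assume "A *v s \<in> span {s}"
    then obtain k where "A *v s = k *\<^sub>R s" by (auto simp: span_singleton)
    then show False
      using rotates_pair_eigen[OF uv assms(2), of x' y' k] snz by (auto simp: s_def)
  qed
  then have ind: "independent {A *v s, s}"
    using snz by (simp add: independent_insert)
  have "orthogonal w (A *v s)" "orthogonal w s"
    unfolding s_def rotation_coeffs[OF uv] by (simp_all add: orthogonal_def inner_add_right iw)
  then have "orthogonal w a" if "a \<in> span {A *v s, s}" for a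
    using that by (intro orthogonal_to_span[of a "{A *v s, s}"]) auto
  then have wn: "w \<notin> span {A *v s, s}"
    using iw(5) by (metis orthogonal_def zero_neq_one)
  then have ind3: "independent {w, A *v s, s}"
    using ind by (rule independent_insertI)
  have "w \<noteq> A *v s" "w \<noteq> s" "A *v s \<noteq> s"
    using wn \<open>A *v s \<notin> span {s}\<close> by (auto simp: span_base)
  then have "card {w, A *v s, s} = 3" by simp
  moreover have "card {w, A *v s, s} \<le> dim V"
    using ind3 wV sV inv by (intro independent_card_le_dim) auto
  ultimately show False using V(2) by simp
qed

section \<open>Covering numbers and the Assouad dimension\<close>

lemma finite_cball_cover:
  fixes E :: "'a::euclidean_space set"
  assumes "bounded E" "0 < r"
  shows "\<exists>C. finite C \<and> E \<subseteq> (\<Union>x\<in>C. cball x r)"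
proof -
  have "compact (closure E)" using assms by simp
  then obtain C where "finite C" "closure E \<subseteq> (\<Union>x\<in>C. ball x r)"
    using seq_compact_imp_totally_bounded[of "closure E"] assms(2) by (auto simp: compact_imp_seq_compact)
  moreover have "(\<Union>x\<in>C. ball x r) \<subseteq> (\<Union>x\<in>C. cball x r)"
    by auto
  ultimately show ?thesis
    using closure_subset by (metis (no_types, lifting) order_trans)
qed

text \<open>A closed ball of radius \<open>r\<close> has diameter \<open>2 * r\<close>, so it
  contains at most one of the separated points. Boundedness yields some finite cover, without which
  the \<open>LEAST\<close> would not be attained.\<close>

lemma covering_number_ge:
  fixes E :: "'a::euclidean_space set"
  assumes "bounded E" "0 < r" "finite I" "x ` I \<subseteq> E"
    and sep: "\<And>i j. i \<in> I \<Longrightarrow> j \<in> I \<Longrightarrow> i \<noteq> j \<Longrightarrow> 2 * r < dist (x i) (x j)"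
  shows "card I \<le> covering_number r E"
proof -
  have "\<exists>n C. finite C \<and> card C = n \<and> E \<subseteq> (\<Union>x\<in>C. cball x r)"
    using finite_cball_cover[OF assms(1,2)] by auto
  then have "\<exists>C. finite C \<and> card C = covering_number r E \<and> E \<subseteq> (\<Union>x\<in>C. cball x r)"
    unfolding covering_number_def by (rule LeastI_ex)
  then obtain C where C: "finite C" "card C = covering_number r E" "E \<subseteq> (\<Union>x\<in>C. cball x r)"
    by blast
  have "\<forall>i\<in>I. \<exists>z\<in>C. x i \<in> cball z r"
    using C(3) assms(4) by blast
  then obtain f where f: "\<And>i. i \<in> I \<Longrightarrow> f i \<in> C" "\<And>i. i \<in> I \<Longrightarrow> dist (f i) (x i) \<le> r"
    unfolding mem_cball by metis
  have "inj_on f I"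
  proof (rule inj_onI, rule ccontr)
    fix i j assume ij: "i \<in> I" "j \<in> I" "f i = f j" "i \<noteq> j"
    then have "dist (x i) (x j) \<le> r + r"
      using f(2)[of i] f(2)[of j] by (smt (verit) dist_commute dist_triangle)
    with sep[of i j] ij show False by simp
  qed
  then show ?thesis
    using card_inj_on_le[of f I C] f(1) C(1,2) by auto
qed

lemma covering_number_le:
  assumes "finite C" "E \<subseteq> (\<Union>x\<in>C. cball x r)"
  shows "covering_number r E \<le> card C"
  unfolding covering_number_def using assms by (intro Least_le) auto

definition assouad_exponent :: "'a::euclidean_space set \<Rightarrow> real \<Rightarrow> bool" where
  "assouad_exponent E \<alpha> \<longleftrightarrow> (\<exists>c. \<forall>r R. 0 < r \<and> r < R \<longrightarrow>
     (\<forall>x\<in>E. real (covering_number r (cball x R \<inter> E)) \<le> c * (R / r) powr \<alpha>))"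

text \<open>If \<open>\<alpha> < l\<close>, then \<open>C * real N powr (\<alpha> - l)\<close> tends
  to 0 although it stays at least 1. This turns counts at scale \<open>1 / N\<close> into an
  inequality of exponents.\<close>

lemma powr_exponent_le:
  assumes "\<And>N::nat. 2 \<le> N \<Longrightarrow> real N powr l \<le> C * real N powr \<alpha>"
  shows "l \<le> \<alpha>"
proof (rule ccontr)
  assume "\<not> l \<le> \<alpha>"
  then have "(\<lambda>N. real N powr (\<alpha> - l)) \<longlonglongrightarrow> 0"
    by (intro tendsto_neg_powr filterlim_real_sequentially) simp
  then have lim: "(\<lambda>N. C * real N powr (\<alpha> - l)) \<longlonglongrightarrow> C * 0"
    by (intro tendsto_intros)
  have "1 \<le> C * real N powr (\<alpha> - l)" if "2 \<le> N" for N
    using assms[OF that] that by (simp add: powr_diff field_simps)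
  then have "1 \<le> C * 0"
    by (intro LIMSEQ_le_const[OF lim]) auto
  then show False by simp
qed

text \<open>A nonempty set needs at least one ball at every pair of scales; here
  \<open>r = 1\<close> and \<open>R = N\<close>. This makes the set of exponents bounded below, as
  the real infimum requires.\<close>

lemma assouad_exponent_nonneg:
  assumes "assouad_exponent E \<alpha>" "E \<noteq> {}"
  shows "0 \<le> \<alpha>"
proof -
  obtain c x where c: "\<And>r R x. 0 < r \<Longrightarrow> r < R \<Longrightarrow> x \<in> E \<Longrightarrow>
      real (covering_number r (cball x R \<inter> E)) \<le> c * (R / r) powr \<alpha>" and x: "x \<in> E"
    using assms unfolding assouad_exponent_def by (metis ex_in_conv)
  show ?thesis
  proof (rule powr_exponent_le)
    fix N :: nat assume N: "2 \<le> N"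
    have "card {()} \<le> covering_number 1 (cball x (real N) \<inter> E)"
      using x by (intro covering_number_ge[where x = "\<lambda>_. x"]) (auto intro: bounded_subset[OF bounded_cball])
    then show "real N powr 0 \<le> c * real N powr \<alpha>"
      using c[of 1 "real N" x] x N by simp
  qed
qed

lemma assouad_dim_le:
  assumes "assouad_exponent E \<alpha>" "E \<noteq> {}"
  shows "assouad_dim E \<le> \<alpha>"
proof -
  have "bdd_below {\<alpha>. assouad_exponent E \<alpha>}"
    using assouad_exponent_nonneg assms(2) by (intro bdd_belowI) auto
  then show ?thesis
    unfolding assouad_dim_def assouad_exponent_def[symmetric]
    using assms(1) by (intro cInf_lower) auto
qed

text \<open>The first premise makes the set of exponents nonempty, so that the real
  \<open>Inf\<close> is a genuine infimum.\<close>

lemma assouad_dim_ge: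
  assumes "assouad_exponent E \<beta>" "\<And>\<alpha>. assouad_exponent E \<alpha> \<Longrightarrow> l \<le> \<alpha>"
  shows "l \<le> assouad_dim E"
  unfolding assouad_dim_def assouad_exponent_def[symmetric]
  using assms by (intro cInf_greatest) auto

text \<open>Cover by balls around a cubic grid centred at \<open>x\<close> in an orthonormal basis
  of \<open>V\<close>: rounding down all \<open>k\<close> coordinates moves a point by at most
  \<open>k * h \<le> r\<close>. All upper bounds on dimensions come from here.\<close>

lemma assouad_exponent_subspace:
  fixes E :: "'a::euclidean_space set"
  assumes "subspace V" "E \<subseteq> V"
  shows "assouad_exponent E (real (dim V))"
proof -
  obtain B where B: "B \<subseteq> V" "pairwise orthogonal B" "\<And>b. b \<in> B \<Longrightarrow> norm b = 1"
    "independent B" "card B = dim V" "span B = V"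
    using orthonormal_basis_subspace[OF assms(1)] by blast
  define k where "k = dim V"
  have fin: "finite B" using B(4) by (rule independent_imp_finite)
  have "real (covering_number r (cball x R \<inter> E)) \<le> (2 * real k + 5) ^ k * (R / r) powr real k"
    if r: "0 < r" "r < R" and x: "x \<in> E" for r R x
  proof -
    \<comment> \<open>The denominator \<open>k + 1\<close> keeps the mesh positive also when
      \<open>k = 0\<close>.\<close>
    define h where "h = r / (real k + 1)"
    have h: "0 < h" using r by (simp add: h_def)
    define M where "M = \<lceil>R / h\<rceil>"
    have "0 \<le> R / h" using r h by simp
    then have M: "0 \<le> M" unfolding M_def by linarith
    define pt where "pt j = x + (\<Sum>b\<in>B. (h * real_of_int (j b)) *\<^sub>R b)" for j
    define C where "C = pt ` (B \<rightarrow>\<^sub>E {-M..M})"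
    have "cball x R \<inter> E \<subseteq> (\<Union>z\<in>C. cball z r)"
    proof
      fix y assume y: "y \<in> cball x R \<inter> E"
      define j where "j = (\<lambda>b\<in>B. \<lfloor>((y - x) \<bullet> b) / h\<rfloor>)"
      have "j b \<in> {-M..M}" if b: "b \<in> B" for b
      proof -
        have "\<bar>(y - x) \<bullet> b\<bar> \<le> R"
          using Cauchy_Schwarz_ineq2[of "y - x" b] B(3)[OF b] y by (simp add: dist_norm norm_minus_commute)
        then have "- (R / h) \<le> ((y - x) \<bullet> b) / h" "((y - x) \<bullet> b) / h \<le> R / h"
          using h by (auto simp: divide_le_cancel minus_divide_left simp del: divide_minus_left)
        then have "- M \<le> \<lfloor>((y - x) \<bullet> b) / h\<rfloor>" "\<lfloor>((y - x) \<bullet> b) / h\<rfloor> \<le> M"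
          unfolding M_def by linarith+
        then show ?thesis using b by (simp add: j_def)
      qed
      then have "pt j \<in> C" by (auto simp: C_def j_def)
      moreover have "dist (pt j) y \<le> r"
      proof -
        have "y - x \<in> span B"
          using assms x y B(6) by (auto intro: subspace_diff)
        then have exp: "(\<Sum>b\<in>B. ((y - x) \<bullet> b) *\<^sub>R b) = y - x"
          using B fin by (intro orthonormal_basis_expand)
        have "y - pt j = (y - x) - (\<Sum>b\<in>B. (h * real_of_int (j b)) *\<^sub>R b)"
          by (simp add: pt_def)
        also have "\<dots> = (\<Sum>b\<in>B. ((y - x) \<bullet> b - h * real_of_int (j b)) *\<^sub>R b)"
          by (subst exp[symmetric]) (simp add: sum_subtractf scaleR_diff_left)
        also have "norm \<dots> \<le> (\<Sum>b\<in>B. h)"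
        proof (rule sum_norm_le)
          fix b assume b: "b \<in> B"
          have "real_of_int (j b) \<le> ((y - x) \<bullet> b) / h" "((y - x) \<bullet> b) / h \<le> real_of_int (j b) + 1"
            using b by (simp_all add: j_def)
          then have "\<bar>(y - x) \<bullet> b - h * real_of_int (j b)\<bar> \<le> h"
            using h by (simp add: field_simps abs_le_iff)
          then show "norm (((y - x) \<bullet> b - h * real_of_int (j b)) *\<^sub>R b) \<le> h"
            using B(3)[OF b] by simp
        qed
        also have "\<dots> = real k * h" using B(5) by (simp add: k_def)
        also have "\<dots> \<le> r" using r by (simp add: h_def field_simps)
        finally show ?thesis by (simp add: dist_norm norm_minus_commute)
      qed
      ultimately show "y \<in> (\<Union>z\<in>C. cball z r)" by auto
    qed
    moreover have "finite (B \<rightarrow>\<^sub>E {-M..M})" using fin by (intro finite_PiE) auto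
    ultimately have "covering_number r (cball x R \<inter> E) \<le> card C" "card C \<le> card (B \<rightarrow>\<^sub>E {-M..M})"
      by (simp_all only: C_def card_image_le covering_number_le finite_imageI)
    then have "covering_number r (cball x R \<inter> E) \<le> card (B \<rightarrow>\<^sub>E {-M..M})" by (rule order_trans)
    also have "card (B \<rightarrow>\<^sub>E {-M..M}) = nat (2 * M + 1) ^ k"
      using B(5) fin by (simp add: card_PiE k_def add.commute)
    finally have "real (covering_number r (cball x R \<inter> E)) \<le> real (nat (2 * M + 1)) ^ k"
      by (metis of_nat_le_iff of_nat_power)
    also have "\<dots> \<le> ((2 * real k + 5) * (R / r)) ^ k"
    proof (rule power_mono)
      have "real_of_int M \<le> R / h + 1" unfolding M_def by linarith
      then have "real (nat (2 * M + 1)) \<le> 2 * (R / h) + 3" using M by simp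
      also have "2 * (R / h) = (2 * real k + 2) * (R / r)"
        using r by (simp add: h_def field_simps)
      \<comment> \<open>Since \<open>R / r > 1\<close>, the additive constant is absorbed, which
        yields the coefficient \<open>2 * k + 5\<close>.\<close>
      also have "\<dots> + 3 \<le> (2 * real k + 2) * (R / r) + 3 * (R / r)"
        using r by (simp add: field_simps)
      finally show "real (nat (2 * M + 1)) \<le> (2 * real k + 5) * (R / r)"
        by (simp add: algebra_simps)
    qed simp
    also have "\<dots> = (2 * real k + 5) ^ k * (R / r) powr real k"
      using r by (simp only: power_mult_distrib) (simp add: powr_realpow)
    finally show ?thesis .
  qed
  then show ?thesis
    unfolding assouad_exponent_def k_def by blast
qed

section \<open>Words and the closed group of orthogonal parts\<close>

locale self_similar =
  fixes m :: nat and S :: "nat \<Rightarrow> real^'n \<Rightarrow> real^'n" and Q :: "nat \<Rightarrow> real^'n^'n"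
    and c :: "nat \<Rightarrow> real" and b :: "nat \<Rightarrow> real^'n" and F :: "(real^'n) set"
  assumes m: "1 \<le> m"
    and Q: "i \<in> {1..m} \<Longrightarrow> orthogonal_matrix (Q i)"
    and c: "i \<in> {1..m} \<Longrightarrow> 0 < c i" "i \<in> {1..m} \<Longrightarrow> c i < 1"
    and S: "i \<in> {1..m} \<Longrightarrow> S i = (\<lambda>x. c i *\<^sub>R (Q i *v x) + b i)"
    and F: "attractor m S F"
begin

abbreviation "words \<equiv> index_words m"
abbreviation "SW \<equiv> word_map S"
abbreviation "OW \<equiv> word_orth Q"
abbreviation "G \<equiv> orth_group m Q"

definition ratio :: "nat list \<Rightarrow> real" where
  "ratio w = prod_list (map c w)"

lemma SW_Nil [simp]: "SW [] = id" and SW_Cons: "SW (i # w) = S i \<circ> SW w"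
  and SW_append: "SW (v @ w) = SW v \<circ> SW w"
proof -
  show "SW [] = id" "SW (i # w) = S i \<circ> SW w" for i w
    by (auto simp: word_map_def)
  then show "SW (v @ w) = SW v \<circ> SW w"
    by (induction v) (auto simp: o_assoc)
qed

lemma OW_Nil [simp]: "OW [] = mat 1" and OW_Cons: "OW (i # w) = Q i ** OW w"
  and OW_append: "OW (v @ w) = OW v ** OW w"
proof -
  show "OW [] = mat 1" "OW (i # w) = Q i ** OW w" for i w
    by (auto simp: word_orth_def)
  then show "OW (v @ w) = OW v ** OW w"
    by (induction v) (auto simp: matrix_mul_assoc)
qed

lemma ratio_Nil [simp]: "ratio [] = 1" and ratio_Cons: "ratio (i # w) = c i * ratio w"
  and ratio_append: "ratio (v @ w) = ratio v * ratio w"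
  by (auto simp: ratio_def)

lemma words_append: "v \<in> words \<Longrightarrow> w \<in> words \<Longrightarrow> v @ w \<in> words"
  by (auto simp: index_words_def)

lemma words_set: "w \<in> words \<Longrightarrow> set w \<subseteq> {1..m}"
  by (auto simp: index_words_def)

lemma OW_orthogonal: "set w \<subseteq> {1..m} \<Longrightarrow> orthogonal_matrix (OW w)"
  by (induction w) (auto simp: OW_Cons orthogonal_matrix_id Q intro!: orthogonal_matrix_mul)

lemma ratio_pos: "set w \<subseteq> {1..m} \<Longrightarrow> 0 < ratio w"
  by (induction w) (auto simp: ratio_Cons c)

lemma ratio_le_1: "set w \<subseteq> {1..m} \<Longrightarrow> ratio w \<le> 1"
proof (induction w)
  case (Cons i w)
  then show ?case
    using ratio_pos[of w] c[of i] mult_mono[of "c i" 1 "ratio w" 1] by (auto simp: ratio_Cons)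
qed simp

lemma SW_diff: "set w \<subseteq> {1..m} \<Longrightarrow> SW w x - SW w y = ratio w *\<^sub>R (OW w *v (x - y))"
proof (induction w)
  case (Cons i w)
  then have "SW (i # w) x - SW (i # w) y = c i *\<^sub>R (Q i *v (SW w x - SW w y))"
    by (simp add: SW_Cons S algebra_simps matrix_vector_mult_diff_distrib)
  then show ?case using Cons
    by (simp add: ratio_Cons OW_Cons matrix_vector_mult_scaleR matrix_vector_mul_assoc)
qed simp

lemma norm_SW_diff: "set w \<subseteq> {1..m} \<Longrightarrow> norm (SW w x - SW w y) = ratio w * norm (x - y)"
  using ratio_pos[of w] by (simp add: SW_diff norm_orthogonal_matrix_mult OW_orthogonal)

lemma F_compact: "compact F" and F_nonempty: "F \<noteq> {}" and F_eq: "F = (\<Union>i\<in>{1..m}. S i ` F)"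
  using F by (auto simp: attractor_def)

lemma F_bounded: "bounded F"
  using F_compact by (rule compact_imp_bounded)

lemma SW_F: "set w \<subseteq> {1..m} \<Longrightarrow> x \<in> F \<Longrightarrow> SW w x \<in> F"
proof (induction w)
  case (Cons i w)
  then have "S i (SW w x) \<in> (\<Union>i\<in>{1..m}. S i ` F)" by auto
  then have "S i (SW w x) \<in> F" using F_eq by (rule ssubst[rotated])
  then show ?case by (simp add: SW_Cons)
qed simp

lemma F_word:
  assumes "x \<in> F"
  shows "\<exists>w y. length w = n \<and> set w \<subseteq> {1..m} \<and> y \<in> F \<and> x = SW w y"
  using assms
proof (induction n arbitrary: x)
  case (Suc n)
  obtain i z where iz: "i \<in> {1..m}" "z \<in> F" "x = S i z"
    using F_eq Suc.prems by blast
  obtain w y where "length w = n" "set w \<subseteq> {1..m}" "y \<in> F" "z = SW w y"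
    using Suc.IH[OF iz(2)] by auto
  with iz show ?case
    by (intro exI[of _ "i # w"] exI[of _ y]) (auto simp: SW_Cons)
qed auto

text \<open>The largest of the finitely many ratios is below 1, so its powers tend to 0. The length
  is required to be positive so that such a word is nonempty, that is, an element of
  \<open>words\<close>.\<close>

lemma small_words:
  assumes "0 < e"
  shows "\<exists>n>0. \<forall>w. set w \<subseteq> {1..m} \<longrightarrow> length w = n \<longrightarrow> ratio w < e"
proof -
  define M where "M = Max (c ` {1..m})"
  have M: "0 < M" "M < 1" "\<And>i. i \<in> {1..m} \<Longrightarrow> c i \<le> M"
    using m c by (auto simp: M_def Max_gr_iff intro!: bexI[of _ 1])
  have le: "ratio w \<le> M ^ length w" if "set w \<subseteq> {1..m}" for w
    using that
  proof (induction w)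
    case (Cons i w)
    then show ?case
      using M c[of i] ratio_pos[of w] by (auto simp: ratio_Cons intro!: mult_mono)
  qed simp
  obtain n where n: "M ^ n < e"
    using real_arch_pow_inv[OF assms M(2)] by auto
  have "M ^ Suc n < e"
    using n M by (smt (verit) power_Suc_less zero_less_power power_Suc mult_left_le_one_le)
  then show ?thesis
    by (intro exI[of _ "Suc n"]) (use le in fastforce)
qed

section \<open>The compact group of orthogonal parts\<close>

lemma OW_in_G: "w \<in> words \<Longrightarrow> OW w \<in> G"
  by (auto simp: orth_group_def orth_parts_def intro: closure_subset[THEN subsetD])

lemma G_orthogonal: "A \<in> G \<Longrightarrow> orthogonal_matrix A"
proof -
  have "orth_parts m Q \<subseteq> {A. orthogonal_matrix A}"
    using OW_orthogonal words_set by (auto simp: orth_parts_def)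
  then have "G \<subseteq> {A. orthogonal_matrix A}"
    unfolding orth_group_def
    by (rule closure_minimal) (rule compact_imp_closed[OF compact_orthogonal_matrices])
  then show "A \<in> G \<Longrightarrow> orthogonal_matrix A" by auto
qed

lemma G_compact: "compact G"
  using compact_Int_closed[OF compact_orthogonal_matrices, of G] G_orthogonal
  by (simp add: orth_group_def Int_absorb1 subset_iff)

lemma G_mult:
  assumes "A \<in> G" "B \<in> G"
  shows "A ** B \<in> G"
proof -
  obtain X Y where X: "\<And>n. X n \<in> orth_parts m Q" "X \<longlonglongrightarrow> A"
    and Y: "\<And>n. Y n \<in> orth_parts m Q" "Y \<longlonglongrightarrow> B"
    using assms unfolding orth_group_def closure_sequential by metis
  have "X n ** Y n \<in> orth_parts m Q" for n
    using X(1)[of n] Y(1)[of n]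
    by (auto simp: orth_parts_def OW_append[symmetric] words_append)
  then show ?thesis
    unfolding orth_group_def closure_sequential
    using tendsto_matrix_mult[OF X(2) Y(2)] by (intro exI[of _ "\<lambda>n. X n ** Y n"]) auto
qed

text \<open>A compact semigroup of invertible matrices is a group: the inverse of \<open>A\<close> is the limit of the
  powers \<open>A ^ (r (n + 2) - r n - 1)\<close> for a convergent subsequence \<open>A ^ r n\<close>.\<close>

lemma G_transpose:
  assumes A: "A \<in> G"
  shows "transpose A \<in> G"
proof -
  \<comment> \<open>\<open>P n\<close> is the power of \<open>A\<close> with exponent
    \<open>n + 1\<close>; starting at \<open>A\<close> avoids the identity, which is not yet known
    to lie in \<open>G\<close>.\<close>
  define P where "P = rec_nat A (\<lambda>_ B. A ** B)"
  have P [simp]: "P 0 = A" "P (Suc n) = A ** P n" for n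
    by (auto simp: P_def)
  have PG: "P n \<in> G" for n
    by (induction n) (auto simp: A G_mult)
  have add: "P (Suc (i + j)) = P i ** P j" for i j
    by (induction i) (auto simp: matrix_mul_assoc)
  have orth: "orthogonal_matrix (P n)" for n
    using PG G_orthogonal by blast
  obtain B r where Br: "B \<in> G" "strict_mono r" "(P \<circ> r) \<longlonglongrightarrow> B"
    using G_compact PG unfolding compact_def by blast
  have lim: "(\<lambda>n. transpose A ** (transpose (P (r n)) ** P (r (Suc (Suc n))))) \<longlonglongrightarrow>
      transpose A ** (transpose B ** B)"
  proof (intro tendsto_matrix_mult tendsto_transpose tendsto_const)
    show "(\<lambda>n. P (r n)) \<longlonglongrightarrow> B"
      using Br(3) by (simp add: o_def)
    then show "(\<lambda>n. P (r (Suc (Suc n)))) \<longlonglongrightarrow> B"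
      using LIMSEQ_ignore_initial_segment[of "\<lambda>n. P (r n)" B 2] by (simp add: numeral_2_eq_2)
  qed
  have "transpose A ** (transpose (P (r n)) ** P (r (Suc (Suc n)))) \<in> G" for n
  proof -
    \<comment> \<open>Two steps of \<open>r\<close> make the index gap at least 2:
      \<open>transpose A\<close> cancels one factor \<open>A\<close>, and a positive power must
      remain.\<close>
    have "r n < r (Suc n)" "r (Suc n) < r (Suc (Suc n))"
      using Br(2) by (auto simp: strict_mono_def)
    then obtain k where k: "r (Suc (Suc n)) = Suc (r n + Suc k)"
      using less_imp_Suc_add by (metis add_Suc_right less_trans_Suc not_less_eq Suc_lessE less_natE)
    have "transpose A ** (transpose (P (r n)) ** P (r (Suc (Suc n)))) =
        transpose A ** (transpose (P (r n)) ** P (r n)) ** (A ** P k)"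
      unfolding k add by (simp add: matrix_mul_assoc)
    also have "\<dots> = P k"
      using orth[of "r n"] G_orthogonal[OF A] by (simp add: orthogonal_matrix matrix_mul_assoc)
    finally show ?thesis using PG by simp
  qed
  moreover have "closed G"
    by (simp add: orth_group_def)
  moreover have "transpose A ** (transpose B ** B) = transpose A"
    using G_orthogonal[OF Br(1)] by (simp add: orthogonal_matrix)
  ultimately show ?thesis
    using lim closed_sequentially[of G "\<lambda>n. transpose A ** (transpose (P (r n)) ** P (r (Suc (Suc n))))"]
    by simp
qed

lemma G_approx:
  assumes "A \<in> G" "0 < e"
  shows "\<exists>w\<in>words. \<forall>x. norm (OW w *v x - A *v x) \<le> e * norm x"
proof -
  obtain w where w: "w \<in> words" "dist (OW w) A < e"
    using assms unfolding orth_group_def closure_approachable orth_parts_def by auto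
  have "norm (OW w *v x - A *v x) \<le> e * norm x" for x
  proof -
    have "norm (OW w *v x - A *v x) \<le> norm (OW w - A) * norm x"
      by (metis matrix_vector_mult_diff_rdistrib norm_matrix_vector_le)
    also have "\<dots> \<le> e * norm x"
      using w by (auto simp: dist_norm intro!: mult_right_mono)
    finally show ?thesis .
  qed
  with w show ?thesis by blast
qed

text \<open>Finiteness is the point: the least ratio over \<Gamma> is positive, and this bounds
  translation lengths from below independently of the accuracy of the approximation.\<close>

lemma G_net:
  assumes "0 < e"
  shows "\<exists>\<Gamma>. finite \<Gamma> \<and> \<Gamma> \<subseteq> words \<and> \<Gamma> \<noteq> {} \<and>
    (\<forall>A\<in>G. \<exists>w\<in>\<Gamma>. \<forall>x. norm (OW w *v x - A *v x) \<le> e * norm x)"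
proof -
  have "\<exists>k. finite k \<and> k \<subseteq> G \<and> G \<subseteq> (\<Union>x\<in>k. ball x (e/2))"
    using seq_compact_imp_totally_bounded[of G] G_compact assms by (simp add: compact_imp_seq_compact)
  then obtain k where k: "finite k" "k \<subseteq> G" "G \<subseteq> (\<Union>x\<in>k. ball x (e/2))"
    by auto
  have "\<forall>A\<in>k. \<exists>w\<in>words. \<forall>x. norm (OW w *v x - A *v x) \<le> e/2 * norm x"
    using G_approx k(2) assms by (meson half_gt_zero subsetD)
  then obtain f where f: "\<And>A. A \<in> k \<Longrightarrow> f A \<in> words"
    "\<And>A x. A \<in> k \<Longrightarrow> norm (OW (f A) *v x - A *v x) \<le> e/2 * norm x"
    by metis
  have "\<exists>w\<in>f ` k. \<forall>x. norm (OW w *v x - A *v x) \<le> e * norm x" if "A \<in> G" for A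
  proof -
    obtain B where B: "B \<in> k" "A \<in> ball B (e/2)"
      using k(3) \<open>A \<in> G\<close> by blast
    have "norm (OW (f B) *v x - A *v x) \<le> e * norm x" for x
    proof -
      have "norm (B *v x - A *v x) \<le> norm (B - A) * norm x"
        by (metis matrix_vector_mult_diff_rdistrib norm_matrix_vector_le)
      also have "\<dots> \<le> e/2 * norm x"
        using B mult_right_mono[of "norm (B - A)" "e/2" "norm x"] by (simp add: dist_norm)
      finally show ?thesis
        using f(2)[OF B(1), of x] norm_diff_triangle_ineq[of "OW (f B) *v x" "B *v x" "B *v x" "A *v x"]
        by (simp add: field_simps)
    qed
    with B show ?thesis by blast
  qed
  moreover have "[1] \<in> words" using m by (auto simp: index_words_def)
  then have "G \<noteq> {}" using OW_in_G by blast
  with k(3) have "f ` k \<noteq> {}" by auto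
  ultimately show ?thesis
    using k(1) f(1) by (intro exI[of _ "f ` k"]) auto
qed

section \<open>Approximate translates inside magnifications\<close>

text \<open>Up to the accuracy \<open>e\<close>, the magnification of \<open>F\<close> by the inverse of a map \<open>SW w\<close> contains \<open>E\<close>.
  The orthogonal part of this map is kept close to the identity, so that linear maps, in particular
  projections, can be applied afterwards.\<close>

definition tangent :: "(real^'n) set \<Rightarrow> bool" where
  "tangent E \<longleftrightarrow> bounded E \<and> (\<forall>e>0. \<exists>w\<in>words. (\<forall>x. norm (OW w *v x - x) \<le> e * norm x) \<and>
     (\<forall>x\<in>E. \<exists>y\<in>F. norm (SW w x - y) \<le> e * ratio w))"

text \<open>The map \<open>\<Phi>\<close> is \<open>S\<^sub>\<alpha>\<^sup>-\<^sup>1 \<circ> S\<^sub>\<beta> - I\<close>. The bound \<open>\<rho> \<parallel>D\<Phi>\<parallel> \<le> \<parallel>\<Phi> a\<parallel>\<close> enters as the Lipschitz condition with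
  \<open>L = 1/\<rho>\<close>, and limits of sequences are replaced by tolerances.\<close>

definition overlap :: "real^'n \<Rightarrow> real \<Rightarrow> real^'n \<Rightarrow> bool" where
  "overlap a L \<omega> \<longleftrightarrow> a \<in> F \<and> 0 \<le> L \<and> norm \<omega> = 1 \<and>
     (\<forall>\<delta>>0. \<forall>\<eta>>0. \<exists>\<alpha>\<in>words. \<exists>\<beta>\<in>words. \<exists>\<Phi>.
        (\<forall>x. SW \<beta> x = SW \<alpha> (x + \<Phi> x)) \<and> \<Phi> a \<noteq> 0 \<and> norm (\<Phi> a) \<le> \<delta> \<and>
        (\<forall>x. norm (\<Phi> x - \<Phi> a) \<le> L * norm (\<Phi> a) * norm (x - a)) \<and>
        norm (\<Phi> a - norm (\<Phi> a) *\<^sub>R \<omega>) \<le> \<eta> * norm (\<Phi> a))"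

text \<open>As \<open>G\<close> is a group, the inverse of \<open>OW w\<close> is approximated by
  some \<open>OW v\<close>. Prefixing \<open>v\<close> maps \<open>F\<close> into \<open>F\<close>
  and scales errors by exactly \<open>ratio v\<close>, so it restores the near-identity orthogonal
  part demanded by \<open>tangent\<close> at no cost.\<close>

lemma orth_correction:
  assumes "w \<in> words" "0 < e"
  shows "\<exists>v\<in>words. \<forall>x. norm (OW (v @ w) *v x - x) \<le> e * norm x"
proof -
  have orth: "orthogonal_matrix (OW w)"
    using assms OW_orthogonal words_set by auto
  obtain v where v: "v \<in> words" "\<And>x. norm (OW v *v x - transpose (OW w) *v x) \<le> e * norm x"
    using G_approx[OF G_transpose[OF OW_in_G[OF assms(1)]] assms(2)] by auto
  have "norm (OW (v @ w) *v x - x) \<le> e * norm x" for x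
    using v(2)[of "OW w *v x"]
    by (simp only: OW_append matrix_vector_mul_assoc[symmetric] transpose_cancel[OF orth]
        norm_orthogonal_matrix_mult[OF orth])
  with v show ?thesis by blast
qed

text \<open>A word \<open>W\<close> realising \<open>E\<close> is prefixed so that the copy lands
  close to \<open>a\<close>, where \<Phi> is nearly constant; following it by \<alpha> or by \<beta>
  then gives two copies that differ nearly by a translation. The vector \<open>v\<close> may depend
  on \<open>e\<close>, but its lower bound does not: only \<Gamma>, \<open>c 1\<close> and
  \<open>t\<close> enter.\<close>

lemma tangent_step_approx:
  assumes ov: "overlap a L \<omega>" and g: "g \<in> G" and "0 < \<eta>" "0 < t" and E: "tangent E" and "0 < e"
    and \<Gamma>: "finite \<Gamma>" "\<Gamma> \<subseteq> words" "\<Gamma> \<noteq> {}"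
      "\<And>A. A \<in> G \<Longrightarrow> \<exists>w\<in>\<Gamma>. \<forall>x. norm (OW w *v x - A *v x) \<le> \<eta> * norm x"
  shows "\<exists>v. Min (ratio ` \<Gamma>) * c 1 * t \<le> norm v \<and> norm v \<le> t \<and>
    norm (v - norm v *\<^sub>R (g *v \<omega>)) \<le> 2 * \<eta> * norm v \<and>
    (\<exists>w\<in>words. (\<forall>x. norm (OW w *v x - x) \<le> e * norm x) \<and>
      (\<forall>x\<in>E \<union> (+) v ` E. \<exists>y\<in>F. norm (SW w x - y) \<le> e * ratio w))"
proof -
  define \<kappa> where "\<kappa> = Min (ratio ` \<Gamma>)"
  have \<kappa>: "0 < \<kappa>" "\<And>w. w \<in> \<Gamma> \<Longrightarrow> \<kappa> \<le> ratio w"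
    using \<Gamma> ratio_pos words_set by (auto simp: \<kappa>_def)
  have L: "0 \<le> L" "a \<in> F" "norm \<omega> = 1"
    using ov by (auto simp: overlap_def)
  have one: "1 \<in> {1..m}" using m by simp
  obtain D where D: "0 < D" "\<And>x. x \<in> F \<Longrightarrow> norm x \<le> D"
    using F_bounded by (auto simp: bounded_pos)
  have "0 < e/2" using \<open>0 < e\<close> by simp
  then obtain W where W: "W \<in> words" "\<And>x. x \<in> E \<Longrightarrow> \<exists>y\<in>F. norm (SW W x - y) \<le> e/2 * ratio W"
    using E unfolding tangent_def by meson
  obtain k where k: "0 < k" "\<And>w. set w \<subseteq> {1..m} \<Longrightarrow> length w = k \<Longrightarrow> ratio w < e/2 / ((L * t + 1) * (2 * D))"
    using small_words[of "e/2 / ((L * t + 1) * (2 * D))"] L D \<open>0 < e\<close> \<open>0 < t\<close>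
    by (auto simp: add_nonneg_pos)
  obtain \<tau> a' where \<tau>: "length \<tau> = k" "set \<tau> \<subseteq> {1..m}" "a' \<in> F" "a = SW \<tau> a'"
    using F_word[OF \<open>a \<in> F\<close>] by blast
  have \<tau>_small: "L * t * (ratio \<tau> * (2 * D)) \<le> e/2"
  proof -
    have "L * t * (ratio \<tau> * (2 * D)) \<le> ratio \<tau> * ((L * t + 1) * (2 * D))"
      using ratio_pos[OF \<tau>(2)] D by (simp add: algebra_simps)
    also have "\<dots> \<le> e/2"
      using k(2)[OF \<tau>(2,1)] L D \<open>0 < t\<close> by (subst (asm) pos_less_divide_eq) (auto simp: add_nonneg_pos)
    finally show ?thesis .
  qed
  have pos: "0 < ratio \<tau>" "0 < ratio W" "0 < c 1" "c 1 < 1"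
    using ratio_pos \<tau>(2) W(1) words_set c one by auto
  \<comment> \<open>The tolerance on \<open>\<Phi> a\<close> is chosen so that the quotient to be
    placed between powers of \<open>c 1\<close> is at most \<open>t\<close>, as
    \<open>power_between\<close> requires.\<close>
  obtain \<alpha> \<beta> \<Phi> where ab: "\<alpha> \<in> words" "\<beta> \<in> words" "\<And>x. SW \<beta> x = SW \<alpha> (x + \<Phi> x)"
    and \<Phi>: "\<Phi> a \<noteq> 0" "norm (\<Phi> a) \<le> t * (ratio \<tau> * \<kappa> * ratio W)"
      "\<And>x. norm (\<Phi> x - \<Phi> a) \<le> L * norm (\<Phi> a) * norm (x - a)"
      "norm (\<Phi> a - norm (\<Phi> a) *\<^sub>R \<omega>) \<le> \<eta> * norm (\<Phi> a)"
    using ov \<open>0 < t\<close> \<open>0 < \<eta>\<close> \<kappa>(1) pos unfolding overlap_def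
    by (metis mult_pos_pos)
  have "\<exists>n. t * c 1 ^ Suc n < norm (\<Phi> a) / (ratio \<tau> * \<kappa> * ratio W) \<and>
      norm (\<Phi> a) / (ratio \<tau> * \<kappa> * ratio W) \<le> t * c 1 ^ n"
    using \<Phi>(1,2) pos \<kappa>(1) by (intro power_between) (auto simp: divide_le_eq)
  then obtain n where n: "t * c 1 ^ Suc n < norm (\<Phi> a) / (ratio \<tau> * \<kappa> * ratio W)"
      "norm (\<Phi> a) / (ratio \<tau> * \<kappa> * ratio W) \<le> t * c 1 ^ n"
    by blast
  \<comment> \<open>The prefix \<tau> localises near \<open>a\<close>; the repeated letter 1 tunes
    the magnification and hence the length of \<open>v\<close>.\<close>
  define P where "P = \<tau> @ replicate n 1"
  have P: "P \<in> words" "ratio P = ratio \<tau> * c 1 ^ n"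
    using \<tau>(1,2) k(1) one by (auto simp: P_def index_words_def ratio_def)
  \<comment> \<open>This solves \<open>OW P ** A ** (OW W ** g) = mat 1\<close>, so a word \<gamma>
    with \<open>OW \<gamma>\<close> near \<open>A\<close> makes \<open>OW U\<close> carry
    \<open>g *v \<omega>\<close> close to \<omega>. Since \<open>A\<close> depends on
    \<open>n\<close> through \<open>P\<close>, the exponent \<open>n\<close> was fixed beforehand
    with \<kappa> in place of the unknown \<open>ratio \<gamma>\<close>.\<close>
  define A where "A = transpose (OW P) ** transpose (OW W ** g)"
  have "A \<in> G"
    unfolding A_def by (intro G_mult G_transpose OW_in_G P W g)
  then obtain \<gamma> where \<gamma>: "\<gamma> \<in> \<Gamma>" "\<And>x. norm (OW \<gamma> *v x - A *v x) \<le> \<eta> * norm x"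
    using \<Gamma>(4) by blast
  have \<gamma>w: "\<gamma> \<in> words" using \<gamma> \<Gamma> by auto
  define Z where "Z = P @ \<gamma>"
  define U where "U = Z @ W"
  have ZU: "Z \<in> words" "U \<in> words"
    using P \<gamma>w W by (auto simp: Z_def U_def intro!: words_append)
  have sets: "set Z \<subseteq> {1..m}" "set U \<subseteq> {1..m}" "set W \<subseteq> {1..m}" "set P \<subseteq> {1..m}" "set \<alpha> \<subseteq> {1..m}"
    "set \<gamma> \<subseteq> {1..m}" "set \<beta> \<subseteq> {1..m}"
    using ZU W P ab \<gamma>w words_set by auto
  have orthP: "orthogonal_matrix (OW P)" and orthWg: "orthogonal_matrix (OW W ** g)"
    and orthU: "orthogonal_matrix (OW U)"
    using sets OW_orthogonal G_orthogonal g by (auto intro: orthogonal_matrix_mul)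
  define rU where "rU = ratio U"
  have rU: "rU = ratio Z * ratio W" "rU = ratio \<tau> * c 1 ^ n * ratio \<gamma> * ratio W" "0 < rU"
    using ratio_pos[OF sets(2)] by (auto simp: U_def rU_def Z_def ratio_append P(2))
  have dir: "norm (OW U *v (g *v \<omega>) - \<omega>) \<le> \<eta>"
  proof -
    define y where "y = (OW W ** g) *v \<omega>"
    have y: "norm y = 1"
      by (simp only: y_def norm_orthogonal_matrix_mult[OF orthWg] L)
    have "OW P *v (A *v y) = \<omega>"
      by (simp only: A_def y_def matrix_vector_mul_assoc[symmetric] transpose_cancel[OF orthP])
         (simp only: matrix_vector_mul_assoc transpose_cancel[OF orthWg, unfolded matrix_vector_mul_assoc])
    moreover have "OW U *v (g *v \<omega>) = OW P *v (OW \<gamma> *v y)"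
      by (simp add: U_def Z_def OW_append y_def matrix_vector_mul_assoc matrix_mul_assoc)
    ultimately have "norm (OW U *v (g *v \<omega>) - \<omega>) = norm (OW P *v (OW \<gamma> *v y - A *v y))"
      by (simp add: matrix_vector_mult_diff_distrib)
    also have "\<dots> \<le> \<eta>"
      using \<gamma>(2)[of y] y by (simp add: norm_orthogonal_matrix_mult[OF orthP])
    finally show ?thesis .
  qed
  \<comment> \<open>The translation vector \<open>\<Phi> a\<close> pulled back through the linear
    part of \<open>SW U\<close>.\<close>
  define v where "v = (1 / rU) *\<^sub>R (transpose (OW U) *v \<Phi> a)"
  have Uv: "rU *\<^sub>R (OW U *v v) = \<Phi> a"
    using rU(3) by (simp only: v_def matrix_vector_mult_scaleR transpose_cancel[OF orthU]) simp
  then have nv: "rU * norm v = norm (\<Phi> a)"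
    using rU(3) by (metis norm_scaleR norm_orthogonal_matrix_mult[OF orthU] abs_of_pos)
  have shift: "SW U (x + v) = SW U x + \<Phi> a" for x
    using SW_diff[OF sets(2), of "x + v" x] Uv by (simp add: rU_def algebra_simps)
  have rg: "ratio \<gamma> \<le> 1" "\<kappa> \<le> ratio \<gamma>" "0 < ratio \<gamma>"
    using ratio_le_1 sets \<kappa> \<gamma> ratio_pos by auto
  have up: "norm v \<le> t"
  proof -
    have "rU * norm v \<le> t * c 1 ^ n * (ratio \<tau> * \<kappa> * ratio W)"
      using n(2) pos \<kappa>(1) unfolding nv by (simp add: divide_le_eq mult_ac)
    also have "\<dots> \<le> t * c 1 ^ n * (ratio \<tau> * ratio \<gamma> * ratio W)"
      using pos rg \<open>0 < t\<close> by (intro mult_left_mono mult_right_mono) auto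
    also have "\<dots> = rU * t"
      by (simp add: rU(2))
    finally show ?thesis using rU(3) by simp
  qed
  have low: "\<kappa> * c 1 * t \<le> norm v"
  proof -
    have "rU * (\<kappa> * c 1 * t) = (ratio \<tau> * c 1 ^ n * ratio W * (\<kappa> * c 1 * t)) * ratio \<gamma>"
      by (simp add: rU(2))
    also have "\<dots> \<le> (ratio \<tau> * c 1 ^ n * ratio W * (\<kappa> * c 1 * t)) * 1"
      using pos rg \<kappa>(1) \<open>0 < t\<close> by (intro mult_left_mono) auto
    also have "\<dots> = t * c 1 ^ Suc n * (ratio \<tau> * \<kappa> * ratio W)"
      by simp
    also have "\<dots> \<le> norm (\<Phi> a)"
      using n(1) pos \<kappa>(1) by (simp add: less_divide_eq mult_ac)
    finally have "rU * (\<kappa> * c 1 * t) \<le> rU * norm v"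
      by (simp add: nv)
    then show ?thesis using rU(3) by simp
  qed
  have dirv: "norm (v - norm v *\<^sub>R (g *v \<omega>)) \<le> 2 * \<eta> * norm v"
  proof -
    have "rU * norm (v - norm v *\<^sub>R (g *v \<omega>)) = norm (rU *\<^sub>R (OW U *v (v - norm v *\<^sub>R (g *v \<omega>))))"
      using rU(3) by (simp add: norm_orthogonal_matrix_mult[OF orthU])
    also have "rU *\<^sub>R (OW U *v (v - norm v *\<^sub>R (g *v \<omega>))) =
        \<Phi> a - norm (\<Phi> a) *\<^sub>R (OW U *v (g *v \<omega>))"
      by (simp only: matrix_vector_mult_diff_distrib scaleR_diff_right Uv matrix_vector_mult_scaleR
          scaleR_scaleR nv)
    also have "\<dots> = (\<Phi> a - norm (\<Phi> a) *\<^sub>R \<omega>) - norm (\<Phi> a) *\<^sub>R (OW U *v (g *v \<omega>) - \<omega>)"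
      by (simp add: algebra_simps)
    also have "norm \<dots> \<le> norm (\<Phi> a - norm (\<Phi> a) *\<^sub>R \<omega>) + norm (norm (\<Phi> a) *\<^sub>R (OW U *v (g *v \<omega>) - \<omega>))"
      by (rule norm_triangle_ineq4)
    also have "\<dots> \<le> \<eta> * norm (\<Phi> a) + norm (\<Phi> a) * \<eta>"
      using \<Phi>(4) dir by (intro add_mono) (auto intro: mult_left_mono)
    also have "\<dots> = rU * (2 * \<eta> * norm v)"
      by (simp add: nv[symmetric])
    finally show ?thesis using rU(3) by simp
  qed
  \<comment> \<open>The prefix \<open>V\<close> cancels the rotation by \<alpha> and
    \<open>U\<close> up to \<open>e\<close>; it leaves \<open>v\<close> unchanged because it acts on
    both copies alike.\<close>
  obtain V where V: "V \<in> words" "\<And>x. norm (OW (V @ (\<alpha> @ U)) *v x - x) \<le> e * norm x"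
    using orth_correction[of "\<alpha> @ U" e] ab ZU \<open>0 < e\<close> words_append by auto
  define w where "w = V @ (\<alpha> @ U)"
  have w: "w \<in> words"
    unfolding w_def using V ab ZU by (intro words_append)
  have setV: "set V \<subseteq> {1..m}" using V words_set by auto
  have rw: "ratio w = ratio V * ratio \<alpha> * rU"
    by (simp add: w_def ratio_append rU_def)
  have rpos: "0 < ratio V" "0 < ratio \<alpha>" "0 < ratio Z"
    using ratio_pos setV sets by auto
  have "\<exists>y\<in>F. norm (SW w x - y) \<le> e * ratio w" if x: "x \<in> E \<union> (+) v ` E" for x
  proof -
    obtain x' where x': "x' \<in> E" "x = x' \<or> x = x' + v"
      using x by (auto simp: add.commute)
    obtain y where y: "y \<in> F" "norm (SW W x' - y) \<le> e/2 * ratio W"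
      using W(2)[OF x'(1)] by blast
    \<comment> \<open>One point of \<open>F\<close> serves twice: its image under
      \<open>V @ \<alpha>\<close> approximates the image of \<open>x'\<close>, and its image under
      \<open>V @ \<beta>\<close> that of \<open>x' + v\<close>.\<close>
    define q where "q = SW Z y"
    have qF: "q \<in> F" unfolding q_def using SW_F sets y by auto
    have Uq: "norm (SW U x' - q) \<le> e/2 * rU"
    proof -
      have "norm (SW U x' - q) = ratio Z * norm (SW W x' - y)"
        by (simp add: U_def SW_append q_def norm_SW_diff[OF sets(1)])
      also have "\<dots> \<le> ratio Z * (e/2 * ratio W)"
        using y(2) rpos by (intro mult_left_mono) auto
      finally show ?thesis by (simp add: rU(1) mult_ac)
    qed
    show ?thesis
      using x'(2)
    proof
      assume "x = x'"
      have "SW (V @ \<alpha>) q \<in> F"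
        using SW_F setV sets qF by auto
      moreover have "norm (SW w x - SW (V @ \<alpha>) q) = ratio (V @ \<alpha>) * norm (SW U x' - q)"
        using norm_SW_diff[of "V @ \<alpha>" "SW U x'" q] setV sets
        by (simp add: w_def SW_append \<open>x = x'\<close>)
      moreover have "ratio (V @ \<alpha>) * norm (SW U x' - q) \<le> ratio (V @ \<alpha>) * (e/2 * rU)"
        using Uq rpos by (intro mult_left_mono) (auto simp: ratio_append)
      moreover have "\<dots> \<le> e * ratio w"
        using rpos rU(3) \<open>0 < e\<close> by (simp add: rw ratio_append)
      ultimately show ?thesis by (metis order_trans)
    next
      assume "x = x' + v"
      have "set (replicate n 1 @ \<gamma>) \<subseteq> {1..m}"
        using sets one by auto
      then have q': "SW (replicate n 1 @ \<gamma>) y \<in> F"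
        using SW_F y(1) by blast
      have "q = SW \<tau> (SW (replicate n 1 @ \<gamma>) y)"
        by (simp add: q_def Z_def P_def SW_append)
      then have "norm (q - a) = ratio \<tau> * norm (SW (replicate n 1 @ \<gamma>) y - a')"
        by (simp only: \<tau>(4) norm_SW_diff[OF \<tau>(2)])
      also have "\<dots> \<le> ratio \<tau> * (2 * D)"
        using D(2)[OF q'] D(2)[OF \<tau>(3)] pos norm_triangle_ineq4[of "SW (replicate n 1 @ \<gamma>) y" a']
        by (intro mult_left_mono) auto
      finally have qa: "norm (q - a) \<le> ratio \<tau> * (2 * D)" .
      have "norm (\<Phi> q - \<Phi> a) \<le> L * (rU * norm v) * norm (q - a)"
        using \<Phi>(3)[of q] by (simp add: nv)
      also have "\<dots> \<le> L * (rU * t) * (ratio \<tau> * (2 * D))"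
        using L up qa rU(3) pos D \<open>0 < t\<close> by (intro mult_mono) auto
      also have "\<dots> = rU * (L * t * (ratio \<tau> * (2 * D)))"
        by (simp add: mult_ac)
      also have "\<dots> \<le> rU * (e/2)"
        using \<tau>_small rU(3) by (intro mult_left_mono) auto
      finally have \<Phi>q: "norm (\<Phi> q - \<Phi> a) \<le> e/2 * rU"
        by (simp add: mult_ac)
      have "SW (V @ \<beta>) q \<in> F"
        using SW_F setV sets qF by auto
      moreover have "norm (SW w x - SW (V @ \<beta>) q) \<le> e * ratio w"
      proof -
        have "SW w x = SW (V @ \<alpha>) (SW U x' + \<Phi> a)"
          by (simp add: w_def SW_append \<open>x = x' + v\<close> shift)
        moreover have "SW (V @ \<beta>) q = SW (V @ \<alpha>) (q + \<Phi> q)"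
          by (simp add: SW_append ab(3))
        ultimately have "norm (SW w x - SW (V @ \<beta>) q) =
            ratio (V @ \<alpha>) * norm ((SW U x' + \<Phi> a) - (q + \<Phi> q))"
          using norm_SW_diff[of "V @ \<alpha>"] setV sets by auto
        also have "(SW U x' + \<Phi> a) - (q + \<Phi> q) = (SW U x' - q) - (\<Phi> q - \<Phi> a)"
          by simp
        also have "ratio (V @ \<alpha>) * norm \<dots> \<le> ratio (V @ \<alpha>) * (e/2 * rU + e/2 * rU)"
          using Uq \<Phi>q rpos norm_triangle_ineq4[of "SW U x' - q" "\<Phi> q - \<Phi> a"]
          by (intro mult_left_mono) (auto simp: ratio_append)
        also have "\<dots> = e * ratio w"
          by (simp add: rw ratio_append algebra_simps)
        finally show ?thesis .
      qed
      ultimately show ?thesis by blast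
    qed
  qed
  with V(2) w low up dirv show ?thesis
    unfolding \<kappa>_def w_def by blast
qed

text \<open>The vectors found for accuracies \<open>1 / Suc n\<close> all lie in one compact set
  \<open>K\<close>, so a limit of a subsequence works for every accuracy. Choosing \<kappa> before
  \<open>E\<close> is what allows the step to be iterated.\<close>

lemma tangent_step:
  assumes ov: "overlap a L \<omega>" and g: "g \<in> G" and "0 < \<eta>" "0 < t"
  shows "\<exists>\<kappa>>0. \<forall>E. tangent E \<longrightarrow> (\<exists>v. \<kappa> \<le> norm v \<and> norm v \<le> t \<and>
    norm (v - norm v *\<^sub>R (g *v \<omega>)) \<le> \<eta> * norm v \<and> tangent (E \<union> (+) v ` E))"
proof -
  have "0 < \<eta>/2" using \<open>0 < \<eta>\<close> by simp
  then obtain \<Gamma> where \<Gamma>: "finite \<Gamma>" "\<Gamma> \<subseteq> words" "\<Gamma> \<noteq> {}"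
      "\<And>A. A \<in> G \<Longrightarrow> \<exists>w\<in>\<Gamma>. \<forall>x. norm (OW w *v x - A *v x) \<le> \<eta>/2 * norm x"
    using G_net by metis
  define \<kappa> where "\<kappa> = Min (ratio ` \<Gamma>) * c 1 * t"
  have "0 < \<kappa>"
    unfolding \<kappa>_def
  proof (intro mult_pos_pos)
    show "0 < Min (ratio ` \<Gamma>)"
      using \<Gamma> ratio_pos words_set by (subst Min_gr_iff) auto
  qed (use c m \<open>0 < t\<close> in auto)
  define K where "K = {v. \<kappa> \<le> norm v \<and> norm v \<le> t \<and> norm (v - norm v *\<^sub>R (g *v \<omega>)) \<le> \<eta> * norm v}"
  have "closed K"
    unfolding K_def by (intro closed_Collect_conj closed_Collect_le continuous_intros)
  moreover have "bounded K"
    unfolding bounded_iff K_def by auto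
  ultimately have K: "compact K" by (simp add: compact_eq_bounded_closed)
  have "\<exists>v\<in>K. tangent (E \<union> (+) v ` E)" if E: "tangent E" for E
  proof -
    define R where "R v w e \<longleftrightarrow> w \<in> words \<and> (\<forall>x. norm (OW w *v x - x) \<le> e * norm x) \<and>
      (\<forall>x\<in>E \<union> (+) v ` E. \<exists>y\<in>F. norm (SW w x - y) \<le> e * ratio w)" for v w e
    have "\<exists>v\<in>K. \<exists>w. R v w (1 / real (Suc n))" for n
      using tangent_step_approx[OF ov g \<open>0 < \<eta>/2\<close> \<open>0 < t\<close> E _ \<Gamma>, of "1 / real (Suc n)"]
      unfolding K_def \<kappa>_def R_def by fastforce
    then obtain v w where vw: "\<And>n. v n \<in> K" "\<And>n. R (v n) (w n) (1 / real (Suc n))"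
      by metis
    obtain u r where u: "u \<in> K" "strict_mono r" "(v \<circ> r) \<longlonglongrightarrow> u"
      using K vw(1) unfolding compact_def by blast
    have bE: "bounded E" using E by (simp add: tangent_def)
    have "tangent (E \<union> (+) u ` E)"
      unfolding tangent_def
    proof (intro conjI allI impI)
      show "bounded (E \<union> (+) u ` E)"
        using bE by (simp add: bounded_translation)
      fix e :: real assume "0 < e"
      then have "\<forall>\<^sub>F n in sequentially. dist ((v \<circ> r) n) u < e/2"
        using tendstoD[OF u(3), of "e/2"] by simp
      moreover have "\<forall>\<^sub>F n in sequentially. 1 / real (Suc n) < e/2"
        using \<open>0 < e\<close> lim_1_over_n[THEN LIMSEQ_Suc] by (intro order_tendstoD(2)) (auto simp: o_def)
      ultimately have "\<forall>\<^sub>F n in sequentially. dist ((v \<circ> r) n) u < e/2 \<and> 1 / real (Suc n) < e/2"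
        by (rule eventually_conj)
      then obtain n where n: "dist (v (r n)) u < e/2" "1 / real (Suc n) < e/2"
        by (auto dest: eventually_happens)
      define k where "k = r n"
      have k: "norm (v k - u) \<le> e/2" "1 / real (Suc k) \<le> e/2"
      proof -
        show "norm (v k - u) \<le> e/2" using n by (simp add: k_def dist_norm)
        have "1 / real (Suc k) \<le> 1 / real (Suc n)"
          using seq_suble[OF u(2), of n] by (auto simp: k_def divide_simps)
        then show "1 / real (Suc k) \<le> e/2" using n by linarith
      qed
      have R: "R (v k) (w k) (1 / real (Suc k))" by (rule vw)
      have wk: "set (w k) \<subseteq> {1..m}" using R words_set by (auto simp: R_def)
      have rp: "0 < ratio (w k)" using ratio_pos[OF wk] .
      have "norm (OW (w k) *v x - x) \<le> e * norm x" for x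
      proof -
        have "1 / real (Suc k) * norm x \<le> e * norm x"
          using k(2) \<open>0 < e\<close> by (intro mult_right_mono) auto
        with R show ?thesis unfolding R_def by (meson order_trans)
      qed
      moreover have "\<exists>y\<in>F. norm (SW (w k) x - y) \<le> e * ratio (w k)" if x: "x \<in> E \<union> (+) u ` E" for x
      proof -
        obtain x' where x': "x' \<in> E \<union> (+) (v k) ` E" "norm (x - x') \<le> e/2"
          using x
        proof
          assume "x \<in> E"
          then show ?thesis using that[of x] \<open>0 < e\<close> by auto
        next
          assume "x \<in> (+) u ` E"
          then obtain z where "z \<in> E" "x = u + z" by auto
          then show ?thesis using that[of "v k + z"] k(1) by (auto simp: norm_minus_commute)
        qed
        obtain y where y: "y \<in> F" "norm (SW (w k) x' - y) \<le> 1 / real (Suc k) * ratio (w k)"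
          using R x'(1) unfolding R_def by blast
        have "norm (SW (w k) x - y) \<le> norm (SW (w k) x - SW (w k) x') + norm (SW (w k) x' - y)"
          by (metis norm_triangle_ineq diff_add_cancel add_diff_eq)
        also have "\<dots> \<le> ratio (w k) * (e/2) + e/2 * ratio (w k)"
        proof (rule add_mono)
          show "norm (SW (w k) x - SW (w k) x') \<le> ratio (w k) * (e/2)"
            using x'(2) rp by (simp add: norm_SW_diff[OF wk])
          show "norm (SW (w k) x' - y) \<le> e/2 * ratio (w k)"
            using y(2) mult_right_mono[OF k(2) less_imp_le[OF rp]] by (rule order_trans)
        qed
        also have "\<dots> = e * ratio (w k)" by simp
        finally show ?thesis using y(1) by blast
      qed
      ultimately show "\<exists>w\<in>words. (\<forall>x. norm (OW w *v x - x) \<le> e * norm x) \<and>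
          (\<forall>x\<in>E \<union> (+) u ` E. \<exists>y\<in>F. norm (SW w x - y) \<le> e * ratio w)"
        using R unfolding R_def by blast
    qed
    with u show ?thesis by blast
  qed
  with \<open>0 < \<kappa>\<close> show ?thesis
    unfolding K_def by blast
qed

section \<open>From single translates to segments and parallelepipeds\<close>

lemma tangent_mono: "tangent E \<Longrightarrow> E' \<subseteq> E \<Longrightarrow> tangent E'"
  unfolding tangent_def by (meson bounded_subset subsetD)

lemma tangent_F: "tangent F"
proof -
  have one: "[1] \<in> words" using m by (auto simp: index_words_def)
  have "\<exists>w\<in>words. (\<forall>x. norm (OW w *v x - x) \<le> e * norm x) \<and>
     (\<forall>x\<in>F. \<exists>y\<in>F. norm (SW w x - y) \<le> e * ratio w)" if "0 < e" for e
  proof -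
    obtain v where v: "v \<in> words" "\<And>x. norm (OW (v @ [1]) *v x - x) \<le> e * norm x"
      using orth_correction[OF one \<open>0 < e\<close>] by auto
    have w: "v @ [1] \<in> words" "set (v @ [1]) \<subseteq> {1..m}"
      using v one words_append words_set by blast+
    have "\<exists>y\<in>F. norm (SW (v @ [1]) x - y) \<le> e * ratio (v @ [1])" if "x \<in> F" for x
      using SW_F[OF w(2) that] \<open>0 < e\<close> ratio_pos[OF w(2)]
      by (intro bexI[of _ "SW (v @ [1]) x"]) auto
    with v w show ?thesis by blast
  qed
  then show ?thesis
    using F_bounded by (simp add: tangent_def)
qed

text \<open>A displacement by \<open>e/2\<close> in the magnified picture becomes
  \<open>e/2 * ratio w\<close> under \<open>SW w\<close>, so half of the tolerance goes to
  \<open>E'\<close> and half to \<open>F\<close>.\<close>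

lemma tangent_approx:
  assumes "bounded E" and app: "\<And>e. 0 < e \<Longrightarrow> \<exists>E'. tangent E' \<and> (\<forall>x\<in>E. \<exists>x'\<in>E'. norm (x - x') \<le> e)"
  shows "tangent E"
  unfolding tangent_def
proof (intro conjI allI impI assms(1))
  fix e :: real assume "0 < e"
  then have "0 < e/2" by simp
  then obtain E' where E': "tangent E'" "\<And>x. x \<in> E \<Longrightarrow> \<exists>x'\<in>E'. norm (x - x') \<le> e/2"
    using app by metis
  obtain w where w: "w \<in> words" "\<And>x. norm (OW w *v x - x) \<le> e/2 * norm x"
      "\<And>x. x \<in> E' \<Longrightarrow> \<exists>y\<in>F. norm (SW w x - y) \<le> e/2 * ratio w"
    using E'(1) \<open>0 < e/2\<close> unfolding tangent_def by meson
  have ws: "set w \<subseteq> {1..m}" "0 < ratio w" using w words_set ratio_pos by auto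
  have "norm (OW w *v x - x) \<le> e * norm x" for x
    using w(2)[of x] \<open>0 < e\<close> by (smt (verit) mult_right_mono norm_ge_zero field_sum_of_halves)
  moreover have "\<exists>y\<in>F. norm (SW w x - y) \<le> e * ratio w" if x: "x \<in> E" for x
  proof -
    obtain x' where x': "x' \<in> E'" "norm (x - x') \<le> e/2"
      using E'(2) x by blast
    obtain y where y: "y \<in> F" "norm (SW w x' - y) \<le> e/2 * ratio w"
      using w(3) x' by blast
    have "norm (SW w x - y) \<le> norm (SW w x - SW w x') + norm (SW w x' - y)"
      by (metis norm_triangle_ineq diff_add_cancel add_diff_eq)
    also have "\<dots> \<le> ratio w * (e/2) + e/2 * ratio w"
      using y(2) x'(2) ws by (intro add_mono) (auto simp: norm_SW_diff)
    also have "\<dots> = e * ratio w" by simp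
    finally show ?thesis using y(1) by blast
  qed
  ultimately show "\<exists>w\<in>words. (\<forall>x. norm (OW w *v x - x) \<le> e * norm x) \<and>
      (\<forall>x\<in>E. \<exists>y\<in>F. norm (SW w x - y) \<le> e * ratio w)"
    using w(1) by blast
qed

text \<open>Each step keeps the old set and adds a translate, so all partial sums remain available.
  Since \<kappa> precedes \<open>n\<close>, the total length can be made as large as
  desired.\<close>

lemma tangent_chain:
  assumes ov: "overlap a L \<omega>" and g: "g \<in> G" and "0 < \<eta>" "0 < t" and E: "tangent E"
  shows "\<exists>\<kappa>>0. \<forall>n::nat. \<exists>E' v. tangent E' \<and>
    (\<forall>j<n. \<kappa> \<le> norm (v j) \<and> norm (v j) \<le> t \<and> norm (v j - norm (v j) *\<^sub>R (g *v \<omega>)) \<le> \<eta> * norm (v j)) \<and>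
    (\<forall>x\<in>E. \<forall>k\<le>n. x + (\<Sum>j<k. v j) \<in> E')"
proof -
  obtain \<kappa> where \<kappa>: "0 < \<kappa>" "\<And>E. tangent E \<Longrightarrow> \<exists>v. \<kappa> \<le> norm v \<and> norm v \<le> t \<and>
    norm (v - norm v *\<^sub>R (g *v \<omega>)) \<le> \<eta> * norm v \<and> tangent (E \<union> (+) v ` E)"
    using tangent_step[OF assms(1-4)] by blast
  have "\<exists>E' v. tangent E' \<and>
    (\<forall>j<n. \<kappa> \<le> norm (v j) \<and> norm (v j) \<le> t \<and> norm (v j - norm (v j) *\<^sub>R (g *v \<omega>)) \<le> \<eta> * norm (v j)) \<and>
    (\<forall>x\<in>E. \<forall>k\<le>n. x + (\<Sum>j<k. v j) \<in> E')" for n :: nat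
  proof (induction n)
    case 0
    then show ?case using E by auto
  next
    case (Suc n)
    then obtain E' v where IH: "tangent E'"
      "\<And>j. j < n \<Longrightarrow> \<kappa> \<le> norm (v j) \<and> norm (v j) \<le> t \<and> norm (v j - norm (v j) *\<^sub>R (g *v \<omega>)) \<le> \<eta> * norm (v j)"
      "\<And>x k. x \<in> E \<Longrightarrow> k \<le> n \<Longrightarrow> x + (\<Sum>j<k. v j) \<in> E'"
      by blast
    obtain u where u: "\<kappa> \<le> norm u" "norm u \<le> t" "norm (u - norm u *\<^sub>R (g *v \<omega>)) \<le> \<eta> * norm u"
      "tangent (E' \<union> (+) u ` E')"
      using \<kappa>(2)[OF IH(1)] by blast
    define v' where "v' = v(n := u)"
    have eq: "(\<Sum>j<k. v' j) = (\<Sum>j<k. v j)" if "k \<le> n" for k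
      using that by (intro sum.cong) (auto simp: v'_def)
    have "x + (\<Sum>j<k. v' j) \<in> E' \<union> (+) u ` E'" if "x \<in> E" "k \<le> Suc n" for x k
    proof (cases "k = Suc n")
      case True
      then have "x + (\<Sum>j<k. v' j) = u + (x + (\<Sum>j<n. v j))"
        by (simp add: eq) (simp add: v'_def)
      then show ?thesis using IH(3)[OF that(1), of n] by auto
    next
      case False
      then show ?thesis using IH(3) that eq by auto
    qed
    moreover have "\<forall>j<Suc n. \<kappa> \<le> norm (v' j) \<and> norm (v' j) \<le> t \<and>
        norm (v' j - norm (v' j) *\<^sub>R (g *v \<omega>)) \<le> \<eta> * norm (v' j)"
      using IH(2) u by (auto simp: v'_def less_Suc_eq)
    ultimately show ?case using u(4) by blast
  qed
  with \<kappa>(1) show ?thesis by blast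
qed

text \<open>A chain of steps of length at most \<open>e/2\<close> and total length above 1 has
  partial sums that follow the segment: they deviate from the direction \<open>g *v \<omega>\<close>
  by at most \<open>e/2\<close> times the length travelled.\<close>

lemma tangent_segment:
  assumes ov: "overlap a L \<omega>" and g: "g \<in> G" and E: "tangent E"
  shows "tangent {x + s *\<^sub>R (g *v \<omega>) | x s. x \<in> E \<and> 0 \<le> s \<and> s \<le> 1}" (is "tangent ?E")
proof (rule tangent_approx)
  obtain D where D: "\<And>x. x \<in> E \<Longrightarrow> norm x \<le> D"
    using E unfolding tangent_def bounded_iff by blast
  have ng: "norm (g *v \<omega>) = 1"
    using ov norm_orthogonal_matrix_mult[OF G_orthogonal[OF g]] by (simp add: overlap_def)
  have "norm (x + s *\<^sub>R (g *v \<omega>)) \<le> D + 1" if "x \<in> E" "0 \<le> s" "s \<le> 1" for x s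
    using D[OF that(1)] that ng norm_triangle_ineq[of x "s *\<^sub>R (g *v \<omega>)"] by simp
  then show "bounded ?E"
    unfolding bounded_iff by auto
  fix e :: real assume "0 < e"
  then have e2: "0 < e/2" by simp
  obtain \<kappa> where \<kappa>: "0 < \<kappa>" "\<And>n::nat. \<exists>E' v. tangent E' \<and>
    (\<forall>j<n. \<kappa> \<le> norm (v j) \<and> norm (v j) \<le> e/2 \<and> norm (v j - norm (v j) *\<^sub>R (g *v \<omega>)) \<le> e/2 * norm (v j)) \<and>
    (\<forall>x\<in>E. \<forall>k\<le>n. x + (\<Sum>j<k. v j) \<in> E')"
    using tangent_chain[OF ov g e2 e2 E] by blast
  obtain n where n: "1 < real n * \<kappa>"
    using reals_Archimedean3[OF \<kappa>(1)] by blast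
  obtain E' v where E': "tangent E'" and v: "\<And>j. j < n \<Longrightarrow> \<kappa> \<le> norm (v j)" "\<And>j. j < n \<Longrightarrow> norm (v j) \<le> e/2"
    "\<And>j. j < n \<Longrightarrow> norm (v j - norm (v j) *\<^sub>R (g *v \<omega>)) \<le> e/2 * norm (v j)"
    and mem: "\<And>x k. x \<in> E \<Longrightarrow> k \<le> n \<Longrightarrow> x + (\<Sum>j<k. v j) \<in> E'"
    using \<kappa>(2)[of n] by blast
  define l where "l k = (\<Sum>j<k. norm (v j))" for k
  have "\<exists>x'\<in>E'. norm (x + s *\<^sub>R (g *v \<omega>) - x') \<le> e" if x: "x \<in> E" and s: "0 \<le> s" "s \<le> 1" for x s
  proof -
    \<comment> \<open>The first moment when the chain is longer than \<open>s\<close>; its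
      predecessor \<open>i\<close> has length between \<open>s - e/2\<close> and
      \<open>s\<close>.\<close>
    define k where "k = (LEAST k. s < l k)"
    have "real n * \<kappa> \<le> l n"
      unfolding l_def using sum_bounded_below[of "{..<n}" \<kappa> "\<lambda>j. norm (v j)"] v(1) by simp
    then have sn: "s < l n" using n s by linarith
    then have k: "s < l k" "k \<le> n"
      unfolding k_def by (auto intro: LeastI Least_le)
    then obtain i where i: "k = Suc i"
      using s by (cases k) (auto simp: l_def)
    have "\<not> s < l i"
      using not_less_Least[of i "\<lambda>k. s < l k"] i by (simp add: k_def)
    then have li: "l i \<le> s" "s \<le> l i + e/2"
      using k i v(2)[of i] by (auto simp: l_def)
    have "norm ((\<Sum>j<i. v j) - l i *\<^sub>R (g *v \<omega>)) = norm (\<Sum>j<i. v j - norm (v j) *\<^sub>R (g *v \<omega>))"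
      by (simp add: l_def sum_subtractf scaleR_sum_left)
    also have "\<dots> \<le> (\<Sum>j<i. e/2 * norm (v j))"
      using v(3) i k by (intro sum_norm_le) auto
    also have "\<dots> = e/2 * l i"
      by (simp add: l_def sum_distrib_left)
    also have "\<dots> \<le> e/2"
      using li s \<open>0 < e\<close> by simp
    finally have 1: "norm ((\<Sum>j<i. v j) - l i *\<^sub>R (g *v \<omega>)) \<le> e/2" .
    have 2: "norm (s *\<^sub>R (g *v \<omega>) - l i *\<^sub>R (g *v \<omega>)) \<le> e/2"
      using li ng by (simp add: scaleR_diff_left[symmetric])
    have "norm (x + s *\<^sub>R (g *v \<omega>) - (x + (\<Sum>j<i. v j))) =
        norm ((s *\<^sub>R (g *v \<omega>) - l i *\<^sub>R (g *v \<omega>)) - ((\<Sum>j<i. v j) - l i *\<^sub>R (g *v \<omega>)))"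
      by simp
    also have "\<dots> \<le> e"
      using norm_triangle_ineq4 1 2 by (smt (verit) field_sum_of_halves)
    finally show ?thesis
      using mem[OF x, of i] i k by (intro bexI[of _ "x + (\<Sum>j<i. v j)"]) auto
  qed
  then show "\<exists>E'. tangent E' \<and> (\<forall>x\<in>?E. \<exists>x'\<in>E'. norm (x - x') \<le> e)"
    using E' by blast
qed

text \<open>One segment is added per vector of \<open>B\<close>. Starting from all of
  \<open>F\<close>, not from a single point, preserves its extent across \<open>B\<close>, which
  later yields strict inequalities.\<close>

lemma tangent_parallelepiped:
  assumes ov: "overlap a L \<omega>" and "finite B" "B \<subseteq> (\<lambda>g. g *v \<omega>) ` G"
  shows "tangent {x + (\<Sum>v\<in>B. t v *\<^sub>R v) | x t. x \<in> F \<and> (\<forall>v\<in>B. 0 \<le> t v \<and> t v \<le> (1::real))}"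
  using assms(2,3)
proof (induction B)
  case empty
  then show ?case using tangent_F by simp
next
  case (insert u B)
  then obtain g where g: "g \<in> G" "u = g *v \<omega>" by auto
  let ?E = "{x + (\<Sum>v\<in>B. t v *\<^sub>R v) | x t. x \<in> F \<and> (\<forall>v\<in>B. 0 \<le> t v \<and> t v \<le> (1::real))}"
  have "tangent {x + s *\<^sub>R (g *v \<omega>) | x s. x \<in> ?E \<and> 0 \<le> s \<and> s \<le> 1}"
    using insert by (intro tangent_segment[OF ov g(1)]) auto
  then show ?case
  proof (rule tangent_mono, intro subsetI)
    fix y assume "y \<in> {x + (\<Sum>v\<in>insert u B. t v *\<^sub>R v) | x t. x \<in> F \<and> (\<forall>v\<in>insert u B. 0 \<le> t v \<and> t v \<le> (1::real))}"
    then obtain x t where xt: "x \<in> F" "\<And>v. v \<in> insert u B \<Longrightarrow> 0 \<le> t v \<and> t v \<le> (1::real)"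
      "y = (x + (\<Sum>v\<in>B. t v *\<^sub>R v)) + t u *\<^sub>R (g *v \<omega>)"
      using insert.hyps by (auto simp: g(2) algebra_simps)
    have "x + (\<Sum>v\<in>B. t v *\<^sub>R v) \<in> ?E"
      using xt by blast
    then show "y \<in> {x + s *\<^sub>R (g *v \<omega>) | x s. x \<in> ?E \<and> 0 \<le> s \<and> s \<le> 1}"
      using xt(2)[of u] xt(3) by blast
  qed
qed

section \<open>Lower bounds for Assouad exponents\<close>

text \<open>Points of \<open>E\<close> correspond to nearby points of \<open>F\<close> at scale
  \<open>ratio w\<close>. Because \<open>OW w\<close> is almost the identity, \<open>p\<close> sees
  their differences almost undistorted, so separation survives the projection. The quotient of the
  two radii is \<open>4 * H / \<delta>\<close>, whatever \<open>w\<close> is, which makes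
  \<open>C\<close> independent of \<delta>.\<close>

lemma tangent_exponent_bound:
  fixes p :: "real^'n \<Rightarrow> real^'n"
  assumes E: "tangent E" and p: "linear p" and \<alpha>: "assouad_exponent (p ` F) \<alpha>"
  shows "\<exists>C. \<forall>\<delta> I x. 0 < \<delta> \<longrightarrow> \<delta> < 1 \<longrightarrow> finite I \<longrightarrow> x ` I \<subseteq> E \<longrightarrow>
    (\<forall>i\<in>I. \<forall>j\<in>I. i \<noteq> j \<longrightarrow> \<delta> \<le> norm (p (x i - x j))) \<longrightarrow> real (card I) \<le> C * (1 / \<delta>) powr \<alpha>"
proof -
  obtain c0 where c0: "\<And>r R x. 0 < r \<Longrightarrow> r < R \<Longrightarrow> x \<in> p ` F \<Longrightarrow>
      real (covering_number r (cball x R \<inter> p ` F)) \<le> c0 * (R / r) powr \<alpha>"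
    using \<alpha> unfolding assouad_exponent_def by metis
  obtain D0 where D0: "\<And>x. x \<in> E \<Longrightarrow> norm x \<le> D0"
    using E unfolding tangent_def bounded_iff by blast
  \<comment> \<open>At least 1, so that the two approximation errors are absorbed by
    \<open>2 * D + 2 \<le> 4 * D\<close>.\<close>
  define D where "D = max 1 D0"
  have D: "1 \<le> D" "\<And>x. x \<in> E \<Longrightarrow> norm x \<le> D" using D0 by (simp_all add: D_def le_max_iff_disj)
  obtain K where K: "0 < K" "\<And>x. norm (p x) \<le> K * norm x"
    using linear_bounded_pos[OF p] by blast
  define H where "H = 2 * K * D + 1"
  have H: "1 < H" using K D by (simp add: H_def)
  have main: "real (card I) \<le> \<bar>c0\<bar> * (4 * H) powr \<alpha> * (1 / \<delta>) powr \<alpha>"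
    if \<delta>: "0 < \<delta>" "\<delta> < 1" and I: "finite I" "x ` I \<subseteq> E"
      and sep: "\<And>i j. i \<in> I \<Longrightarrow> j \<in> I \<Longrightarrow> i \<noteq> j \<Longrightarrow> \<delta> \<le> norm (p (x i - x j))" for \<delta> I x
  proof (cases "I = {}")
    case True
    then show ?thesis by simp
  next
    case False
    then obtain i0 where i0: "i0 \<in> I" by blast
    define e where "e = \<delta> / (16 * K * D)"
    have e: "0 < e" using \<delta> K D by (simp add: e_def)
    have KeD: "K * e * (4 * D) = \<delta> / 4" using K D by (simp add: e_def)
    obtain w where w: "w \<in> words" "\<And>x. norm (OW w *v x - x) \<le> e * norm x"
      "\<And>x. x \<in> E \<Longrightarrow> \<exists>y\<in>F. norm (SW w x - y) \<le> e * ratio w"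
      using E e unfolding tangent_def by meson
    have ws: "set w \<subseteq> {1..m}" using w words_set by auto
    define \<rho> where "\<rho> = ratio w"
    have \<rho>: "0 < \<rho>" using ratio_pos[OF ws] by (simp add: \<rho>_def)
    have "\<forall>i\<in>I. \<exists>y. y \<in> F \<and> norm (SW w (x i) - y) \<le> e * \<rho>"
      using w(3) I(2) unfolding \<rho>_def image_subset_iff by blast
    from bchoice[OF this] obtain y where y: "\<And>i. i \<in> I \<Longrightarrow> y i \<in> F"
      "\<And>i. i \<in> I \<Longrightarrow> norm (SW w (x i) - y i) \<le> e * \<rho>"
      by blast
    have close: "norm (p (y i - y j) - \<rho> *\<^sub>R p (x i - x j)) \<le> \<rho> * (\<delta> / 4)" if ij: "i \<in> I" "j \<in> I" for i j
    proof -
      define z where "z = x i - x j"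
      have xE: "x i \<in> E" "x j \<in> E" using I ij by auto
      have nz: "norm z \<le> 2 * D"
        using D(2)[OF xE(1)] D(2)[OF xE(2)] norm_triangle_ineq4[of "x i" "x j"] by (simp add: z_def)
      have "(y i - y j) - \<rho> *\<^sub>R z = (\<rho> *\<^sub>R (OW w *v z - z)) - ((SW w (x i) - y i) - (SW w (x j) - y j))"
        using SW_diff[OF ws, of "x i" "x j"] by (simp add: z_def \<rho>_def algebra_simps)
      also have "norm \<dots> \<le> norm (\<rho> *\<^sub>R (OW w *v z - z)) + norm ((SW w (x i) - y i) - (SW w (x j) - y j))"
        by (rule norm_triangle_ineq4)
      also have "\<dots> \<le> \<rho> * (e * (2 * D)) + (e * \<rho> + e * \<rho>)"
      proof (rule add_mono)
        have "norm (OW w *v z - z) \<le> e * (2 * D)"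
          using w(2)[of z] mult_left_mono[OF nz less_imp_le[OF e]] by (rule order_trans)
        then show "norm (\<rho> *\<^sub>R (OW w *v z - z)) \<le> \<rho> * (e * (2 * D))"
          using \<rho> by simp
        show "norm ((SW w (x i) - y i) - (SW w (x j) - y j)) \<le> e * \<rho> + e * \<rho>"
          using y(2)[OF ij(1)] y(2)[OF ij(2)] norm_triangle_ineq4[of "SW w (x i) - y i" "SW w (x j) - y j"]
          by linarith
      qed
      also have "\<dots> = \<rho> * (e * (2 * D + 2))" by (simp add: algebra_simps)
      also have "\<dots> \<le> \<rho> * (e * (4 * D))"
        using \<rho> e D by (intro mult_left_mono) auto
      finally have 1: "norm ((y i - y j) - \<rho> *\<^sub>R z) \<le> \<rho> * (e * (4 * D))" .
      have "norm (p (y i - y j) - \<rho> *\<^sub>R p z) = norm (p ((y i - y j) - \<rho> *\<^sub>R z))"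
        using p by (simp add: linear_diff linear_cmul)
      also have "\<dots> \<le> K * (\<rho> * (e * (4 * D)))"
        using K(2)[of "(y i - y j) - \<rho> *\<^sub>R z"] mult_left_mono[OF 1 less_imp_le[OF K(1)]] by (rule order_trans)
      also have "\<dots> = \<rho> * (\<delta> / 4)"
        using KeD by (metis mult.assoc mult.left_commute)
      finally show ?thesis by (simp add: z_def)
    qed
    \<comment> \<open>The projected points are separated by at least three quarters of
      \<open>\<rho> * \<delta>\<close>, which exceeds \<open>2 * r\<close>.\<close>
    define r where "r = \<rho> * (\<delta> / 4)"
    have r4: "r = \<rho> * \<delta> / 4" by (simp add: r_def)
    have r: "0 < r" using \<rho> \<delta> by (simp add: r_def)
    have pdiff: "p (y i) - p (y j) = p (y i - y j)" for i j
      using p by (simp add: linear_diff)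
    have "card I \<le> covering_number r (cball (p (y i0)) (\<rho> * H) \<inter> p ` F)"
    proof (rule covering_number_ge[where x = "\<lambda>i. p (y i)"])
      show "bounded (cball (p (y i0)) (\<rho> * H) \<inter> p ` F)"
        by (auto intro: bounded_subset[OF bounded_cball])
      show "2 * r < dist (p (y i)) (p (y j))" if ij: "i \<in> I" "j \<in> I" "i \<noteq> j" for i j
      proof -
        have "\<rho> * \<delta> \<le> norm (\<rho> *\<^sub>R p (x i - x j))"
          using sep[OF ij] \<rho> by simp
        also have "\<dots> \<le> norm (p (y i - y j)) + norm (p (y i - y j) - \<rho> *\<^sub>R p (x i - x j))"
          by (metis norm_triangle_sub norm_minus_commute)
        also have "\<dots> \<le> norm (p (y i - y j)) + r"
          using close[OF ij(1,2)] by (simp add: r_def)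
        also have "\<dots> = norm (p (y i - y j)) + \<rho> * \<delta> / 4" by (simp add: r4)
        finally show ?thesis
          using mult_pos_pos[OF \<rho> \<delta>(1)] unfolding dist_norm pdiff r4 by linarith
      qed
      show "(\<lambda>i. p (y i)) ` I \<subseteq> cball (p (y i0)) (\<rho> * H) \<inter> p ` F"
      proof
        fix z assume "z \<in> (\<lambda>i. p (y i)) ` I"
        then obtain i where i: "i \<in> I" "z = p (y i)" by blast
        have "norm (p (x i - x i0)) \<le> K * (2 * D)"
        proof -
          have "norm (x i - x i0) \<le> 2 * D"
            using D(2)[of "x i"] D(2)[of "x i0"] subsetD[OF I(2)] i i0 norm_triangle_ineq4[of "x i" "x i0"]
            by force
          from mult_left_mono[OF this less_imp_le[OF K(1)]] show ?thesis
            using K(2)[of "x i - x i0"] by (rule order_trans[rotated])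
        qed
        then have "norm (\<rho> *\<^sub>R p (x i - x i0)) \<le> \<rho> * (K * (2 * D))"
          using \<rho> by simp
        moreover have "norm (p (y i - y i0)) \<le> norm (\<rho> *\<^sub>R p (x i - x i0)) + \<rho> * (\<delta> / 4)"
          using close[OF i(1) i0] norm_triangle_sub[of "p (y i - y i0)" "\<rho> *\<^sub>R p (x i - x i0)"] by linarith
        moreover have "\<rho> * (\<delta> / 4) \<le> \<rho> * 1" using \<rho> \<delta> by (intro mult_left_mono) auto
        moreover have "\<rho> * H = \<rho> * (K * (2 * D)) + \<rho> * 1" by (simp add: H_def algebra_simps)
        ultimately have "norm (p (y i - y i0)) \<le> \<rho> * H" by linarith
        then have "dist (p (y i0)) (p (y i)) \<le> \<rho> * H"
          by (metis dist_commute dist_norm pdiff)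
        then show "z \<in> cball (p (y i0)) (\<rho> * H) \<inter> p ` F"
          using y(1)[OF i(1)] i(2) by simp
      qed
    qed (use I r in auto)
    then have "real (card I) \<le> real (covering_number r (cball (p (y i0)) (\<rho> * H) \<inter> p ` F))" by simp
    also have "\<dots> \<le> c0 * (\<rho> * H / r) powr \<alpha>"
    proof (rule c0[OF r])
      have "\<rho> * (\<delta> / 4) < \<rho> * H" using \<delta> H \<rho> by simp
      then show "r < \<rho> * H" by (simp add: r_def)
    qed (use y(1) i0 in auto)
    also have "\<dots> \<le> \<bar>c0\<bar> * (\<rho> * H / r) powr \<alpha>"
      by (intro mult_right_mono) auto
    also have "\<rho> * H / r = (4 * H) * (1 / \<delta>)"
      using \<rho> \<delta> by (simp add: r_def)
    also have "((4 * H) * (1 / \<delta>)) powr \<alpha> = (4 * H) powr \<alpha> * (1 / \<delta>) powr \<alpha>"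
      using H \<delta> by (intro powr_mult)
    finally show ?thesis by (simp add: mult.assoc)
  qed
  show ?thesis
    by (intro exI allI impI, rule main) (assumption | blast)+
qed

text \<open>Over each point of \<open>Y\<close> stands a grid of \<open>N ^ card B\<close> points of
  the parallelepiped. Points over different \<open>y\<close> are separated for all coefficients
  \<open>t\<close> by assumption; points over the same \<open>y\<close> are separated because
  \<open>B\<close> is independent and fixed by \<open>p\<close>.\<close>

lemma exponent_count:
  fixes p :: "real^'n \<Rightarrow> real^'n"
  assumes ov: "overlap a L \<omega>" and B: "independent B" "B \<subseteq> (\<lambda>g. g *v \<omega>) ` G"
    and p: "linear p" "\<forall>b\<in>B. p b = b" and \<alpha>: "assouad_exponent (p ` F) \<alpha>"
  shows "\<exists>C. \<forall>N\<ge>2. \<forall>Y. finite Y \<longrightarrow> Y \<subseteq> F \<longrightarrow>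
    (\<forall>y\<in>Y. \<forall>y'\<in>Y. y \<noteq> y' \<longrightarrow> (\<forall>t. 1 / real N \<le> norm (p (y - y') + (\<Sum>b\<in>B. t b *\<^sub>R b)))) \<longrightarrow>
    real (card Y) * real N ^ card B \<le> C * real N powr \<alpha>"
proof -
  have fin: "finite B" using B(1) by (rule independent_imp_finite)
  let ?E = "{x + (\<Sum>v\<in>B. t v *\<^sub>R v) | x t. x \<in> F \<and> (\<forall>v\<in>B. 0 \<le> t v \<and> t v \<le> (1::real))}"
  obtain C where C: "\<forall>\<delta> (I::((real^'n) \<times> (real^'n \<Rightarrow> nat)) set) x. 0 < \<delta> \<longrightarrow> \<delta> < 1 \<longrightarrow> finite I \<longrightarrow> x ` I \<subseteq> ?E \<longrightarrow>
    (\<forall>i\<in>I. \<forall>j\<in>I. i \<noteq> j \<longrightarrow> \<delta> \<le> norm (p (x i - x j))) \<longrightarrow> real (card I) \<le> C * (1 / \<delta>) powr \<alpha>"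
    using tangent_exponent_bound[OF tangent_parallelepiped[OF ov fin B(2)] p(1) \<alpha>]
    by (elim exE) (rule that)
  obtain \<kappa> where \<kappa>: "0 < \<kappa>" "\<kappa> \<le> 1" "\<And>t b. b \<in> B \<Longrightarrow> \<kappa> * \<bar>t b\<bar> \<le> norm (\<Sum>b\<in>B. t b *\<^sub>R b)"
    using independent_lower_bound[OF B(1)] by blast
  have main: "real (card Y) * real N ^ card B \<le> C * (1 / \<kappa>) powr \<alpha> * real N powr \<alpha>"
    if N: "2 \<le> N" and Y: "finite Y" "Y \<subseteq> F"
      and sep: "\<And>y y' t. y \<in> Y \<Longrightarrow> y' \<in> Y \<Longrightarrow> y \<noteq> y' \<Longrightarrow> 1 / real N \<le> norm (p (y - y') + (\<Sum>b\<in>B. t b *\<^sub>R b))"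
    for N Y
  proof -
    define I where "I = Y \<times> (B \<rightarrow>\<^sub>E {..<N})"
    define x where "x i = fst i + (\<Sum>b\<in>B. (real (snd i b) / real N) *\<^sub>R b)" for i
    have finI: "finite I" using Y fin by (auto simp: I_def intro!: finite_PiE)
    have card: "card I = card Y * N ^ card B"
      using fin by (simp add: I_def card_cartesian_product card_PiE)
    have sub: "x ` I \<subseteq> ?E"
    proof
      fix z assume "z \<in> x ` I"
      then obtain y j where yj: "y \<in> Y" "j \<in> B \<rightarrow>\<^sub>E {..<N}" "z = x (y, j)" by (auto simp: I_def)
      have "z = y + (\<Sum>b\<in>B. (real (j b) / real N) *\<^sub>R b)" using yj by (simp add: x_def)
      moreover have "0 \<le> real (j b) / real N \<and> real (j b) / real N \<le> 1" if "b \<in> B" for b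
        using PiE_mem[OF yj(2) that] by (auto simp: divide_le_eq_1)
      moreover have "y \<in> F" using yj Y by auto
      ultimately show "z \<in> ?E" by (intro CollectI exI[of _ y] exI[of _ "\<lambda>b. real (j b) / real N"]) auto
    qed
    have "\<kappa> / real N \<le> norm (p (x i - x j))" if ij: "i \<in> I" "j \<in> I" "i \<noteq> j" for i j
    proof -
      obtain y s y' s' where i: "i = (y, s)" and j: "j = (y', s')" by fastforce
      define t where "t b = real (s b) / real N - real (s' b) / real N" for b
      have "x i - x j = (y - y') + (\<Sum>b\<in>B. t b *\<^sub>R b)"
        by (simp add: x_def i j t_def scaleR_diff_left sum_subtractf)
      then have px: "p (x i - x j) = p (y - y') + (\<Sum>b\<in>B. t b *\<^sub>R b)"
        using p by (simp add: linear_add linear_sum linear_cmul)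
      show ?thesis
      proof (cases "y = y'")
        case False
        have "\<kappa> / real N \<le> 1 / real N" using \<kappa> N by (simp add: divide_right_mono)
        also have "\<dots> \<le> norm (p (x i - x j))"
          unfolding px using ij False by (intro sep) (auto simp: I_def i j)
        finally show ?thesis .
      next
        case True
        then have "s \<noteq> s'" using ij i j by auto
        moreover have "s \<in> B \<rightarrow>\<^sub>E {..<N}" "s' \<in> B \<rightarrow>\<^sub>E {..<N}" using ij by (auto simp: I_def i j)
        ultimately obtain b where b: "b \<in> B" "s b \<noteq> s' b"
          by (meson PiE_ext)
        have "1 \<le> \<bar>real (s b) - real (s' b)\<bar>" using b(2) by linarith
        then have "1 / real N \<le> \<bar>t b\<bar>"
          using N by (simp add: t_def diff_divide_distrib[symmetric] abs_divide divide_right_mono)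
        then have "\<kappa> / real N \<le> \<kappa> * \<bar>t b\<bar>"
          using mult_left_mono[of "1 / real N" "\<bar>t b\<bar>" \<kappa>] \<kappa>(1) by simp
        also have "\<dots> \<le> norm (\<Sum>b\<in>B. t b *\<^sub>R b)" by (rule \<kappa>(3)[OF b(1)])
        finally show ?thesis
          using px True p(1) by (simp add: linear_0)
      qed
    qed
    moreover have "\<kappa> / real N < 1" "0 < \<kappa> / real N" using \<kappa> N by auto
    ultimately have "real (card I) \<le> C * (1 / (\<kappa> / real N)) powr \<alpha>"
      using finI sub by (intro C[rule_format])
    also have "1 / (\<kappa> / real N) = (1 / \<kappa>) * real N" by simp
    also have "\<dots> powr \<alpha> = (1 / \<kappa>) powr \<alpha> * real N powr \<alpha>"
      using \<kappa> by (intro powr_mult)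
    finally show ?thesis using card by (simp add: mult.assoc)
  qed
  show ?thesis
    by (intro exI allI impI, rule main) (assumption | blast)+
qed

text \<open>A single point as \<open>Y\<close> already suffices: only the grid along
  \<open>B\<close> is counted.\<close>

lemma card_le_exponent:
  fixes p :: "real^'n \<Rightarrow> real^'n"
  assumes ov: "overlap a L \<omega>" and B: "independent B" "B \<subseteq> (\<lambda>g. g *v \<omega>) ` G"
    and p: "linear p" "\<forall>b\<in>B. p b = b" and \<alpha>: "assouad_exponent (p ` F) \<alpha>"
  shows "real (card B) \<le> \<alpha>"
proof -
  obtain C where C: "\<forall>N\<ge>2. \<forall>Y. finite Y \<longrightarrow> Y \<subseteq> F \<longrightarrow>
    (\<forall>y\<in>Y. \<forall>y'\<in>Y. y \<noteq> y' \<longrightarrow> (\<forall>t. 1 / real N \<le> norm (p (y - y') + (\<Sum>b\<in>B. t b *\<^sub>R b)))) \<longrightarrow>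
    real (card Y) * real N ^ card B \<le> C * real N powr \<alpha>"
    using exponent_count[OF assms] by (elim exE) (rule that)
  obtain y where y: "y \<in> F" using F_nonempty by blast
  show ?thesis
  proof (rule powr_exponent_le)
    fix N :: nat assume "2 \<le> N"
    then show "real N powr real (card B) \<le> C * real N powr \<alpha>"
      using C[rule_format, of N "{y}"] y by (simp add: powr_realpow)
  qed
qed

lemma assouad_dim_ge_card:
  fixes p :: "real^'n \<Rightarrow> real^'n"
  assumes ov: "overlap a L \<omega>" and B: "independent B" "B \<subseteq> (\<lambda>g. g *v \<omega>) ` G"
    and p: "linear p" "\<forall>b\<in>B. p b = b"
  shows "real (card B) \<le> assouad_dim (p ` F)"
proof (rule assouad_dim_ge)
  show "assouad_exponent (p ` F) (real (dim (UNIV :: (real^'n) set)))"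
    by (rule assouad_exponent_subspace) auto
  show "real (card B) \<le> \<alpha>" if "assouad_exponent (p ` F) \<alpha>" for \<alpha>
    using card_le_exponent[OF assms that] .
qed

section \<open>Existence of overlaps\<close>

lemma SW_bij:
  assumes "set w \<subseteq> {1..m}"
  shows "inj (SW w)" "surj (SW w)"
proof -
  show "inj (SW w)"
  proof (rule injI)
    fix x y assume "SW w x = SW w y"
    then show "x = y"
      using norm_SW_diff[OF assms, of x y] ratio_pos[OF assms] by simp
  qed
  have "SW w (transpose (OW w) *v ((1 / ratio w) *\<^sub>R (y - SW w 0))) = y" for y
  proof -
    have "SW w z = ratio w *\<^sub>R (OW w *v z) + SW w 0" for z
      using SW_diff[OF assms, of z 0] by (simp add: algebra_simps)
    from this[of "transpose (OW w) *v ((1 / ratio w) *\<^sub>R (y - SW w 0))"] show ?thesis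
      using ratio_pos[OF assms] by (simp only: transpose_cancel[OF OW_orthogonal[OF assms]]) simp
  qed
  then show "surj (SW w)" by (rule surjI)
qed

lemma SW_displacement:
  assumes "set \<alpha> \<subseteq> {1..m}"
  shows "SW \<beta> x = SW \<alpha> (x + displacement S \<alpha> \<beta> x)"
  using SW_bij[OF assms] by (simp add: displacement_def surj_f_inv_f)

lemma displacement_affine:
  assumes "set \<alpha> \<subseteq> {1..m}" "set \<beta> \<subseteq> {1..m}"
  shows "\<exists>M v. \<forall>x. displacement S \<alpha> \<beta> x = M *v x + v"
proof -
  define M where "M = (ratio \<beta> / ratio \<alpha>) *\<^sub>R (transpose (OW \<alpha>) ** OW \<beta>) - mat 1"
  define v where "v = (1 / ratio \<alpha>) *\<^sub>R (transpose (OW \<alpha>) *v (SW \<beta> 0 - SW \<alpha> 0))"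
  have "displacement S \<alpha> \<beta> x = M *v x + v" for x
  proof -
    have Mx: "x + (M *v x + v) = (1 / ratio \<alpha>) *\<^sub>R (transpose (OW \<alpha>) *v (ratio \<beta> *\<^sub>R (OW \<beta> *v x) + (SW \<beta> 0 - SW \<alpha> 0)))"
      by (simp add: M_def v_def matrix_vector_mult_diff_rdistrib scaleR_matrix_vector_assoc[symmetric]
          matrix_vector_mul_assoc[symmetric] matrix_vector_right_distrib matrix_vector_mult_scaleR scaleR_right_distrib
          del: transpose_matrix_vector)
    have "SW \<alpha> (x + (M *v x + v)) = ratio \<alpha> *\<^sub>R (OW \<alpha> *v (x + (M *v x + v))) + SW \<alpha> 0"
      using SW_diff[OF assms(1), of "x + (M *v x + v)" 0] by (simp add: algebra_simps)
    also have "\<dots> = ratio \<beta> *\<^sub>R (OW \<beta> *v x) + (SW \<beta> 0 - SW \<alpha> 0) + SW \<alpha> 0"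
      unfolding Mx matrix_vector_mult_scaleR transpose_cancel(2)[OF OW_orthogonal[OF assms(1)]]
      using ratio_pos[OF assms(1)] by simp
    also have "\<dots> = SW \<beta> x"
      using SW_diff[OF assms(2), of x 0] by (simp add: algebra_simps)
    finally have "SW \<alpha> (x + (M *v x + v)) = SW \<alpha> (x + displacement S \<alpha> \<beta> x)"
      using SW_displacement[OF assms(1)] by simp
    then show ?thesis
      using SW_bij(1)[OF assms(1)] by (simp add: inj_eq)
  qed
  then show ?thesis by blast
qed

text \<open>A single far index of the sequence meets both tolerances. This is the common exit for
  the two sources of overlaps: given overlapping directions and the bare failure of weak
  separation.\<close>

lemma overlapI:
  assumes "a \<in> F" "0 \<le> L" "norm \<omega> = 1"
    and \<Phi>: "\<And>n::nat. \<alpha> n \<in> words" "\<And>n. \<beta> n \<in> words" "\<And>n. \<Phi> n = displacement S (\<alpha> n) (\<beta> n)"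
    and lim: "(\<lambda>n. \<Phi> n a) \<longlonglongrightarrow> 0" "(\<lambda>n. (1 / norm (\<Phi> n a)) *\<^sub>R \<Phi> n a) \<longlonglongrightarrow> \<omega>"
    and L: "\<forall>\<^sub>F n in sequentially. \<Phi> n a \<noteq> 0 \<and> (\<forall>x. norm (\<Phi> n x - \<Phi> n a) \<le> L * norm (\<Phi> n a) * norm (x - a))"
  shows "overlap a L \<omega>"
  unfolding overlap_def
proof (intro conjI allI impI assms(1-3))
  fix \<delta> \<eta> :: real assume "0 < \<delta>" "0 < \<eta>"
  have "\<forall>\<^sub>F n in sequentially. dist (\<Phi> n a) 0 < \<delta>"
    "\<forall>\<^sub>F n in sequentially. dist ((1 / norm (\<Phi> n a)) *\<^sub>R \<Phi> n a) \<omega> < \<eta>"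
    using tendstoD[OF lim(1) \<open>0 < \<delta>\<close>] tendstoD[OF lim(2) \<open>0 < \<eta>\<close>] by auto
  with L have "\<forall>\<^sub>F n in sequentially. dist (\<Phi> n a) 0 < \<delta> \<and> dist ((1 / norm (\<Phi> n a)) *\<^sub>R \<Phi> n a) \<omega> < \<eta> \<and>
      \<Phi> n a \<noteq> 0 \<and> (\<forall>x. norm (\<Phi> n x - \<Phi> n a) \<le> L * norm (\<Phi> n a) * norm (x - a))"
    by eventually_elim auto
  then obtain n where n: "norm (\<Phi> n a) < \<delta>" "norm ((1 / norm (\<Phi> n a)) *\<^sub>R \<Phi> n a - \<omega>) < \<eta>"
      "\<Phi> n a \<noteq> 0" "\<And>x. norm (\<Phi> n x - \<Phi> n a) \<le> L * norm (\<Phi> n a) * norm (x - a)"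
    by (auto simp: dist_norm dest: eventually_happens)
  have "\<Phi> n a - norm (\<Phi> n a) *\<^sub>R \<omega> = norm (\<Phi> n a) *\<^sub>R ((1 / norm (\<Phi> n a)) *\<^sub>R \<Phi> n a - \<omega>)"
    using n(3) by (simp add: scaleR_diff_right)
  then have "norm (\<Phi> n a - norm (\<Phi> n a) *\<^sub>R \<omega>) =
      norm (\<Phi> n a) * norm ((1 / norm (\<Phi> n a)) *\<^sub>R \<Phi> n a - \<omega>)"
    by (simp only: norm_scaleR abs_norm_cancel)
  then have "norm (\<Phi> n a - norm (\<Phi> n a) *\<^sub>R \<omega>) \<le> \<eta> * norm (\<Phi> n a)"
    using mult_left_mono[OF less_imp_le[OF n(2)] norm_ge_zero[of "\<Phi> n a"]] by (simp only: mult.commute)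
  moreover have "SW (\<beta> n) x = SW (\<alpha> n) (x + \<Phi> n x)" for x
    using SW_displacement words_set \<Phi> by simp
  ultimately show "\<exists>\<alpha>\<in>words. \<exists>\<beta>\<in>words. \<exists>\<Phi>.
        (\<forall>x. SW \<beta> x = SW \<alpha> (x + \<Phi> x)) \<and> \<Phi> a \<noteq> 0 \<and> norm (\<Phi> a) \<le> \<delta> \<and>
        (\<forall>x. norm (\<Phi> x - \<Phi> a) \<le> L * norm (\<Phi> a) * norm (x - a)) \<and>
        norm (\<Phi> a - norm (\<Phi> a) *\<^sub>R \<omega>) \<le> \<eta> * norm (\<Phi> a)"
    using n \<Phi>(1,2)
    by (intro bexI[of _ "\<alpha> n"] bexI[of _ "\<beta> n"] exI[of _ "\<Phi> n"]) (simp_all add: less_imp_le)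
qed

text \<open>Minimality of \<open>a' k\<close> gives \<rho> times the operator norm at most the norm
  of \<open>\<Phi> k a\<close>, that is, the Lipschitz condition with \<open>1 / \<rho>\<close>. It
  also forces \<open>\<Phi> k a \<noteq> 0\<close>, since otherwise \<open>\<Phi> k\<close> would
  vanish identically and have cube norm 0.\<close>

lemma overlapping_direction_overlap:
  assumes "overlapping_direction m S F \<omega>"
  shows "\<exists>a L. overlap a L \<omega>"
proof -
  obtain \<alpha> \<beta> \<Phi> a \<rho> a' r where
    H: "\<forall>k::nat. \<alpha> k \<in> words \<and> \<beta> k \<in> words \<and> \<Phi> k = displacement S (\<alpha> k) (\<beta> k)"
      "\<forall>k. 0 < cube_norm (\<Phi> k)"
      "\<forall>k. is_arg_min (\<lambda>x. norm (\<Phi> k x)) (\<lambda>x. x \<in> cball a \<rho>) (a' k) \<and>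
        \<rho> * onorm (frechet_derivative (\<Phi> k) (at 0)) \<le> norm (\<Phi> k (a' k))"
    and cube: "(\<lambda>k. cube_norm (\<Phi> k)) \<longlonglongrightarrow> 0" and a: "a \<in> F" and \<rho>: "0 < \<rho>"
    and r: "strict_mono (r :: nat \<Rightarrow> nat)"
    and lim: "(\<lambda>j. (1 / norm (\<Phi> (r j) a)) *\<^sub>R \<Phi> (r j) a) \<longlonglongrightarrow> \<omega>" and "\<omega> \<in> sphere 0 1"
    using assms unfolding overlapping_direction_def by (elim conjE exE) (rule that; assumption)
  then have words: "\<alpha> k \<in> words" "\<beta> k \<in> words" and \<Phi>: "\<Phi> k = displacement S (\<alpha> k) (\<beta> k)"
    and cube_pos: "0 < cube_norm (\<Phi> k)"
    and arg: "is_arg_min (\<lambda>x. norm (\<Phi> k x)) (\<lambda>x. x \<in> cball a \<rho>) (a' k)"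
    and D: "\<rho> * onorm (frechet_derivative (\<Phi> k) (at 0)) \<le> norm (\<Phi> k (a' k))"
    and \<omega>: "norm \<omega> = 1" for k
    by (blast, blast, blast, blast, blast, blast, simp)
  have "\<exists>M v. \<forall>x. \<Phi> k x = M *v x + v" for k
    using displacement_affine words words_set \<Phi> by simp
  then obtain M v where Mv: "\<And>k x. \<Phi> k x = M k *v x + v k" by metis
  have der: "frechet_derivative (\<Phi> k) (at 0) = (*v) (M k)" for k
  proof -
    have "((\<lambda>x. M k *v x + v k) has_derivative (*v) (M k)) (at 0)"
      by (rule has_derivative_add_const)
        (rule bounded_linear_imp_has_derivative, rule matrix_vector_mul_bounded_linear)
    then show ?thesis
      using frechet_derivative_at[of "\<Phi> k"] Mv by (metis (no_types, lifting) ext)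
  qed
  have min: "norm (\<Phi> k (a' k)) \<le> norm (\<Phi> k a)" for k
    using arg[of k] \<rho> by (auto simp: is_arg_min_def not_less)
  have lip: "norm (\<Phi> k x - \<Phi> k a) \<le> 1 / \<rho> * norm (\<Phi> k a) * norm (x - a)" for k x
  proof -
    have "\<Phi> k x - \<Phi> k a = M k *v (x - a)"
      by (simp add: Mv matrix_vector_mult_diff_distrib)
    also have "norm \<dots> \<le> onorm ((*v) (M k)) * norm (x - a)"
      by (rule onorm[OF matrix_vector_mul_bounded_linear])
    also have "onorm ((*v) (M k)) \<le> norm (\<Phi> k a) / \<rho>"
      using order_trans[OF D min, of k] \<rho> by (simp add: der field_simps)
    then have "onorm ((*v) (M k)) * norm (x - a) \<le> norm (\<Phi> k a) / \<rho> * norm (x - a)"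
      by (intro mult_right_mono) auto
    finally show ?thesis by simp
  qed
  have nz: "\<Phi> k a \<noteq> 0" for k
  proof
    assume "\<Phi> k a = 0"
    then have "\<Phi> k x = 0" for x using lip[of k x] by simp
    then have "\<Phi> k = (\<lambda>_. 0)" by (intro ext)
    moreover have "cbox 0 1 \<noteq> ({} :: (real^'n) set)" using zero_in_cube by blast
    ultimately have "cube_norm (\<Phi> k) = 0" by (simp only: cube_norm_def norm_zero cSUP_const not_False_eq_True)
    with cube_pos[of k] show False by simp
  qed
  have cont: "continuous_on UNIV (\<Phi> k)" for k
  proof -
    have "\<Phi> k = (\<lambda>x. M k *v x + v k)" by (rule ext) (rule Mv)
    then show ?thesis by (simp only:) (intro continuous_intros)
  qed
  have bound: "norm (\<Phi> k a) \<le> cube_norm (\<Phi> k) * (1 + 2 * (\<Sum>i\<in>UNIV. \<bar>a $ i\<bar>))" for k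
    unfolding Mv[of k a]
  proof (rule norm_affine_le)
    show "norm (v k) \<le> cube_norm (\<Phi> k)"
      using norm_le_cube_norm[OF cont zero_in_cube, of k] by (simp add: Mv)
    show "norm (M k *v axis i 1 + v k) \<le> cube_norm (\<Phi> k)" for i
      using norm_le_cube_norm[OF cont axis_in_cube, of k] by (simp add: Mv)
  qed
  have "(\<lambda>k. \<Phi> k a) \<longlonglongrightarrow> 0"
    by (rule Lim_null_comparison[OF always_eventually[OF allI[OF bound]] tendsto_mult_left_zero[OF cube]])
  then have lim0: "(\<lambda>j. \<Phi> (r j) a) \<longlonglongrightarrow> 0"
    using LIMSEQ_subseq_LIMSEQ[OF _ r] by (auto simp: o_def)
  have ev: "\<forall>\<^sub>F j in sequentially. \<Phi> (r j) a \<noteq> 0 \<and>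
      (\<forall>x. norm (\<Phi> (r j) x - \<Phi> (r j) a) \<le> 1 / \<rho> * norm (\<Phi> (r j) a) * norm (x - a))"
    by (intro always_eventually allI conjI nz lip)
  have "overlap a (1 / \<rho>) \<omega>"
    by (rule overlapI[where \<Phi> = "\<lambda>j. \<Phi> (r j)" and \<alpha> = "\<lambda>j. \<alpha> (r j)" and \<beta> = "\<lambda>j. \<beta> (r j)",
          OF a _ \<omega> words \<Phi> lim0 lim ev]) (use \<rho> in simp)
  then show ?thesis by (intro exI)
qed

text \<open>A neighbourhood of \<open>id\<close> for pointwise convergence may test the finitely
  many points 0 and \<open>axis i 1\<close>, and these control an affine map everywhere.\<close>

lemma not_weak_separation_approx:
  assumes "\<not> weak_separation m S" "0 < e"
  shows "\<exists>\<alpha>\<in>words. \<exists>\<beta>\<in>words. \<exists>M v. (M, v) \<noteq> 0 \<and> (\<forall>x. displacement S \<alpha> \<beta> x = M *v x + v) \<and>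
    norm v \<le> e \<and> (\<forall>i. norm (M *v axis i 1 + v) \<le> e)"
proof -
  define P where "P = insert 0 (range (\<lambda>i. axis i 1 :: real^'n))"
  define U where "U = (\<Inter>x\<in>P. (\<lambda>f::real^'n \<Rightarrow> real^'n. f x) -` ball x e)"
  have "open U"
    unfolding U_def
  proof (intro open_INT ballI)
    show "finite P" by (simp add: P_def)
    show "open ((\<lambda>f::real^'n \<Rightarrow> real^'n. f x) -` ball x e)" for x
      by (rule open_vimage[OF open_ball continuous_on_product_coordinates])
  qed
  moreover have "id \<in> U" using assms(2) by (simp add: U_def)
  then have "U \<inter> closure (quotient_maps m S - {id}) \<noteq> {}"
    using assms(1) unfolding weak_separation_def by blast
  ultimately have "U \<inter> (quotient_maps m S - {id}) \<noteq> {}"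
    by (simp only: open_Int_closure_eq_empty not_False_eq_True)
  then obtain f where f: "f \<in> quotient_maps m S" "f \<noteq> id" "f \<in> U"
    by blast
  obtain \<alpha> \<beta> where ab: "\<alpha> \<in> words" "\<beta> \<in> words" "f = inv (SW \<alpha>) \<circ> SW \<beta>"
    using f(1) by (auto simp: quotient_maps_def)
  obtain M v where Mv: "\<And>x. displacement S \<alpha> \<beta> x = M *v x + v"
    using displacement_affine ab words_set by metis
  have fx: "f x - x = M *v x + v" for x
    using Mv[of x] ab(3) by (simp add: displacement_def)
  have nz: "(M, v) \<noteq> 0"
  proof
    assume "(M, v) = 0"
    then have "f = id" using fx by (auto simp: zero_prod_def)
    with f(2) show False ..
  qed
  have Psmall: "norm (f x - x) \<le> e" if "x \<in> P" for x
    using f(3) that by (auto simp: U_def dist_norm norm_minus_commute)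
  have small: "norm v \<le> e" "norm (M *v axis i 1 + v) \<le> e" for i
    using Psmall[of 0, unfolded fx] Psmall[of "axis i 1", unfolded fx] by (simp_all add: P_def)
  show ?thesis
    by (intro bexI[OF _ ab(1)] bexI[OF _ ab(2)] exI[of _ M] exI[of _ v] conjI allI nz Mv small)
qed

text \<open>The pairs \<open>(M n, v n)\<close> are normalised to the unit sphere of a
  finite-dimensional space and converge along a subsequence. Nondegeneracy of \<open>F\<close> gives
  \<open>a\<close> where the limit map is nonzero; there \<open>\<Phi> n a\<close> is comparable to
  the whole pair, which is the Lipschitz condition.\<close>

lemma exists_overlap:
  assumes nondeg: "\<not> in_some_hyperplane F" and wsp: "\<not> weak_separation m S"
  shows "\<exists>a L \<omega>. overlap a L \<omega>"
proof -
  have "\<forall>n. \<exists>\<alpha> \<beta> M v. \<alpha> \<in> words \<and> \<beta> \<in> words \<and> (M, v) \<noteq> 0 \<and> (\<forall>x. displacement S \<alpha> \<beta> x = M *v x + v) \<and>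
    norm v \<le> 1 / real (Suc n) \<and> (\<forall>i. norm (M *v axis i 1 + v) \<le> 1 / real (Suc n))"
    using not_weak_separation_approx[OF wsp] by (metis of_nat_0_less_iff zero_less_Suc zero_less_divide_1_iff)
  then obtain \<alpha> \<beta> M v where words: "\<And>n. \<alpha> n \<in> words" "\<And>n. \<beta> n \<in> words"
    and nz: "\<And>n. (M n, v n) \<noteq> 0" and Mv: "\<And>n x. displacement S (\<alpha> n) (\<beta> n) x = M n *v x + v n"
    and small: "\<And>n. norm (v n) \<le> 1 / real (Suc n)" "\<And>n i. norm (M n *v axis i 1 + v n) \<le> 1 / real (Suc n)"
    unfolding choice_iff by (elim exE) (rule that; blast)
  define N where "N n = norm (M n, v n)" for n
  have N: "0 < N n" for n using nz by (simp add: N_def)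
  define u where "u n = (1 / N n) *\<^sub>R (M n, v n)" for n
  have "u n \<in> sphere 0 1" for n
    using N[of n] unfolding mem_sphere_0 u_def norm_scaleR N_def[symmetric] by simp
  then obtain u0 r where u0: "u0 \<in> sphere 0 1" "strict_mono r" "(u \<circ> r) \<longlonglongrightarrow> u0"
    using compact_sphere[of "0 :: (real^'n^'n) \<times> (real^'n)" 1] unfolding compact_def by blast
  have "(fst u0, snd u0) \<noteq> 0" using u0(1) by auto
  then obtain a where a: "a \<in> F" "fst u0 *v a + snd u0 \<noteq> 0"
    using affine_nonzero_on_nondegenerate[OF nondeg F_nonempty] by blast
  define z where "z = fst u0 *v a + snd u0"
  define \<Phi> where "\<Phi> n = displacement S (\<alpha> (r n)) (\<beta> (r n))" for n
  define q where "q n = (1 / N (r n)) *\<^sub>R \<Phi> n a" for n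
  have nz0: "0 < norm z" using a by (simp add: z_def)
  have qeq: "q n = fst (u (r n)) *v a + snd (u (r n))" for n
    by (simp add: q_def \<Phi>_def Mv u_def scaleR_right_distrib scaleR_matrix_vector_assoc)
  have "(\<lambda>n. u (r n)) \<longlonglongrightarrow> u0" using u0(3) by (simp add: o_def)
  then have q: "q \<longlonglongrightarrow> z"
    unfolding z_def qeq[abs_def] by (intro tendsto_add tendsto_matrix_vector_mult tendsto_fst tendsto_snd)
  have "(\<lambda>n. (1 / norm (q n)) *\<^sub>R q n) \<longlonglongrightarrow> (1 / norm z) *\<^sub>R z"
    using q nz0 by (intro tendsto_intros) auto
  moreover have "(1 / norm (q n)) *\<^sub>R q n = (1 / norm (\<Phi> n a)) *\<^sub>R \<Phi> n a" for n
    using N[of "r n"] by (simp add: q_def)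
  ultimately have lim: "(\<lambda>n. (1 / norm (\<Phi> n a)) *\<^sub>R \<Phi> n a) \<longlonglongrightarrow> (1 / norm z) *\<^sub>R z" by simp
  have "norm (displacement S (\<alpha> n) (\<beta> n) a) \<le> 1 / real (Suc n) * (1 + 2 * (\<Sum>i\<in>UNIV. \<bar>a $ i\<bar>))" for n
    unfolding Mv by (intro norm_affine_le small)
  then have "\<forall>\<^sub>F n in sequentially.
      norm (displacement S (\<alpha> n) (\<beta> n) a) \<le> 1 / real (Suc n) * (1 + 2 * (\<Sum>i\<in>UNIV. \<bar>a $ i\<bar>))"
    by (intro always_eventually allI)
  moreover have "(\<lambda>n. 1 / real (Suc n) * (1 + 2 * (\<Sum>i\<in>UNIV. \<bar>a $ i\<bar>))) \<longlonglongrightarrow> 0"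
    by (intro tendsto_mult_left_zero lim_1_over_n[THEN LIMSEQ_Suc])
  ultimately have "(\<lambda>n. displacement S (\<alpha> n) (\<beta> n) a) \<longlonglongrightarrow> 0"
    by (rule Lim_null_comparison)
  then have lim0: "(\<lambda>n. \<Phi> n a) \<longlonglongrightarrow> 0"
    using LIMSEQ_subseq_LIMSEQ[OF _ u0(2)] by (auto simp: o_def \<Phi>_def)
  \<comment> \<open>Half of the limiting norm is retained eventually; this is the origin of the
    constant \<open>2 / norm z\<close>.\<close>
  have "\<forall>\<^sub>F n in sequentially. norm z / 2 < norm (q n)"
    using nz0 by (intro order_tendstoD(1)[OF tendsto_norm[OF q]]) auto
  then have ev: "\<forall>\<^sub>F n in sequentially. \<Phi> n a \<noteq> 0 \<and>
      (\<forall>x. norm (\<Phi> n x - \<Phi> n a) \<le> 2 / norm z * norm (\<Phi> n a) * norm (x - a))"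
  proof eventually_elim
    case (elim n)
    have qn: "norm (q n) * N (r n) = norm (\<Phi> n a)" using N[of "r n"] by (simp add: q_def)
    have "norm (\<Phi> n x - \<Phi> n a) \<le> 2 / norm z * norm (\<Phi> n a) * norm (x - a)" for x
    proof -
      have "\<Phi> n x - \<Phi> n a = M (r n) *v (x - a)"
        by (simp add: \<Phi>_def Mv matrix_vector_mult_diff_distrib)
      also have "norm \<dots> \<le> norm (M (r n)) * norm (x - a)" by (rule norm_matrix_vector_le)
      also have "norm (M (r n)) \<le> N (r n)"
        unfolding N_def by (metis norm_fst_le fst_conv)
      also have "N (r n) \<le> 2 / norm z * norm (\<Phi> n a)"
      proof -
        have "norm z / 2 * N (r n) \<le> norm (\<Phi> n a)"
          unfolding qn[symmetric] using elim N[of "r n"] by (intro mult_right_mono) auto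
        then show ?thesis using nz0 by (simp add: field_simps)
      qed
      finally show ?thesis by (simp add: mult_right_mono)
    qed
    moreover have "\<Phi> n a \<noteq> 0" using elim nz0 by (auto simp: q_def)
    ultimately show ?case by blast
  qed
  have "overlap a (2 / norm z) ((1 / norm z) *\<^sub>R z)"
    by (rule overlapI[where \<Phi> = \<Phi> and \<alpha> = "\<lambda>n. \<alpha> (r n)" and \<beta> = "\<lambda>n. \<beta> (r n)",
          OF a(1) _ _ _ _ \<Phi>_def lim0 lim ev]) (use nz0 words in simp_all)
  then show ?thesis by (intro exI)
qed

section \<open>Dimension gain in orthogonal directions\<close>

text \<open>By compactness of the sphere, widths tending to 0 would produce a direction in which
  \<open>F\<close> has width 0, hence a hyperplane containing \<open>F\<close>.\<close>

lemma uniform_width: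
  assumes nondeg: "\<not> in_some_hyperplane F"
  shows "\<exists>\<kappa>>0. \<forall>e. norm e = 1 \<longrightarrow> (\<exists>x\<in>F. \<exists>y\<in>F. \<kappa> \<le> (x - y) \<bullet> e)"
proof (rule ccontr)
  assume neg: "\<not> ?thesis"
  have "\<exists>e. norm e = 1 \<and> (\<forall>x\<in>F. \<forall>y\<in>F. (x - y) \<bullet> e \<le> 1 / real (Suc n))" for n
  proof -
    have "0 < 1 / real (Suc n)" by simp
    then show ?thesis using neg by (metis linear)
  qed
  then obtain f where f: "\<And>n. norm (f n) = 1" "\<And>n x y. x \<in> F \<Longrightarrow> y \<in> F \<Longrightarrow> (x - y) \<bullet> f n \<le> 1 / real (Suc n)"
    by metis
  have "f n \<in> sphere 0 1" for n using f(1) by simp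
  then obtain e r where e: "e \<in> sphere 0 1" "strict_mono r" "(f \<circ> r) \<longlonglongrightarrow> e"
    using compact_sphere[of "0 :: real^'n" 1] unfolding compact_def by blast
  have le: "(x - y) \<bullet> e \<le> 0" if "x \<in> F" "y \<in> F" for x y
  proof (rule LIMSEQ_le)
    show "(\<lambda>n. (x - y) \<bullet> (f \<circ> r) n) \<longlonglongrightarrow> (x - y) \<bullet> e"
      by (intro tendsto_intros e)
    show "(\<lambda>n. 1 / real (Suc (r n))) \<longlonglongrightarrow> 0"
      using LIMSEQ_subseq_LIMSEQ[OF lim_1_over_n[THEN LIMSEQ_Suc] e(2)] by (simp add: o_def)
    show "\<exists>N. \<forall>n\<ge>N. (x - y) \<bullet> (f \<circ> r) n \<le> 1 / real (Suc (r n))"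
      using f(2)[OF that] by (auto simp del: of_nat_Suc)
  qed
  obtain x0 where x0: "x0 \<in> F" using F_nonempty by blast
  have "F \<subseteq> {x. e \<bullet> x = e \<bullet> x0}"
  proof
    fix x assume "x \<in> F"
    then have "x \<bullet> e = x0 \<bullet> e"
      using le[of x x0] le[of x0 x] x0 by (simp add: inner_diff_left)
    then show "x \<in> {x. e \<bullet> x = e \<bullet> x0}"
      by (simp add: inner_commute)
  qed
  moreover have "e \<noteq> 0" using e(1) by auto
  then have "aff_dim {x. e \<bullet> x = e \<bullet> x0} = int CARD('n) - 1"
    by (simp add: aff_dim_hyperplane)
  moreover have "affine {x. e \<bullet> x = e \<bullet> x0}" by (rule affine_hyperplane)
  ultimately show False using nondeg unfolding in_some_hyperplane_def by blast
qed

lemma ratio_ge_power: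
  assumes "\<And>i. i \<in> {1..m} \<Longrightarrow> q \<le> c i" "0 < q" "set w \<subseteq> {1..m}"
  shows "q ^ length w \<le> ratio w"
  using assms(3)
proof (induction w)
  case (Cons i w)
  then show ?case
    using assms(1)[of i] assms(2) by (simp add: ratio_Cons mult_mono)
qed simp

text \<open>Every small copy of \<open>F\<close> has width comparable to its size in every direction \<open>e\<close>. Hence two points
  of \<open>F\<close> far apart in direction \<open>e\<close> can be replaced by small copies of \<open>F\<close> around them, and iterating
  gives a binary tree of points.\<close>

lemma separated_points:
  assumes nondeg: "\<not> in_some_hyperplane F"
  shows "\<exists>\<kappa> q. 0 < \<kappa> \<and> \<kappa> \<le> 1/2 \<and> 0 < q \<and> q < 1 \<and> (\<forall>n e. norm e = 1 \<longrightarrow>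
    (\<exists>Y\<subseteq>F. finite Y \<and> card Y = 2 ^ n \<and> (\<forall>y\<in>Y. \<forall>y'\<in>Y. y \<noteq> y' \<longrightarrow> \<kappa> * q ^ n \<le> \<bar>(y - y') \<bullet> e\<bar>)))"
proof -
  obtain \<kappa>0 where \<kappa>0: "0 < \<kappa>0" "\<And>e. norm e = 1 \<Longrightarrow> \<exists>x\<in>F. \<exists>y\<in>F. \<kappa>0 \<le> (x - y) \<bullet> e"
    using uniform_width[OF nondeg] by blast
  \<comment> \<open>With \<open>2 * \<kappa> \<le> \<kappa>0\<close>, points within
    \<open>\<kappa> / 2\<close> of \<open>x\<close> and of \<open>y\<close> remain at least \<kappa>
    apart in direction \<open>e\<close>.\<close>
  define \<kappa> where "\<kappa> = min \<kappa>0 1 / 2"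
  have \<kappa>: "0 < \<kappa>" "\<kappa> \<le> 1/2" "2 * \<kappa> \<le> \<kappa>0" using \<kappa>0(1) by (auto simp: \<kappa>_def)
  obtain D where D: "0 < D" "\<And>x. x \<in> F \<Longrightarrow> norm x \<le> D"
    using F_bounded by (auto simp: bounded_pos)
  \<comment> \<open>As \<open>F\<close> has diameter at most \<open>2 * D\<close>, copies of this
    level have diameter at most \<open>\<kappa> / 2\<close>; \<open>0 < k\<close> also ensures
    \<open>q < 1\<close> below.\<close>
  obtain k where k: "0 < k" "\<And>w. set w \<subseteq> {1..m} \<Longrightarrow> length w = k \<Longrightarrow> ratio w < \<kappa> / (4 * D)"
    using small_words[of "\<kappa> / (4 * D)"] \<kappa>(1) D(1) by auto
  define q0 where "q0 = Min (c ` {1..m})"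
  have q0: "0 < q0" "q0 < 1" "\<And>i. i \<in> {1..m} \<Longrightarrow> q0 \<le> c i"
    using m c by (auto simp: q0_def Min_less_iff intro!: bexI[of _ 1])
  define q where "q = q0 ^ k"
  have q: "0 < q" "q < 1" using q0 k(1) by (auto simp: q_def power_less_one_iff)
  have rq: "q \<le> ratio w" if "set w \<subseteq> {1..m}" "length w = k" for w
    using ratio_ge_power[OF q0(3,1) that(1)] that(2) by (simp add: q_def)
  have "\<exists>Y\<subseteq>F. finite Y \<and> card Y = 2 ^ n \<and> (\<forall>y\<in>Y. \<forall>y'\<in>Y. y \<noteq> y' \<longrightarrow> \<kappa> * q ^ n \<le> \<bar>(y - y') \<bullet> e\<bar>)"
    if "norm e = 1" for n e
    using that
  proof (induction n arbitrary: e)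
    case 0
    obtain x where "x \<in> F" using F_nonempty by blast
    then show ?case by (intro exI[of _ "{x}"]) auto
  next
    case (Suc n)
    have copy: "\<exists>Y\<subseteq>F. finite Y \<and> card Y = 2 ^ n \<and> (\<forall>y\<in>Y. \<bar>(y - x) \<bullet> e\<bar> \<le> \<kappa> / 2) \<and>
        (\<forall>y\<in>Y. \<forall>y'\<in>Y. y \<noteq> y' \<longrightarrow> \<kappa> * q ^ Suc n \<le> \<bar>(y - y') \<bullet> e\<bar>)" if x: "x \<in> F" for x
    proof -
      obtain w x' where w: "length w = k" "set w \<subseteq> {1..m}" "x' \<in> F" "x = SW w x'"
        using F_word[OF x] by blast
      have orth: "orthogonal_matrix (OW w)" using OW_orthogonal w by blast
      \<comment> \<open>The copy is rotated by \<open>OW w\<close>, so the induction hypothesis is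
        needed in the direction rotated back; hence the induction is over all
        \<open>e\<close>.\<close>
      have "norm (transpose (OW w) *v e) = 1"
        using Suc.prems orth by (simp add: norm_orthogonal_matrix_mult del: transpose_matrix_vector)
      then obtain Y where Y: "Y \<subseteq> F" "finite Y" "card Y = 2 ^ n"
          "\<And>y y'. y \<in> Y \<Longrightarrow> y' \<in> Y \<Longrightarrow> y \<noteq> y' \<Longrightarrow> \<kappa> * q ^ n \<le> \<bar>(y - y') \<bullet> (transpose (OW w) *v e)\<bar>"
        using Suc.IH by metis
      have inner: "(SW w y - SW w y') \<bullet> e = ratio w * ((y - y') \<bullet> (transpose (OW w) *v e))" for y y'
      proof -
        have "(OW w *v (y - y')) \<bullet> e = (y - y') \<bullet> (transpose (OW w) *v e)"
          by (metis dot_lmul_matrix inner_commute transpose_matrix_vector)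
        then show ?thesis by (simp only: SW_diff[OF w(2)] inner_scaleR_left)
      qed
      have "inj_on (SW w) Y"
        using SW_bij(1)[OF w(2)] by (rule inj_on_subset) simp
      then have "card (SW w ` Y) = 2 ^ n" using Y by (simp add: card_image)
      moreover have "SW w ` Y \<subseteq> F" using SW_F[OF w(2)] Y(1) by blast
      moreover have "\<bar>(SW w y - x) \<bullet> e\<bar> \<le> \<kappa> / 2" if y: "y \<in> Y" for y
      proof -
        have "\<bar>(SW w y - x) \<bullet> e\<bar> \<le> norm (SW w y - SW w x')"
          using Cauchy_Schwarz_ineq2[of "SW w y - x" e] Suc.prems w(4) by simp
        also have "\<dots> = ratio w * norm (y - x')" by (rule norm_SW_diff[OF w(2)])
        also have "\<dots> \<le> \<kappa> / (4 * D) * (2 * D)"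
        proof (rule mult_mono)
          show "norm (y - x') \<le> 2 * D"
            using D(2)[of y] D(2)[OF w(3)] subsetD[OF Y(1) y] norm_triangle_ineq4[of y x'] by simp
        qed (use k(2)[OF w(2,1)] \<kappa> D in auto)
        finally show ?thesis using D by simp
      qed
      moreover have "\<kappa> * q ^ Suc n \<le> \<bar>(SW w y - SW w y') \<bullet> e\<bar>" if "y \<in> Y" "y' \<in> Y" "SW w y \<noteq> SW w y'" for y y'
      proof -
        have "q * (\<kappa> * q ^ n) \<le> ratio w * \<bar>(y - y') \<bullet> (transpose (OW w) *v e)\<bar>"
          using Y(4)[OF that(1,2)] that(3) rq[OF w(2,1)] \<kappa>(1) q(1) by (intro mult_mono) auto
        then show ?thesis
          using ratio_pos[OF w(2)] by (simp only: inner abs_mult) (simp add: mult_ac)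
      qed
      ultimately show ?thesis using Y(2) by (intro exI[of _ "SW w ` Y"]) auto
    qed
    obtain x y where xy: "x \<in> F" "y \<in> F" "\<kappa>0 \<le> (x - y) \<bullet> e"
      using \<kappa>0(2)[OF Suc.prems] by blast
    obtain X where X0: "X \<subseteq> F" "finite X" "card X = 2 ^ n" "\<forall>u\<in>X. \<bar>(u - x) \<bullet> e\<bar> \<le> \<kappa> / 2"
      "\<forall>u\<in>X. \<forall>u'\<in>X. u \<noteq> u' \<longrightarrow> \<kappa> * q ^ Suc n \<le> \<bar>(u - u') \<bullet> e\<bar>"
      using copy[OF xy(1)] by (elim exE conjE) (rule that; assumption)
    note X = X0(1-3) X0(4,5)[rule_format]
    obtain Y where Y0: "Y \<subseteq> F" "finite Y" "card Y = 2 ^ n" "\<forall>u\<in>Y. \<bar>(u - y) \<bullet> e\<bar> \<le> \<kappa> / 2"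
      "\<forall>u\<in>Y. \<forall>u'\<in>Y. u \<noteq> u' \<longrightarrow> \<kappa> * q ^ Suc n \<le> \<bar>(u - u') \<bullet> e\<bar>"
      using copy[OF xy(2)] by (elim exE conjE) (rule that; assumption)
    note Y = Y0(1-3) Y0(4,5)[rule_format]
    have qn: "\<kappa> * q ^ Suc n \<le> \<kappa>"
      using \<kappa>(1) q power_le_one[of q "Suc n"] by (simp add: mult_left_le del: power_Suc)
    have cross: "\<kappa> \<le> (u - u') \<bullet> e" if "u \<in> X" "u' \<in> Y" for u u'
    proof -
      have "(u - u') \<bullet> e = (x - y) \<bullet> e + (u - x) \<bullet> e - (u' - y) \<bullet> e"
        by (simp add: inner_diff_left)
      then show ?thesis
        using X(4)[OF that(1)] Y(4)[OF that(2)] xy(3) \<kappa>(3) by linarith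
    qed
    have "X \<inter> Y = {}" using cross \<kappa>(1) by force
    then have "card (X \<union> Y) = 2 ^ Suc n" using X Y by (simp add: card_Un_disjoint)
    moreover have "\<kappa> * q ^ Suc n \<le> \<bar>(u - u') \<bullet> e\<bar>" if uu: "u \<in> X \<union> Y" "u' \<in> X \<union> Y" "u \<noteq> u'" for u u'
    proof -
      consider "u \<in> X" "u' \<in> X" | "u \<in> Y" "u' \<in> Y" | "u \<in> X" "u' \<in> Y" | "u \<in> Y" "u' \<in> X"
        using uu by blast
      then show ?thesis
      proof cases
        case 1
        then show ?thesis using X(5) uu(3) by blast
      next
        case 2
        then show ?thesis using Y(5) uu(3) by blast
      next
        case 3
        then show ?thesis using cross[of u u'] qn by linarith
      next
        case 4
        have "(u - u') \<bullet> e = - ((u' - u) \<bullet> e)" by (simp add: inner_diff_left)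
        then show ?thesis using cross[of u' u] 4 qn by linarith
      qed
    qed
    ultimately show ?case using X(1,2) Y(1,2) by (intro exI[of _ "X \<union> Y"]) auto
  qed
  then show ?thesis
    using \<kappa> q by (intro exI[of _ \<kappa>] exI[of _ q]) blast
qed

text \<open>The \<open>2 ^ n\<close> points separated by \<open>\<kappa> * q ^ n\<close> along
  \<open>e\<close> multiply the grid along \<open>B\<close>. At scale \<open>1 / N\<close>
  comparable to \<open>q ^ n\<close> this adds \<open>ln 2 / (- ln q)\<close> to the exponent. The
  gain is the same for every exponent, so strictness survives the infimum.\<close>

lemma assouad_dim_gt_card:
  assumes nondeg: "\<not> in_some_hyperplane F" and ov: "overlap a L \<omega>"
    and B: "independent B" "B \<subseteq> (\<lambda>g. g *v \<omega>) ` G"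
    and e: "e \<noteq> 0" "\<And>b. b \<in> B \<Longrightarrow> b \<bullet> e = 0"
  shows "real (card B) < assouad_dim F"
proof -
  define e1 where "e1 = (1 / norm e) *\<^sub>R e"
  have e1: "norm e1 = 1" "\<And>b. b \<in> B \<Longrightarrow> b \<bullet> e1 = 0" using e by (auto simp: e1_def)
  obtain \<kappa> q where \<kappa>: "0 < \<kappa>" "\<kappa> \<le> 1/2" and q: "0 < q" "q < 1"
    and sep: "\<And>n. \<exists>Y\<subseteq>F. finite Y \<and> card Y = 2 ^ n \<and> (\<forall>y\<in>Y. \<forall>y'\<in>Y. y \<noteq> y' \<longrightarrow> \<kappa> * q ^ n \<le> \<bar>(y - y') \<bullet> e1\<bar>)"
    using separated_points[OF nondeg] e1(1) by (elim exE conjE) (rule that; blast)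
  define l where "l = card B"
  have "real l + ln 2 / (- ln q) \<le> \<alpha>" if \<alpha>: "assouad_exponent F \<alpha>" for \<alpha>
  proof -
    have \<alpha>': "assouad_exponent (id ` F) \<alpha>" using \<alpha> by simp
    have id: "\<forall>b\<in>B. id b = b" by simp
    \<comment> \<open>Makes \<open>\<alpha> - l\<close> nonnegative, so that \<open>N\<close> may be
      replaced by its upper bound \<open>2 / \<delta>\<close> below.\<close>
    have l\<alpha>: "real l \<le> \<alpha>"
      unfolding l_def by (rule card_le_exponent[OF ov B linear_id id \<alpha>'])
    obtain C where C: "\<forall>N\<ge>2. \<forall>Y. finite Y \<longrightarrow> Y \<subseteq> F \<longrightarrow>
      (\<forall>y\<in>Y. \<forall>y'\<in>Y. y \<noteq> y' \<longrightarrow> (\<forall>t. 1 / real N \<le> norm ((y - y') + (\<Sum>b\<in>B. t b *\<^sub>R b)))) \<longrightarrow>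
      real (card Y) * real N ^ card B \<le> C * real N powr \<alpha>"
      using exponent_count[OF ov B linear_id id \<alpha>'] unfolding id_apply by (elim exE) (rule that)
    have bound: "(2 * q powr (\<alpha> - l)) ^ n \<le> \<bar>C\<bar> * (2 / \<kappa>) powr (\<alpha> - l)" for n
    proof -
      obtain Y where Y: "Y \<subseteq> F" "finite Y" "card Y = 2 ^ n"
        and Ysep: "\<forall>y\<in>Y. \<forall>y'\<in>Y. y \<noteq> y' \<longrightarrow> \<kappa> * q ^ n \<le> \<bar>(y - y') \<bullet> e1\<bar>"
        using sep[of n] by (elim exE conjE) (rule that; assumption)
      define \<delta> where "\<delta> = \<kappa> * q ^ n"
      have "q ^ n \<le> 1" using q by (intro power_le_one) auto
      then have "\<delta> \<le> 1/2 * 1" unfolding \<delta>_def using \<kappa> q by (intro mult_mono) auto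
      then have \<delta>: "0 < \<delta>" "\<delta> \<le> 1/2" using \<kappa> q by (auto simp: \<delta>_def)
      have inv\<delta>: "2 \<le> 1 / \<delta>" using \<delta> by (simp add: field_simps)
      define N where "N = nat \<lceil>1 / \<delta>\<rceil>"
      have N: "1 / \<delta> \<le> real N" "real N \<le> 1 / \<delta> + 1" "2 \<le> N"
        using inv\<delta> unfolding N_def by linarith+
      have N1: "1 / real N \<le> \<delta>" using N \<delta> by (simp add: field_simps)
      have N2: "real N \<le> 2 / \<delta>" using N(2) inv\<delta> by simp
      have "1 / real N \<le> norm ((y - y') + (\<Sum>b\<in>B. t b *\<^sub>R b))" if "y \<in> Y" "y' \<in> Y" "y \<noteq> y'" for y y' t
      proof -
        have "(\<Sum>b\<in>B. t b *\<^sub>R b) \<bullet> e1 = 0" using e1(2) by (simp add: inner_sum_left)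
        then have "\<bar>(y - y') \<bullet> e1\<bar> = \<bar>((y - y') + (\<Sum>b\<in>B. t b *\<^sub>R b)) \<bullet> e1\<bar>"
          by (simp add: inner_add_left)
        also have "\<dots> \<le> norm ((y - y') + (\<Sum>b\<in>B. t b *\<^sub>R b))"
          using Cauchy_Schwarz_ineq2[of "(y - y') + (\<Sum>b\<in>B. t b *\<^sub>R b)" e1] e1(1) by simp
        finally show ?thesis using Ysep[rule_format, OF that] N1 by (simp add: \<delta>_def)
      qed
      then have "real (card Y) * real N ^ card B \<le> C * real N powr \<alpha>"
        using N(3) Y(1,2) by (intro C[rule_format])
      then have "2 ^ n * real N powr l \<le> C * real N powr \<alpha>"
        using Y(3) N(3) by (simp add: l_def powr_realpow)
      then have "2 ^ n \<le> C * real N powr (\<alpha> - l)"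
        using N(3) by (simp add: powr_diff field_simps)
      also have "\<dots> \<le> \<bar>C\<bar> * (2 / \<delta>) powr (\<alpha> - l)"
        using N2 l\<alpha> by (intro mult_mono powr_mono2) auto
      also have "2 / \<delta> = (2 / \<kappa>) / q ^ n" by (simp add: \<delta>_def)
      also have "((2 / \<kappa>) / q ^ n) powr (\<alpha> - l) = (2 / \<kappa>) powr (\<alpha> - l) / (q ^ n) powr (\<alpha> - l)"
        using \<kappa> q by (intro powr_divide)
      also have "(q ^ n) powr (\<alpha> - l) = (q powr (\<alpha> - l)) ^ n"
        using q by (simp add: powr_realpow[symmetric] powr_powr mult.commute)
      finally show ?thesis
        using q by (simp add: power_mult_distrib field_simps)
    qed
    \<comment> \<open>The bound is independent of \<open>n\<close>, whereas powers of a base above 1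
      are unbounded.\<close>
    have le1: "2 * q powr (\<alpha> - l) \<le> 1"
    proof (rule ccontr)
      assume "\<not> ?thesis"
      then obtain n where "\<bar>C\<bar> * (2 / \<kappa>) powr (\<alpha> - l) < (2 * q powr (\<alpha> - l)) ^ n"
        using real_arch_pow by (metis not_le)
      with bound[of n] show False by simp
    qed
    have "ln (2 * q powr (\<alpha> - l)) \<le> 0"
      using le1 q by simp
    then have "ln 2 + (\<alpha> - l) * ln q \<le> 0"
      using q by (simp add: ln_mult ln_powr)
    moreover have "ln q < 0" using q by simp
    ultimately have "ln 2 / (- ln q) \<le> \<alpha> - l"
      by (simp add: field_simps)
    then show ?thesis by simp
  qed
  then have "real l + ln 2 / (- ln q) \<le> assouad_dim F"
    using assouad_exponent_subspace[OF subspace_UNIV subset_UNIV, of F] by (intro assouad_dim_ge)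
  moreover have "0 < ln 2 / (- ln q)" using q by (intro divide_pos_pos) auto
  ultimately show ?thesis by (simp add: l_def)
qed

section \<open>Orbits of overlapping directions\<close>

lemma G_one: "mat 1 \<in> G"
proof -
  have "[1] \<in> words" using m by (auto simp: index_words_def)
  then have "OW [1] \<in> G" by (rule OW_in_G)
  then show ?thesis
    using G_mult[OF G_transpose, of "OW [1]" "OW [1]"] G_orthogonal[of "OW [1]"]
    by (simp add: orthogonal_matrix)
qed

lemma Q_in_G: "i \<in> {1..m} \<Longrightarrow> Q i \<in> G"
  using OW_in_G[of "[i]"] by (simp add: OW_Cons index_words_def)

lemma assouad_dim_F_ge:
  assumes "overlap a L \<omega>" "independent B" "B \<subseteq> (\<lambda>g. g *v \<omega>) ` G"
  shows "real (card B) \<le> assouad_dim F"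
  using assouad_dim_ge_card[OF assms linear_id] by simp

lemma assouad_dim_subspace_le:
  assumes "subspace V" "p ` F \<subseteq> V"
  shows "assouad_dim (p ` F) \<le> real (dim V)"
  using assouad_dim_le[OF assouad_exponent_subspace[OF assms]] F_nonempty by simp

lemma assouad_dim_F_le: "assouad_dim F \<le> real CARD('n)"
  using assouad_dim_subspace_le[OF subspace_UNIV, of id] by simp

lemma orbit_pair:
  assumes "overlap a L \<omega>" "A \<in> G" "A *v \<omega> \<notin> span {\<omega>}"
  shows "independent {A *v \<omega>, \<omega>}" "{A *v \<omega>, \<omega>} \<subseteq> (\<lambda>g. g *v \<omega>) ` G" "card {A *v \<omega>, \<omega>} = 2"
proof -
  have "\<omega> \<noteq> 0" using assms(1) by (auto simp: overlap_def)
  then show "independent {A *v \<omega>, \<omega>}"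
    using assms(3) by (simp add: independent_insert)
  have "\<omega> = mat 1 *v \<omega>" by simp
  then show "{A *v \<omega>, \<omega>} \<subseteq> (\<lambda>g. g *v \<omega>) ` G"
    using assms(2) G_one by blast
  show "card {A *v \<omega>, \<omega>} = 2"
    using assms(3) by (metis card_2_iff span_base singletonI)
qed

text \<open>For \<open>d \<ge> 2\<close> rotations act transitively on the unit sphere, so an
  orthonormal basis of the range of \<open>p\<close> lies in the orbit of \<omega>, and
  \<open>p\<close> fixes it.\<close>

lemma assouad_dim_projection:
  assumes d: "2 \<le> CARD('n)" and ov: "overlap a L \<omega>"
    and dense: "{A. rotation_matrix A} \<subseteq> G" and p: "p \<in> orth_projections k"
  shows "assouad_dim (p ` F) = real k"
proof -
  obtain V where V: "subspace V" "dim V = k" "\<And>x. p x \<in> V" "\<And>x v. v \<in> V \<Longrightarrow> orthogonal (x - p x) v"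
    using p unfolding orth_projections_def by blast
  note lin = orth_projections_linear[OF V(1,3,4)]
  obtain B where B: "B \<subseteq> V" "\<And>b. b \<in> B \<Longrightarrow> norm b = 1" "independent B" "card B = dim V"
    using orthonormal_basis_subspace[OF V(1)] by metis
  have "b \<in> (\<lambda>g. g *v \<omega>) ` G" if b: "b \<in> B" for b
  proof -
    have "norm \<omega> = norm b" using ov B(2)[OF b] by (simp add: overlap_def)
    then obtain f where f: "orthogonal_transformation f" "det (matrix f) = 1" "f \<omega> = b"
      using rotation_exists[OF d] by metis
    then have "rotation_matrix (matrix f)" "matrix f *v \<omega> = b"
      by (auto simp: rotation_matrix_def orthogonal_transformation_matrix)
    then show ?thesis using dense by (intro image_eqI[of _ _ "matrix f"]) auto
  qed
  then have "real (card B) \<le> assouad_dim (p ` F)"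
    using B(1) lin(2) by (intro assouad_dim_ge_card[OF ov B(3) _ lin(1)]) auto
  moreover have "assouad_dim (p ` F) \<le> real (dim V)"
    using V(1,3) by (intro assouad_dim_subspace_le) auto
  ultimately show ?thesis using B(4) V(2) by simp
qed

text \<open>If \<omega>, its image and its second image were dependent, the span of at most two of
  them would be a proper nonzero invariant subspace containing \<omega>.\<close>

lemma full_dimension_of_cyclic:
  assumes ov: "overlap a L \<omega>" and d: "CARD('n) = 3" and A: "A \<in> G"
    and inv: "\<And>V. invariant_subspace A V \<Longrightarrow> V \<noteq> {0} \<Longrightarrow> V \<noteq> UNIV \<Longrightarrow> \<omega> \<notin> V"
  shows "assouad_dim F = 3"
proof -
  have nz: "\<omega> \<noteq> 0" using ov by (auto simp: overlap_def)
  have small: "span B \<noteq> UNIV" if "finite B" "card B < 3" for B :: "(real^'n) set"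
  proof
    assume "span B = UNIV"
    then have "dim (UNIV :: (real^'n) set) \<le> card B"
      using that(1) by (intro span_card_ge_dim) auto
    with that(2) d show False by simp
  qed
  have no_inv: "\<not> (\<forall>b\<in>B. A *v b \<in> span B)" if "finite B" "card B < 3" "\<omega> \<in> B" for B
  proof
    assume *: "\<forall>b\<in>B. A *v b \<in> span B"
    have "A *v x \<in> span B" if "x \<in> span B" for x
    proof -
      have "A *v x \<in> span ((*v) A ` B)"
        using that linear_span_image[OF matrix_vector_mul_linear, of A B] by blast
      also have "\<dots> \<subseteq> span B"
        using * by (intro span_minimal) auto
      finally show ?thesis .
    qed
    then have "invariant_subspace A (span B)" by (simp add: invariant_subspace_def)
    moreover have "\<omega> \<in> span B" using that by (simp add: span_base)
    moreover have "span B \<noteq> {0}" using \<open>\<omega> \<in> span B\<close> nz by blast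
    ultimately show False using inv small[OF that(1,2)] by blast
  qed
  have 1: "A *v \<omega> \<notin> span {\<omega>}" using no_inv[of "{\<omega>}"] by auto
  note pair = orbit_pair[OF ov A 1]
  have 2: "A *v (A *v \<omega>) \<notin> span {A *v \<omega>, \<omega>}"
    using no_inv[of "{A *v \<omega>, \<omega>}"] pair(3) by (auto simp: span_base)
  let ?B = "insert (A *v (A *v \<omega>)) {A *v \<omega>, \<omega>}"
  have "independent ?B" using independent_insertI[OF 2 pair(1)] .
  moreover have "?B \<subseteq> (\<lambda>g. g *v \<omega>) ` G"
    using pair(2) G_mult[OF A A] by (auto simp: matrix_vector_mul_assoc)
  moreover have "A *v (A *v \<omega>) \<notin> {A *v \<omega>, \<omega>}" using 2 span_base by metis
  then have "card ?B = 3" using pair(3) by simp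
  ultimately have "3 \<le> assouad_dim F" using assouad_dim_F_ge[OF ov, of ?B] by simp
  then show ?thesis using assouad_dim_F_le d by simp
qed

text \<open>No eigenvector of \<open>Q i\<close> lies in \<open>V\<close>, so \<omega> and its image
  are independent in \<open>V\<close>; a normal vector of \<open>V\<close> is orthogonal to both and
  supplies the gain.\<close>

lemma dimension_gt_2_of_invariant_plane:
  assumes nondeg: "\<not> in_some_hyperplane F" and ov: "overlap a L \<omega>" and d: "CARD('n) = 3"
    and i: "i \<in> {1..m}" "contains_rotation (Q i) \<theta>" "sin \<theta> \<noteq> 0"
    and V: "invariant_subspace (Q i) V" "dim V = 2" "\<omega> \<in> V"
  shows "2 < assouad_dim F"
proof -
  have "\<omega> \<noteq> 0" using ov by (auto simp: overlap_def)
  then have no: "Q i *v \<omega> \<notin> span {\<omega>}"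
    by (rule contains_rotation_no_eigenvector[OF i(2,3) _ V])
  note pair = orbit_pair[OF ov Q_in_G[OF i(1)] no]
  have "dim V < DIM(real^'n)" using V(2) d by simp
  then obtain e where e: "e \<noteq> 0" "\<And>y. y \<in> span V \<Longrightarrow> orthogonal e y"
    using orthogonal_to_subspace_exists by metis
  have "b \<bullet> e = 0" if "b \<in> {Q i *v \<omega>, \<omega>}" for b
  proof -
    have "b \<in> V" using that V by (auto simp: invariant_subspace_def)
    then show ?thesis using e(2)[of b] by (simp add: span_base orthogonal_def inner_commute)
  qed
  then have "real (card {Q i *v \<omega>, \<omega>}) < assouad_dim F"
    by (rule assouad_dim_gt_card[OF nondeg ov pair(1,2) e(1)])
  then show ?thesis unfolding pair(3) by simp
qed

end

theorem corollary1p6: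
  fixes m :: nat
    and S :: "nat \<Rightarrow> real^'n \<Rightarrow> real^'n"
    and Q :: "nat \<Rightarrow> real^'n^'n"
    and F :: "(real^'n) set"
  assumes d: "2 \<le> CARD('n)"
    and ifs: "similitude_ifs m S Q"
    and F: "attractor m S F"
    and nondegenerate: "\<not> in_some_hyperplane F"
    and no_wsp: "\<not> weak_separation m S"
  shows
    "(dense_in_set (orth_parts m Q) {A. orthogonal_matrix A} \<or>
      dense_in_set (orth_parts m Q) {A. rotation_matrix A} \<longrightarrow>
        assouad_dim F = real CARD('n) \<and>
        (\<forall>k. \<forall>p\<in>orth_projections k. assouad_dim (p ` F) = real k))
   \<and> ((\<exists>v. overlapping_direction m S F v \<and>
        (\<exists>A\<in>orth_group m Q. \<forall>V. invariant_subspace A V \<and> dim V = 1 \<longrightarrow> v \<notin> V)) \<longrightarrow>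
        2 \<le> assouad_dim F)
   \<and> (CARD('n) = 2 \<and>
        (\<exists>i\<in>{1..m}. \<exists>\<theta>\<in>{0..<2*pi} - {0, pi}. plane_rotation (Q i) \<theta>) \<longrightarrow>
        assouad_dim F = 2)
   \<and> (CARD('n) = 3 \<longrightarrow>
        (\<forall>i\<in>{1..m}. (\<exists>\<theta>\<in>{0..<2*pi} - {0, pi}. contains_rotation (Q i) \<theta>) \<longrightarrow>
          ((\<exists>v. overlapping_direction m S F v \<and>
             (\<forall>V. invariant_subspace (Q i) V \<and> V \<noteq> {0} \<and> V \<noteq> UNIV \<longrightarrow> v \<notin> V)) \<longrightarrow>
             assouad_dim F = 3) \<and>
          ((\<exists>v. overlapping_direction m S F v \<and>
             (\<exists>V. invariant_subspace (Q i) V \<and> dim V = 2 \<and> v \<in> V)) \<longrightarrow>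
             2 < assouad_dim F)))"
proof -
  have "\<forall>i\<in>{1..m}. \<exists>c b. 0 < c \<and> c < 1 \<and> S i = (\<lambda>x. c *\<^sub>R (Q i *v x) + b)"
    using ifs by (simp add: similitude_ifs_def)
  then obtain c b where cb: "\<forall>i\<in>{1..m}. 0 < c i \<and> c i < 1 \<and> S i = (\<lambda>x. c i *\<^sub>R (Q i *v x) + b i)"
    unfolding bchoice_iff by blast
  interpret self_similar m S Q c b F
    using ifs F cb by unfold_locales (auto simp: similitude_ifs_def)
  \<comment> \<open>This overlap serves the density case and the planar case, where no overlapping
    direction is given.\<close>
  obtain a L \<omega> where ov: "overlap a L \<omega>"
    using exists_overlap[OF nondegenerate no_wsp] by blast
  show ?thesis
  proof (intro conjI impI allI ballI; (elim exE bexE conjE)?)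
    assume "dense_in_set (orth_parts m Q) {A. orthogonal_matrix A} \<or>
      dense_in_set (orth_parts m Q) {A. rotation_matrix A}"
    then have dense: "{A. rotation_matrix A} \<subseteq> G"
      by (auto simp: dense_in_set_def orth_group_def rotation_matrix_def)
    then show "assouad_dim (p ` F) = real k" if "p \<in> orth_projections k" for k p
      using assouad_dim_projection[OF d ov _ that] by blast
    \<comment> \<open>The dimension of \<open>F\<close> itself is the case of the projection onto
      the whole space.\<close>
    have "(id :: real^'n \<Rightarrow> real^'n) \<in> orth_projections CARD('n)"
      unfolding orth_projections_def by (auto intro!: exI[of _ UNIV] simp: orthogonal_def)
    then show "assouad_dim F = real CARD('n)"
      using assouad_dim_projection[OF d ov dense] by fastforce
  next
    fix v A assume v: "overlapping_direction m S F v" and A: "A \<in> orth_group m Q"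
      "\<forall>V. invariant_subspace A V \<and> dim V = 1 \<longrightarrow> v \<notin> V"
    obtain a L where ov: "overlap a L v"
      using overlapping_direction_overlap[OF v] by blast
    then have "v \<noteq> 0" by (auto simp: overlap_def)
    have "A *v v \<notin> span {v}"
    proof
      assume "A *v v \<in> span {v}"
      then have "invariant_subspace A (span {v})"
        by (auto simp: invariant_subspace_def span_singleton matrix_vector_mult_scaleR
            intro: subspace_span[of "{v}", unfolded span_singleton])
      moreover have "dim (span {v}) = 1" using \<open>v \<noteq> 0\<close> by (simp add: dim_insert)
      ultimately show False using A(2) by (metis span_base singletonI)
    qed
    note pair = orbit_pair[OF ov A(1) this]
    show "2 \<le> assouad_dim F"
      using assouad_dim_F_ge[OF ov pair(1,2)] unfolding pair(3) by simp
  next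
    fix i \<theta> assume i: "CARD('n) = 2" "i \<in> {1..m}" "\<theta> \<in> {0..<2*pi} - {0, pi}" "plane_rotation (Q i) \<theta>"
    have "\<omega> \<noteq> 0" using ov by (auto simp: overlap_def)
    then have "Q i *v \<omega> \<notin> span {\<omega>}"
      using plane_rotation_no_eigenvector[OF i(4) sin_nonzero[OF i(3)]] by blast
    note pair = orbit_pair[OF ov Q_in_G[OF i(2)] this]
    have "2 \<le> assouad_dim F"
      using assouad_dim_F_ge[OF ov pair(1,2)] unfolding pair(3) by simp
    then show "assouad_dim F = 2"
      using assouad_dim_F_le i(1) by simp
  next
    fix i v assume i: "CARD('n) = 3" "i \<in> {1..m}" and v: "overlapping_direction m S F v"
      "\<forall>V. invariant_subspace (Q i) V \<and> V \<noteq> {0} \<and> V \<noteq> UNIV \<longrightarrow> v \<notin> V"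
    obtain a L where ov: "overlap a L v"
      using overlapping_direction_overlap[OF v(1)] by blast
    show "assouad_dim F = 3"
      by (rule full_dimension_of_cyclic[OF ov i(1) Q_in_G[OF i(2)]]) (use v(2) in blast)
  next
    fix i \<theta> v V assume i: "CARD('n) = 3" "i \<in> {1..m}" "\<theta> \<in> {0..<2*pi} - {0, pi}"
      "contains_rotation (Q i) \<theta>" and v: "overlapping_direction m S F v"
      and V: "invariant_subspace (Q i) V" "dim V = 2" "v \<in> V"
    obtain a L where ov: "overlap a L v"
      using overlapping_direction_overlap[OF v] by blast
    show "2 < assouad_dim F"
      by (rule dimension_gt_2_of_invariant_plane[OF nondegenerate ov i(1,2,4) sin_nonzero[OF i(3)] V])
  qed
qed

end
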